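(* Let $A$ be a topological group. If $(S,\mathscr{S},l)$ and $(T,\mathscr{T},m)$ are finite $A$-monomial simplicial complexes and $(f,\lambda),(f',\lambda')\colon(S,\mathscr{S},l)\to(T,\mathscr{T},m)$ are homotopic morphisms in $\mathsf{simp}^A$, then their realizations $(|f,\lambda|,|f|)$ and $(|f',\lambda'|,|f'|)$ are homotopic in $\mathsf{Top}^A$. In particular, the realization functor $|\cdot|\colon\mathsf{simp}^A\to\mathsf{Top}^A$ induces a functor $\overline{|\cdot|}\colon\mathscr{H}(\mathsf{simp}^A)\to\mathscr{H}(\mathsf{Top}^A)$ such that $\overline{|\cdot|}\circ Q=Q'\circ|\cdot|$, where $Q\colon\mathsf{simp}^A\to\mathscr{H}(\mathsf{simp}^A)$ and $Q'\colon\mathsf{Top}^A\to\mathscr{H}(\mathsf{Top}^A)$ are the canonical functors (identity on objects, sending a morphism to its homotopy class).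
   Context: $A$-monomial simplicial complexes. A simplicial complex is a pair $(S,\mathscr{S})$, $S$ a set and $\mathscr{S}$ a set of nonempty finite subsets of $S$ (simplices) containing all singletons and closed under taking nonempty subsets. A simplicial map $(S,\mathscr S)\to(T,\mathscr T)$ is a map $f\colon S\to T$ with $f(\sigma)\in\mathscr{T}$ for all $\sigma\in\mathscr{S}$. An $A$-monomial simplicial complex is a triple $(S,\mathscr{S},l)$ with $(S,\mathscr S)$ a simplicial complex and $l$ assigning to each pair $\sigma\subseteq\sigma'$ in $\mathscr{S}$ an element $l(\sigma,\sigma')\in A$ with $l(\sigma',\sigma'')\,l(\sigma,\sigma')=l(\sigma,\sigma'')$ for $\sigma\subseteq\sigma'\subseteq\sigma''$ and $l(\sigma,\sigma)=1_A$. A morphism $(S,\mathscr{S},l)\to(T,\mathscr{T},m)$ is a pair $(f,\lambda)$ with $f$ a simplicial map and $\lambda\colon\mathscr{S}\to A$ a function with $m(f(\sigma),f(\sigma'))\,\lambda(\sigma)=\lambda(\sigma')\,l(\sigma,\sigma')$ for $\sigma\subseteq\sigma'$. Composition: $(e,\mu)\circ(f,\lambda)=(e\circ f,\ \sigma\mapsto\mu(f(\sigma))\lambda(\sigma))$. The category of these is $\mathsf{Simp}^A$; $\mathsf{simp}^A$ is the full subcategory of finite ones ($S$ finite). Homotopy of such morphisms. Morphisms $(f,\lambda),(f',\lambda')\colon(S,\mathscr S,l)\to(T,\mathscr T,m)$ are contiguous if for every $\sigma\in\mathscr{S}$: $f(\sigma)\cup f'(\sigma)\in\mathscr{T}$ and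 $m(f(\sigma),f(\sigma)\cup f'(\sigma))\,\lambda(\sigma)=m(f'(\sigma),f(\sigma)\cup f'(\sigma))\,\lambda'(\sigma)$. Homotopic means related by the transitive closure of contiguity. Homotopy is compatible with composition; $\mathscr{H}(\mathsf{simp}^A)$ has the objects of $\mathsf{simp}^A$ and homotopy classes of morphisms. $A$-fibered bundles. An $A$-fibered bundle is a surjective continuous map $\pi\colon E\to X$ where $A$ acts on the space $E$ via homeomorphisms, $X$ has the trivial $A$-action, $\pi$ is $A$-equivariant, and each $x\in X$ has an open neighborhood $U$ with an $A$-equivariant homeomorphism $\pi^{-1}(U)\to U\times A$ over $U$ (where $a(u,b)=(u,ab)$). A morphism from $\pi\colon E\to X$ to $\pi'\colon E'\to X'$ is a pair $(\varphi,f)$ with $f\colon X\to X'$ continuous, $\varphi\colon E\to E'$ continuous and $A$-equivariant, and $\pi'\varphi=f\pi$. This is the category $\mathsf{Top}^A$. Morphisms $(\varphi,f),(\varphi',f')$ are homotopic if there are a continuous $A$-equivariant map $H\colon E\times I\to E'$ ($I=[0,1]$ with trivial $A$-action) and a continuous map $h\colon X\times I\to X'$ with $\pi'\circ H=h\circ(\pi\times\mathrm{id}_I)$, $H(\cdot,0)=\varphi$, $H(\cdot,1)=\varphi'$, $h(\cdot,0)=f$, $h(\cdot,1)=f'$. This is an equivalence relation compatible with composition; $\mathscr{H}(\mathsf{Top}^A)$ has the objects of $\mathsf{Top}^A$ and homotopy classes of morphisms. The functor $|\cdot|\colon\mathsf{simp}^A\to\mathsf{Top}^A$. For a finite simplicial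 complex $(S,\mathscr S)$, let $|S,\mathscr{S}|=\{\alpha\in\mathbb{R}^S\mid \alpha(s)\ge0\ \forall s,\ \mathrm{supp}(\alpha)\in\mathscr{S},\ \sum_{s}\alpha(s)=1\}$ with $\mathrm{supp}(\alpha)=\{s\mid\alpha(s)\ne0\}$, the usual geometric realization (the quotient of $\coprod_{\sigma\in\mathscr S}|\sigma|$, where $|\sigma|=\{\alpha\in\mathbb{R}^\sigma\mid\alpha\ge0,\ \sum_{s\in\sigma}\alpha(s)=1\}$, identifying points that are equal in $\mathbb{R}^S$ after extension by $0$). For a simplicial map $f\colon(S,\mathscr S)\to(T,\mathscr T)$, $|f|(\alpha)(t)=\sum_{s\in f^{-1}(t)}\alpha(s)$. For a finite $A$-monomial simplicial complex $(S,\mathscr S,l)$, let $E_{(S,\mathscr S,l)}=\coprod_{\sigma\in\mathscr S}|\sigma|\times A$, with points written $(\sigma,\alpha,a)$, and let $|S,\mathscr S,l|=E_{(S,\mathscr S,l)}/\!\sim$ with the quotient topology, where $(\sigma,\alpha,a)\sim(\tau,\beta,b)$ iff $\alpha=\beta$ in $\mathbb{R}^S$ and $a\,l(\mathrm{supp}(\alpha),\sigma)=b\,l(\mathrm{supp}(\beta),\tau)$. $A$ acts by $b\cdot[\sigma,\alpha,a]=[\sigma,\alpha,ba]$. The functor sends $(S,\mathscr S,l)$ to the $A$-fibered bundle $\pi\colon|S,\mathscr S,l|\to|S,\mathscr S|$, $[\sigma,\alpha,a]\mapsto\alpha$, and a morphism $(f,\lambda)\colon(S,\mathscr S,l)\to(T,\mathscr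 T,m)$ to the pair $(|f,\lambda|,|f|)$ with $|f,\lambda|([\sigma,\alpha,a])=[f(\sigma),|f|(\alpha),a\lambda(\sigma)^{-1}]$. *)

theory Defs
  imports "HOL-Analysis.Analysis" "HOL-Algebra.Group_Action"
begin

section \<open>Categories and functors\<close>

text \<open>
  Composition takes the three objects as arguments because morphisms are represented by
  extensional functions, whose composition depends on the domain.
  \<open>Cmp C X Y Z g f\<close> is the composite of \<open>f \<in> Hom C X Y\<close> and \<open>g \<in> Hom C Y Z\<close>.
  Hom-sets of different pairs of objects need not be disjoint.
\<close>

record ('o, 'm) category =
  Ob :: "'o set"
  Hom :: "'o \<Rightarrow> 'o \<Rightarrow> 'm set"
  Idn :: "'o \<Rightarrow> 'm"
  Cmp :: "'o \<Rightarrow> 'o \<Rightarrow> 'o \<Rightarrow> 'm \<Rightarrow> 'm \<Rightarrow> 'm"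

definition is_category :: "('o, 'm) category \<Rightarrow> bool" where
  "is_category C \<longleftrightarrow>
     (\<forall>X\<in>Ob C. Idn C X \<in> Hom C X X) \<and>
     (\<forall>X\<in>Ob C. \<forall>Y\<in>Ob C. \<forall>Z\<in>Ob C. \<forall>f\<in>Hom C X Y. \<forall>g\<in>Hom C Y Z.
        Cmp C X Y Z g f \<in> Hom C X Z) \<and>
     (\<forall>X\<in>Ob C. \<forall>Y\<in>Ob C. \<forall>f\<in>Hom C X Y.
        Cmp C X X Y f (Idn C X) = f \<and> Cmp C X Y Y (Idn C Y) f = f) \<and>
     (\<forall>W\<in>Ob C. \<forall>X\<in>Ob C. \<forall>Y\<in>Ob C. \<forall>Z\<in>Ob C.
        \<forall>f\<in>Hom C W X. \<forall>g\<in>Hom C X Y. \<forall>h\<in>Hom C Y Z.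
        Cmp C W X Z (Cmp C X Y Z h g) f = Cmp C W Y Z h (Cmp C W X Y g f))"

record ('o1, 'm1, 'o2, 'm2) cat_map =
  on_ob :: "'o1 \<Rightarrow> 'o2"
  on_hom :: "'o1 \<Rightarrow> 'o1 \<Rightarrow> 'm1 \<Rightarrow> 'm2"

definition is_functor ::
  "('o1, 'm1) category \<Rightarrow> ('o2, 'm2) category \<Rightarrow> ('o1, 'm1, 'o2, 'm2) cat_map \<Rightarrow> bool" where
  "is_functor C D F \<longleftrightarrow>
     is_category C \<and> is_category D \<and>
     (\<forall>X\<in>Ob C. on_ob F X \<in> Ob D) \<and>
     (\<forall>X\<in>Ob C. \<forall>Y\<in>Ob C. \<forall>f\<in>Hom C X Y. on_hom F X Y f \<in> Hom D (on_ob F X) (on_ob F Y)) \<and>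
     (\<forall>X\<in>Ob C. on_hom F X X (Idn C X) = Idn D (on_ob F X)) \<and>
     (\<forall>X\<in>Ob C. \<forall>Y\<in>Ob C. \<forall>Z\<in>Ob C. \<forall>f\<in>Hom C X Y. \<forall>g\<in>Hom C Y Z.
        on_hom F X Z (Cmp C X Y Z g f) =
        Cmp D (on_ob F X) (on_ob F Y) (on_ob F Z) (on_hom F Y Z g) (on_hom F X Y f))"

definition functor_comp ::
  "('o2, 'm2, 'o3, 'm3) cat_map \<Rightarrow> ('o1, 'm1, 'o2, 'm2) cat_map \<Rightarrow> ('o1, 'm1, 'o3, 'm3) cat_map"
  where
  "functor_comp G F =
     \<lparr>on_ob = \<lambda>X. on_ob G (on_ob F X),
      on_hom = \<lambda>X Y f. on_hom G (on_ob F X) (on_ob F Y) (on_hom F X Y f)\<rparr>"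

text \<open>Equality of functors with source \<open>C\<close>; values outside \<open>C\<close> are irrelevant.\<close>

definition functor_eq ::
  "('o1, 'm1) category \<Rightarrow> ('o1, 'm1, 'o2, 'm2) cat_map \<Rightarrow> ('o1, 'm1, 'o2, 'm2) cat_map \<Rightarrow> bool"
  where
  "functor_eq C F G \<longleftrightarrow>
     (\<forall>X\<in>Ob C. on_ob F X = on_ob G X) \<and>
     (\<forall>X\<in>Ob C. \<forall>Y\<in>Ob C. \<forall>f\<in>Hom C X Y. on_hom F X Y f = on_hom G X Y f)"

text \<open>
  The category with the same objects and with equivalence classes of morphisms.  It makes
  sense when each \<open>R X Y\<close> is an equivalence relation on \<open>Hom C X Y\<close> compatible with
  composition; then the union defining the composite of two classes is a single class.
\<close>

definition quotient_category ::
  "('o, 'm) category \<Rightarrow> ('o \<Rightarrow> 'o \<Rightarrow> ('m \<times> 'm) set) \<Rightarrow> ('o, 'm set) category" where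
  "quotient_category C R =
     \<lparr>Ob = Ob C,
      Hom = \<lambda>X Y. Hom C X Y // R X Y,
      Idn = \<lambda>X. R X X `` {Idn C X},
      Cmp = \<lambda>X Y Z G F. \<Union>g\<in>G. \<Union>f\<in>F. R X Z `` {Cmp C X Y Z g f}\<rparr>"

definition quotient_functor :: "('o \<Rightarrow> 'o \<Rightarrow> ('m \<times> 'm) set) \<Rightarrow> ('o, 'm, 'o, 'm set) cat_map" where
  "quotient_functor R = \<lparr>on_ob = \<lambda>X. X, on_hom = \<lambda>X Y f. R X Y `` {f}\<rparr>"


section \<open>Topological groups\<close>

text \<open>Neither commutativity nor any separation property is assumed.\<close>

locale topological_group = group A for A (structure) +
  fixes TA :: "'a topology"
  assumes topspace_TA: "topspace TA = carrier A"
    and continuous_mult: "continuous_map (prod_topology TA TA) TA (\<lambda>(a, b). a \<otimes> b)"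
    and continuous_inv: "continuous_map TA TA (\<lambda>a. inv a)"


section \<open>Monomial simplicial complexes\<close>

definition abstract_simplicial_complex :: "'s set \<Rightarrow> 's set set \<Rightarrow> bool" where
  "abstract_simplicial_complex S K \<longleftrightarrow>
     (\<forall>\<sigma>\<in>K. \<sigma> \<noteq> {} \<and> finite \<sigma> \<and> \<sigma> \<subseteq> S) \<and>
     (\<forall>s\<in>S. {s} \<in> K) \<and>
     (\<forall>\<sigma>\<in>K. \<forall>\<tau>. \<tau> \<subseteq> \<sigma> \<and> \<tau> \<noteq> {} \<longrightarrow> \<tau> \<in> K)"

definition simplicial_map ::
  "'s set \<Rightarrow> 's set set \<Rightarrow> 't set \<Rightarrow> 't set set \<Rightarrow> ('s \<Rightarrow> 't) \<Rightarrow> bool" where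
  "simplicial_map S K T L f \<longleftrightarrow> f \<in> S \<rightarrow>\<^sub>E T \<and> (\<forall>\<sigma>\<in>K. f ` \<sigma> \<in> L)"

record ('s, 'a) mono_complex =
  Vert :: "'s set"
  Simp :: "'s set set"
  Lab :: "'s set \<times> 's set \<Rightarrow> 'a"

definition monomial_complex ::
  "('a, 'g) monoid_scheme \<Rightarrow> ('s, 'a) mono_complex \<Rightarrow> bool" where
  "monomial_complex A X \<longleftrightarrow>
     abstract_simplicial_complex (Vert X) (Simp X) \<and>
     Lab X \<in> {(\<sigma>, \<sigma>'). \<sigma> \<in> Simp X \<and> \<sigma>' \<in> Simp X \<and> \<sigma> \<subseteq> \<sigma>'} \<rightarrow>\<^sub>E carrier A \<and>
     (\<forall>\<sigma>\<in>Simp X. \<forall>\<sigma>'\<in>Simp X. \<forall>\<sigma>''\<in>Simp X. \<sigma> \<subseteq> \<sigma>' \<and> \<sigma>' \<subseteq> \<sigma>'' \<longrightarrow>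
        Lab X (\<sigma>', \<sigma>'') \<otimes>\<^bsub>A\<^esub> Lab X (\<sigma>, \<sigma>') = Lab X (\<sigma>, \<sigma>'')) \<and>
     (\<forall>\<sigma>\<in>Simp X. Lab X (\<sigma>, \<sigma>) = \<one>\<^bsub>A\<^esub>)"

definition mono_hom ::
  "('a, 'g) monoid_scheme \<Rightarrow> ('s, 'a) mono_complex \<Rightarrow> ('t, 'a) mono_complex
     \<Rightarrow> (('s \<Rightarrow> 't) \<times> ('s set \<Rightarrow> 'a)) set" where
  "mono_hom A X Y =
     {(f, \<kappa>). simplicial_map (Vert X) (Simp X) (Vert Y) (Simp Y) f \<and>
        \<kappa> \<in> Simp X \<rightarrow>\<^sub>E carrier A \<and>
        (\<forall>\<sigma>\<in>Simp X. \<forall>\<sigma>'\<in>Simp X. \<sigma> \<subseteq> \<sigma>' \<longrightarrow>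
           Lab Y (f ` \<sigma>, f ` \<sigma>') \<otimes>\<^bsub>A\<^esub> \<kappa> \<sigma> = \<kappa> \<sigma>' \<otimes>\<^bsub>A\<^esub> Lab X (\<sigma>, \<sigma>'))}"

definition mono_id ::
  "('a, 'g) monoid_scheme \<Rightarrow> ('s, 'a) mono_complex \<Rightarrow> ('s \<Rightarrow> 's) \<times> ('s set \<Rightarrow> 'a)" where
  "mono_id A X = (\<lambda>s\<in>Vert X. s, \<lambda>\<sigma>\<in>Simp X. \<one>\<^bsub>A\<^esub>)"

definition mono_comp ::
  "('a, 'g) monoid_scheme \<Rightarrow> ('s, 'a) mono_complex
     \<Rightarrow> ('t \<Rightarrow> 'u) \<times> ('t set \<Rightarrow> 'a) \<Rightarrow> ('s \<Rightarrow> 't) \<times> ('s set \<Rightarrow> 'a)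
     \<Rightarrow> ('s \<Rightarrow> 'u) \<times> ('s set \<Rightarrow> 'a)" where
  "mono_comp A X = (\<lambda>(e, \<mu>) (f, \<kappa>).
     (compose (Vert X) e f, \<lambda>\<sigma>\<in>Simp X. \<mu> (f ` \<sigma>) \<otimes>\<^bsub>A\<^esub> \<kappa> \<sigma>))"

text \<open>The finite monomial complexes with vertices in the type \<open>'s\<close>.\<close>

definition simp_cat ::
  "('a, 'g) monoid_scheme
     \<Rightarrow> (('s, 'a) mono_complex, ('s \<Rightarrow> 's) \<times> ('s set \<Rightarrow> 'a)) category" where
  "simp_cat A =
     \<lparr>Ob = {X. monomial_complex A X \<and> finite (Vert X)},
      Hom = mono_hom A,
      Idn = mono_id A,
      Cmp = \<lambda>X Y Z. mono_comp A X\<rparr>"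

definition contiguous ::
  "('a, 'g) monoid_scheme \<Rightarrow> ('s, 'a) mono_complex \<Rightarrow> ('t, 'a) mono_complex
     \<Rightarrow> ((('s \<Rightarrow> 't) \<times> ('s set \<Rightarrow> 'a)) \<times> (('s \<Rightarrow> 't) \<times> ('s set \<Rightarrow> 'a))) set" where
  "contiguous A X Y =
     {((f, \<kappa>), (f', \<kappa>')). (f, \<kappa>) \<in> mono_hom A X Y \<and> (f', \<kappa>') \<in> mono_hom A X Y \<and>
        (\<forall>\<sigma>\<in>Simp X. f ` \<sigma> \<union> f' ` \<sigma> \<in> Simp Y \<and>
           Lab Y (f ` \<sigma>, f ` \<sigma> \<union> f' ` \<sigma>) \<otimes>\<^bsub>A\<^esub> \<kappa> \<sigma> =
           Lab Y (f' ` \<sigma>, f ` \<sigma> \<union> f' ` \<sigma>) \<otimes>\<^bsub>A\<^esub> \<kappa>' \<sigma>)}"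

definition simp_homotopic ::
  "('a, 'g) monoid_scheme \<Rightarrow> ('s, 'a) mono_complex \<Rightarrow> ('t, 'a) mono_complex
     \<Rightarrow> ((('s \<Rightarrow> 't) \<times> ('s set \<Rightarrow> 'a)) \<times> (('s \<Rightarrow> 't) \<times> ('s set \<Rightarrow> 'a))) set" where
  "simp_homotopic A X Y = (contiguous A X Y)\<^sup>+"


section \<open>Fibered bundles\<close>

record ('a, 'e, 'x) fib_bundle =
  Tot :: "'e topology"
  Base :: "'x topology"
  Act :: "'a \<Rightarrow> 'e \<Rightarrow> 'e"
  Proj :: "'e \<Rightarrow> 'x"

definition fibered_bundle ::
  "('a, 'g) monoid_scheme \<Rightarrow> 'a topology \<Rightarrow> ('a, 'e, 'x) fib_bundle \<Rightarrow> bool" where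
  "fibered_bundle A TA B \<longleftrightarrow>
     group_action A (topspace (Tot B)) (Act B) \<and>
     Act B \<in> extensional (carrier A) \<and>
     (\<forall>a\<in>carrier A. homeomorphic_map (Tot B) (Tot B) (Act B a)) \<and>
     continuous_map (Tot B) (Base B) (Proj B) \<and>
     Proj B \<in> extensional (topspace (Tot B)) \<and>
     Proj B ` topspace (Tot B) = topspace (Base B) \<and>
     (\<forall>a\<in>carrier A. \<forall>e\<in>topspace (Tot B). Proj B (Act B a e) = Proj B e) \<and>
     (\<forall>x\<in>topspace (Base B). \<exists>U. openin (Base B) U \<and> x \<in> U \<and>
        (\<exists>\<psi>. homeomorphic_map
                (subtopology (Tot B) {e \<in> topspace (Tot B). Proj B e \<in> U})
                (prod_topology (subtopology (Base B) U) TA) \<psi> \<and>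
              (\<forall>e\<in>topspace (Tot B). Proj B e \<in> U \<longrightarrow>
                 fst (\<psi> e) = Proj B e \<and>
                 (\<forall>a\<in>carrier A. \<psi> (Act B a e) = (fst (\<psi> e), a \<otimes>\<^bsub>A\<^esub> snd (\<psi> e))))))"

definition bundle_hom ::
  "('a, 'g) monoid_scheme \<Rightarrow> ('a, 'e, 'x) fib_bundle \<Rightarrow> ('a, 'f, 'y) fib_bundle
     \<Rightarrow> (('e \<Rightarrow> 'f) \<times> ('x \<Rightarrow> 'y)) set" where
  "bundle_hom A B B' =
     {(\<phi>, f). continuous_map (Tot B) (Tot B') \<phi> \<and> \<phi> \<in> extensional (topspace (Tot B)) \<and>
        continuous_map (Base B) (Base B') f \<and> f \<in> extensional (topspace (Base B)) \<and>
        (\<forall>a\<in>carrier A. \<forall>e\<in>topspace (Tot B). \<phi> (Act B a e) = Act B' a (\<phi> e)) \<and>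
        (\<forall>e\<in>topspace (Tot B). Proj B' (\<phi> e) = f (Proj B e))}"

text \<open>The bundles whose total and base spaces have points in the types \<open>'e\<close> and \<open>'x\<close>.\<close>

definition top_cat ::
  "('a, 'g) monoid_scheme \<Rightarrow> 'a topology
     \<Rightarrow> (('a, 'e, 'x) fib_bundle, ('e \<Rightarrow> 'e) \<times> ('x \<Rightarrow> 'x)) category" where
  "top_cat A TA =
     \<lparr>Ob = {B. fibered_bundle A TA B},
      Hom = bundle_hom A,
      Idn = \<lambda>B. (\<lambda>e\<in>topspace (Tot B). e, \<lambda>x\<in>topspace (Base B). x),
      Cmp = \<lambda>B B' B'' (\<phi>', f') (\<phi>, f).
        (compose (topspace (Tot B)) \<phi>' \<phi>, compose (topspace (Base B)) f' f)\<rparr>"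

abbreviation unit_interval :: "real topology" where
  "unit_interval \<equiv> top_of_set {0..1}"

definition bundle_homotopic ::
  "('a, 'g) monoid_scheme \<Rightarrow> ('a, 'e, 'x) fib_bundle \<Rightarrow> ('a, 'f, 'y) fib_bundle
     \<Rightarrow> ((('e \<Rightarrow> 'f) \<times> ('x \<Rightarrow> 'y)) \<times> (('e \<Rightarrow> 'f) \<times> ('x \<Rightarrow> 'y))) set" where
  "bundle_homotopic A B B' =
     {((\<phi>, f), (\<phi>', f')). (\<phi>, f) \<in> bundle_hom A B B' \<and> (\<phi>', f') \<in> bundle_hom A B B' \<and>
        (\<exists>H h.
           continuous_map (prod_topology (Tot B) unit_interval) (Tot B') H \<and>
           continuous_map (prod_topology (Base B) unit_interval) (Base B') h \<and>
           (\<forall>a\<in>carrier A. \<forall>e\<in>topspace (Tot B). \<forall>t\<in>{0..1}. H (Act B a e, t) = Act B' a (H (e, t))) \<and>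
           (\<forall>e\<in>topspace (Tot B). \<forall>t\<in>{0..1}. Proj B' (H (e, t)) = h (Proj B e, t)) \<and>
           (\<forall>e\<in>topspace (Tot B). H (e, 0) = \<phi> e \<and> H (e, 1) = \<phi>' e) \<and>
           (\<forall>x\<in>topspace (Base B). h (x, 0) = f x \<and> h (x, 1) = f' x))}"


section \<open>Geometric realization\<close>

definition quotient_topology :: "'p topology \<Rightarrow> ('p \<Rightarrow> 'q) \<Rightarrow> 'q topology" where
  "quotient_topology P q =
     topology (\<lambda>V. V \<subseteq> q ` topspace P \<and> openin P {x \<in> topspace P. q x \<in> V})"

lemma openin_quotient_topology:
  "openin (quotient_topology P q) V \<longleftrightarrow>
     V \<subseteq> q ` topspace P \<and> openin P {x \<in> topspace P. q x \<in> V}"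
proof -
  have "istopology (\<lambda>V. V \<subseteq> q ` topspace P \<and> openin P {x \<in> topspace P. q x \<in> V})"
    unfolding istopology_def
  proof (intro conjI allI impI)
    fix V W
    assume V: "V \<subseteq> q ` topspace P \<and> openin P {x \<in> topspace P. q x \<in> V}"
      and W: "W \<subseteq> q ` topspace P \<and> openin P {x \<in> topspace P. q x \<in> W}"
    show "V \<inter> W \<subseteq> q ` topspace P"
      using V by blast
    have "{x \<in> topspace P. q x \<in> V \<inter> W} =
        {x \<in> topspace P. q x \<in> V} \<inter> {x \<in> topspace P. q x \<in> W}"
      by blast
    then show "openin P {x \<in> topspace P. q x \<in> V \<inter> W}"
      using V W by (simp add: openin_Int)
  next
    fix \<V>
    assume \<V>: "\<forall>V\<in>\<V>. V \<subseteq> q ` topspace P \<and> openin P {x \<in> topspace P. q x \<in> V}"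
    then show "\<Union>\<V> \<subseteq> q ` topspace P"
      by blast
    have "{x \<in> topspace P. q x \<in> \<Union>\<V>} = (\<Union>V\<in>\<V>. {x \<in> topspace P. q x \<in> V})"
      by blast
    then show "openin P {x \<in> topspace P. q x \<in> \<Union>\<V>}"
      using \<V> by auto
  qed
  then show ?thesis
    by (simp add: quotient_topology_def topology_inverse')
qed

lemma topspace_quotient_topology [simp]:
  "topspace (quotient_topology P q) = q ` topspace P"
proof
  show "topspace (quotient_topology P q) \<subseteq> q ` topspace P"
    using openin_topspace[of "quotient_topology P q"]
    unfolding openin_quotient_topology by (rule conjunct1)
  have "{x \<in> topspace P. q x \<in> q ` topspace P} = topspace P"
    by blast
  then have "openin (quotient_topology P q) (q ` topspace P)"
    by (simp add: openin_quotient_topology)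
  then show "q ` topspace P \<subseteq> topspace (quotient_topology P q)"
    by (rule openin_subset)
qed

lemma quotient_map_quotient_topology: "quotient_map P (quotient_topology P q) q"
  by (simp add: quotient_map_def openin_quotient_topology)

lemma quotient_topology_unique:
  assumes "quotient_map P Q q" shows "quotient_topology P q = Q"
proof -
  have im: "q ` topspace P = topspace Q"
    and op: "\<And>U. U \<subseteq> topspace Q \<Longrightarrow> openin P {x \<in> topspace P. q x \<in> U} \<longleftrightarrow> openin Q U"
    using assms by (auto simp: quotient_map_def)
  have "openin (quotient_topology P q) U \<longleftrightarrow> openin Q U" for U
    unfolding openin_quotient_topology im using op[of U] openin_subset[of Q U] by blast
  then show ?thesis
    by (simp add: topology_eq)
qed

text \<open>
  Points of the Euclidean space over a finite vertex set are represented as functions on the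
  whole vertex type that vanish outside that set.  Extension by zero is thus invisible, and the
  product topology on all functions induces the usual one.
\<close>

definition supp :: "('s \<Rightarrow> real) \<Rightarrow> 's set" where
  "supp \<alpha> = {s. \<alpha> s \<noteq> 0}"

definition simplex_space :: "'s set \<Rightarrow> ('s \<Rightarrow> real) topology" where
  "simplex_space \<sigma> = subtopology (powertop_real UNIV)
     {\<alpha>. (\<forall>s. 0 \<le> \<alpha> s) \<and> (\<forall>s. s \<notin> \<sigma> \<longrightarrow> \<alpha> s = 0) \<and> (\<Sum>s\<in>\<sigma>. \<alpha> s) = 1}"

text \<open>Points of the disjoint union of simplices are identified when they are equal as functions.\<close>

definition complex_space :: "'s set set \<Rightarrow> ('s \<Rightarrow> real) topology" where
  "complex_space K = quotient_topology (sum_topology simplex_space K) snd"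

lemma topspace_simplex_space [simp]:
  "topspace (simplex_space \<sigma>) =
     {\<alpha>. (\<forall>s. 0 \<le> \<alpha> s) \<and> (\<forall>s. s \<notin> \<sigma> \<longrightarrow> \<alpha> s = 0) \<and> (\<Sum>s\<in>\<sigma>. \<alpha> s) = 1}"
  by (simp add: simplex_space_def)

lemma supp_in_simplices:
  assumes K: "abstract_simplicial_complex S K" and "\<sigma> \<in> K" "\<alpha> \<in> topspace (simplex_space \<sigma>)"
  shows "supp \<alpha> \<in> K" "supp \<alpha> \<subseteq> \<sigma>"
proof -
  show sub: "supp \<alpha> \<subseteq> \<sigma>"
    using assms by (auto simp: supp_def)
  have "supp \<alpha> \<noteq> {}"
  proof
    assume "supp \<alpha> = {}"
    then have "(\<Sum>s\<in>\<sigma>. \<alpha> s) = 0"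
      by (simp add: supp_def)
    then show False
      using assms by simp
  qed
  with sub show "supp \<alpha> \<in> K"
    using K \<open>\<sigma> \<in> K\<close> unfolding abstract_simplicial_complex_def by blast
qed

lemma topspace_complex_space:
  assumes K: "abstract_simplicial_complex S K" and fin: "finite S"
  shows "topspace (complex_space K) =
    {\<alpha>. (\<forall>s. 0 \<le> \<alpha> s) \<and> (\<forall>s. s \<notin> S \<longrightarrow> \<alpha> s = 0) \<and> supp \<alpha> \<in> K \<and> (\<Sum>s\<in>S. \<alpha> s) = 1}"
    (is "_ = ?R")
proof -
  have "topspace (complex_space K) = (\<Union>\<sigma>\<in>K. topspace (simplex_space \<sigma>))"
    by (force simp: complex_space_def)
  also have "\<dots> = ?R"
  proof (intro equalityI subsetI)
    fix \<alpha> assume "\<alpha> \<in> (\<Union>\<sigma>\<in>K. topspace (simplex_space \<sigma>))"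
    then obtain \<sigma> where \<sigma>: "\<sigma> \<in> K" "\<alpha> \<in> topspace (simplex_space \<sigma>)" by blast
    have "\<sigma> \<subseteq> S"
      using K \<sigma> by (simp add: abstract_simplicial_complex_def)
    then have "(\<Sum>s\<in>S. \<alpha> s) = (\<Sum>s\<in>\<sigma>. \<alpha> s)"
      using \<sigma> fin by (intro sum.mono_neutral_right) auto
    then show "\<alpha> \<in> ?R"
      using \<sigma> supp_in_simplices(1)[OF K \<sigma>] \<open>\<sigma> \<subseteq> S\<close> by auto
  next
    fix \<alpha> assume \<alpha>: "\<alpha> \<in> ?R"
    then have "supp \<alpha> \<subseteq> S"
      by (auto simp: supp_def)
    then have "(\<Sum>s\<in>S. \<alpha> s) = (\<Sum>s\<in>supp \<alpha>. \<alpha> s)"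
      using fin by (intro sum.mono_neutral_right) (auto simp: supp_def)
    then have "\<alpha> \<in> topspace (simplex_space (supp \<alpha>))"
      using \<alpha> by (auto simp: supp_def)
    then show "\<alpha> \<in> (\<Union>\<sigma>\<in>K. topspace (simplex_space \<sigma>))"
      using \<alpha> by blast
  qed
  finally show ?thesis .
qed

lemma closedin_simplex:
  assumes "finite \<sigma>"
  shows "closedin (powertop_real UNIV) (topspace (simplex_space \<sigma>))"
proof -
  have eq: "topspace (simplex_space \<sigma>) =
      (\<Inter>s. {\<alpha> \<in> topspace (powertop_real UNIV). \<alpha> s \<in> {0..}}) \<inter>
      ((\<Inter>s. {\<alpha> \<in> topspace (powertop_real UNIV). \<alpha> s \<in> (if s \<in> \<sigma> then UNIV else {0})}) \<inter>
       {\<alpha> \<in> topspace (powertop_real UNIV). (\<Sum>s\<in>\<sigma>. \<alpha> s) \<in> {1}})"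
    by (auto split: if_splits)
  have proj: "continuous_map (powertop_real UNIV) euclideanreal (\<lambda>\<alpha>. \<alpha> s)" for s :: 'a
    by (rule continuous_map_product_projection[where X = "\<lambda>_. euclideanreal", OF UNIV_I])
  have total: "continuous_map (powertop_real UNIV) euclideanreal (\<lambda>\<alpha>. \<Sum>s\<in>\<sigma>. \<alpha> s)"
    using assms proj by (rule continuous_map_sum)
  have pre: "closedin (powertop_real UNIV) {\<alpha> \<in> topspace (powertop_real UNIV). \<alpha> s \<in> C}"
      "closedin (powertop_real UNIV) {\<alpha> \<in> topspace (powertop_real UNIV). (\<Sum>s\<in>\<sigma>. \<alpha> s) \<in> C}"
    if "closed C" for C and s :: 'a
    using closedin_continuous_map_preimage[OF proj] closedin_continuous_map_preimage[OF total] that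
    by simp_all
  show ?thesis
    unfolding eq
    by (intro closedin_Int closedin_INT UNIV_not_empty pre) auto
qed

text \<open>For finite complexes the topology is that of a subspace of Euclidean space.\<close>

lemma complex_space_eq_subspace:
  assumes K: "abstract_simplicial_complex S K" and fin: "finite S"
  shows "complex_space K = subtopology (powertop_real UNIV) (topspace (complex_space K))"
    (is "_ = ?T")
  unfolding complex_space_def
proof (rule quotient_topology_unique)
  have "K \<subseteq> Pow S"
    using K by (auto simp: abstract_simplicial_complex_def)
  then have finK: "finite K"
    using fin finite_subset by blast
  have top: "topspace (quotient_topology (sum_topology simplex_space K) snd) =
      (\<Union>\<sigma>\<in>K. topspace (simplex_space \<sigma>))"
    by force
  let ?P = "subtopology (powertop_real UNIV)
    (topspace (quotient_topology (sum_topology simplex_space K) snd))"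
  show "quotient_map (sum_topology simplex_space K) ?P snd"
  proof (rule continuous_closed_imp_quotient_map)
    show "continuous_map (sum_topology simplex_space K) ?P snd"
    proof (unfold continuous_map_def, intro conjI allI impI)
      show "snd \<in> topspace (sum_topology simplex_space K) \<rightarrow> topspace ?P"
        unfolding top by auto
      fix U assume "openin ?P U"
      then obtain V where V: "openin (powertop_real UNIV) V"
        and U: "U = V \<inter> topspace (quotient_topology (sum_topology simplex_space K) snd)"
        unfolding openin_subtopology by blast
      have "{\<alpha>. (\<sigma>, \<alpha>) \<in> {x \<in> topspace (sum_topology simplex_space K). snd x \<in> U}} =
          V \<inter> topspace (simplex_space \<sigma>)" if "\<sigma> \<in> K" for \<sigma>
        using that unfolding U top by (auto simp del: topspace_simplex_space)
      moreover have "openin (simplex_space \<sigma>) (V \<inter> topspace (simplex_space \<sigma>))" for \<sigma>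
        using V unfolding simplex_space_def by (auto simp: openin_subtopology)
      ultimately show "openin (sum_topology simplex_space K)
          {x \<in> topspace (sum_topology simplex_space K). snd x \<in> U}"
        by (auto simp: openin_sum_topology)
    qed
    show "closed_map (sum_topology simplex_space K) ?P snd"
      unfolding closed_map_def
    proof (intro allI impI)
      fix U assume U: "closedin (sum_topology simplex_space K) U"
      let ?F = "\<lambda>\<sigma>. {\<alpha>. (\<sigma>, \<alpha>) \<in> U}"
      have "U \<subseteq> Sigma K (topspace \<circ> simplex_space)"
        using closedin_subset[OF U] by simp
      then have "U \<subseteq> K \<times> UNIV"
        by blast
      then have sU: "snd ` U = (\<Union>\<sigma>\<in>K. ?F \<sigma>)"
        by force
      have "closedin (powertop_real UNIV) (?F \<sigma>)" if "\<sigma> \<in> K" for \<sigma>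
      proof (rule closedin_trans_full)
        show "closedin (subtopology (powertop_real UNIV) (topspace (simplex_space \<sigma>))) (?F \<sigma>)"
          using U that by (simp add: closedin_sum_topology simplex_space_def)
        have "finite \<sigma>"
          using K that by (simp add: abstract_simplicial_complex_def)
        then show "closedin (powertop_real UNIV) (topspace (simplex_space \<sigma>))"
          by (rule closedin_simplex)
      qed
      then have "closedin (powertop_real UNIV) (snd ` U)"
        unfolding sU using finK by (intro closedin_Union) auto
      moreover have "snd ` U \<subseteq> topspace (quotient_topology (sum_topology simplex_space K) snd)"
        using closedin_subset[OF U] by auto
      ultimately show "closedin ?P (snd ` U)"
        by (meson closedin_subset_topspace)
    qed
    show "snd ` topspace (sum_topology simplex_space K) = topspace ?P"
      by simp
  qed
qed

definition push :: "'s set \<Rightarrow> ('s \<Rightarrow> 't) \<Rightarrow> ('s \<Rightarrow> real) \<Rightarrow> 't \<Rightarrow> real" where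
  "push S f \<alpha> = (\<lambda>t. \<Sum>s | s \<in> S \<and> f s = t. \<alpha> s)"

definition glue_space ::
  "'a topology \<Rightarrow> ('s, 'a) mono_complex \<Rightarrow> ('s set \<times> ('s \<Rightarrow> real) \<times> 'a) topology" where
  "glue_space TA X = sum_topology (\<lambda>\<sigma>. prod_topology (simplex_space \<sigma>) TA) (Simp X)"

definition glue_rel ::
  "('a, 'g) monoid_scheme \<Rightarrow> 'a topology \<Rightarrow> ('s, 'a) mono_complex
     \<Rightarrow> (('s set \<times> ('s \<Rightarrow> real) \<times> 'a) \<times> ('s set \<times> ('s \<Rightarrow> real) \<times> 'a)) set" where
  "glue_rel A TA X =
     {((\<sigma>, \<alpha>, a), (\<tau>, \<beta>, b)).
        (\<sigma>, \<alpha>, a) \<in> topspace (glue_space TA X) \<and> (\<tau>, \<beta>, b) \<in> topspace (glue_space TA X) \<and>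
        \<alpha> = \<beta> \<and> a \<otimes>\<^bsub>A\<^esub> Lab X (supp \<alpha>, \<sigma>) = b \<otimes>\<^bsub>A\<^esub> Lab X (supp \<beta>, \<tau>)}"

definition total_space ::
  "('a, 'g) monoid_scheme \<Rightarrow> 'a topology \<Rightarrow> ('s, 'a) mono_complex
     \<Rightarrow> ('s set \<times> ('s \<Rightarrow> real) \<times> 'a) set topology" where
  "total_space A TA X = quotient_topology (glue_space TA X) (\<lambda>p. glue_rel A TA X `` {p})"

text \<open>
  Maps out of the quotient are defined on an equivalence class by combining the values on all
  its representatives.
\<close>

definition realization ::
  "('a, 'g) monoid_scheme \<Rightarrow> 'a topology \<Rightarrow> ('s, 'a) mono_complex
     \<Rightarrow> ('a, ('s set \<times> ('s \<Rightarrow> real) \<times> 'a) set, 's \<Rightarrow> real) fib_bundle" where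
  "realization A TA X =
     \<lparr>Tot = total_space A TA X,
      Base = complex_space (Simp X),
      Act = (\<lambda>b\<in>carrier A. \<lambda>c\<in>topspace (total_space A TA X).
               \<Union>(\<sigma>, \<alpha>, a)\<in>c. glue_rel A TA X `` {(\<sigma>, \<alpha>, b \<otimes>\<^bsub>A\<^esub> a)}),
      Proj = (\<lambda>c\<in>topspace (total_space A TA X). the_elem ((\<lambda>(\<sigma>, \<alpha>, a). \<alpha>) ` c))\<rparr>"

definition realization_hom ::
  "('a, 'g) monoid_scheme \<Rightarrow> 'a topology \<Rightarrow> ('s, 'a) mono_complex \<Rightarrow> ('t, 'a) mono_complex
     \<Rightarrow> ('s \<Rightarrow> 't) \<times> ('s set \<Rightarrow> 'a)
     \<Rightarrow> (('s set \<times> ('s \<Rightarrow> real) \<times> 'a) set \<Rightarrow> ('t set \<times> ('t \<Rightarrow> real) \<times> 'a) set)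
        \<times> (('s \<Rightarrow> real) \<Rightarrow> ('t \<Rightarrow> real))" where
  "realization_hom A TA X Y = (\<lambda>(f, \<kappa>).
     (\<lambda>c\<in>topspace (total_space A TA X).
        \<Union>(\<sigma>, \<alpha>, a)\<in>c. glue_rel A TA Y `` {(f ` \<sigma>, push (Vert X) f \<alpha>, a \<otimes>\<^bsub>A\<^esub> inv\<^bsub>A\<^esub> (\<kappa> \<sigma>))},
      \<lambda>\<alpha>\<in>topspace (complex_space (Simp X)). push (Vert X) f \<alpha>))"

definition realization_functor ::
  "('a, 'g) monoid_scheme \<Rightarrow> 'a topology
     \<Rightarrow> (('s, 'a) mono_complex, ('s \<Rightarrow> 's) \<times> ('s set \<Rightarrow> 'a),
         ('a, ('s set \<times> ('s \<Rightarrow> real) \<times> 'a) set, 's \<Rightarrow> real) fib_bundle,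
         (('s set \<times> ('s \<Rightarrow> real) \<times> 'a) set \<Rightarrow> ('s set \<times> ('s \<Rightarrow> real) \<times> 'a) set)
           \<times> (('s \<Rightarrow> real) \<Rightarrow> ('s \<Rightarrow> real))) cat_map" where
  "realization_functor A TA =
     \<lparr>on_ob = realization A TA, on_hom = realization_hom A TA\<rparr>"

context topological_group
begin

lemma topspace_glue_space:
  "topspace (glue_space TA X) = (SIGMA \<sigma>:Simp X. topspace (simplex_space \<sigma>) \<times> carrier A)"
  by (simp add: glue_space_def topspace_TA comp_def del: topspace_simplex_space)

lemma glue_rel_iff:
  "((\<sigma>, \<alpha>, a), (\<tau>, \<beta>, b)) \<in> glue_rel A TA X \<longleftrightarrow>
     \<sigma> \<in> Simp X \<and> \<alpha> \<in> topspace (simplex_space \<sigma>) \<and> a \<in> carrier A \<and>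
     \<tau> \<in> Simp X \<and> \<beta> \<in> topspace (simplex_space \<tau>) \<and> b \<in> carrier A \<and>
     \<alpha> = \<beta> \<and> a \<otimes> Lab X (supp \<alpha>, \<sigma>) = b \<otimes> Lab X (supp \<beta>, \<tau>)"
  unfolding glue_rel_def topspace_glue_space by (simp del: topspace_simplex_space)

lemma glue_relE:
  assumes "(p, q) \<in> glue_rel A TA X"
  obtains \<sigma> \<alpha> a \<tau> c where "p = (\<sigma>, \<alpha>, a)" "q = (\<tau>, \<alpha>, c)"
    "\<sigma> \<in> Simp X" "\<alpha> \<in> topspace (simplex_space \<sigma>)" "a \<in> carrier A"
    "\<tau> \<in> Simp X" "\<alpha> \<in> topspace (simplex_space \<tau>)" "c \<in> carrier A"
    "a \<otimes> Lab X (supp \<alpha>, \<sigma>) = c \<otimes> Lab X (supp \<alpha>, \<tau>)"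
  using assms by (cases p; cases q) (simp add: glue_rel_iff del: topspace_simplex_space)

lemma equiv_glue_rel: "equiv (topspace (glue_space TA X)) (glue_rel A TA X)"
proof (rule equivI)
  show "glue_rel A TA X \<subseteq> topspace (glue_space TA X) \<times> topspace (glue_space TA X)"
    unfolding glue_rel_def by auto
  show "refl_on (topspace (glue_space TA X)) (glue_rel A TA X)"
    unfolding glue_rel_def refl_on_def by auto
  show "sym (glue_rel A TA X)"
    unfolding glue_rel_def sym_def by (clarsimp simp del: topspace_simplex_space)
  show "trans (glue_rel A TA X)"
    unfolding glue_rel_def trans_def by (clarsimp simp del: topspace_simplex_space)
qed

lemma glue_class_in_total_space:
  "p \<in> topspace (glue_space TA X) \<Longrightarrow> glue_rel A TA X `` {p} \<in> topspace (total_space A TA X)"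
  by (simp add: total_space_def)

lemma Lab_closed:
  assumes "monomial_complex A X" "\<sigma> \<in> Simp X" "\<sigma>' \<in> Simp X" "\<sigma> \<subseteq> \<sigma>'"
  shows "Lab X (\<sigma>, \<sigma>') \<in> carrier A"
  using assms unfolding monomial_complex_def by (auto simp: PiE_iff)

lemma realization_Proj:
  assumes p: "(\<sigma>, \<alpha>, a) \<in> topspace (glue_space TA X)"
  shows "Proj (realization A TA X) (glue_rel A TA X `` {(\<sigma>, \<alpha>, a)}) = \<alpha>"
proof -
  have "(\<lambda>(\<sigma>, \<alpha>, a). \<alpha>) ` (glue_rel A TA X `` {(\<sigma>, \<alpha>, a)}) = {\<alpha>}"
    using p by (force simp: glue_rel_def)
  then show ?thesis
    using glue_class_in_total_space[OF p] by (simp add: realization_def)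
qed

lemma realization_Act:
  assumes X: "monomial_complex A X" and p: "(\<sigma>, \<alpha>, a) \<in> topspace (glue_space TA X)"
    and b: "b \<in> carrier A"
  shows "Act (realization A TA X) b (glue_rel A TA X `` {(\<sigma>, \<alpha>, a)}) =
    glue_rel A TA X `` {(\<sigma>, \<alpha>, b \<otimes> a)}"
proof -
  have K: "abstract_simplicial_complex (Vert X) (Simp X)"
    using X by (simp add: monomial_complex_def)
  have "(\<lambda>(\<sigma>, \<alpha>, a). glue_rel A TA X `` {(\<sigma>, \<alpha>, b \<otimes> a)}) respects glue_rel A TA X"
  proof (rule congruentI)
    fix p q assume "(p, q) \<in> glue_rel A TA X"
    then obtain \<sigma> \<alpha> a \<tau> c where pq: "p = (\<sigma>, \<alpha>, a)" "q = (\<tau>, \<alpha>, c)"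
      and m: "\<sigma> \<in> Simp X" "\<alpha> \<in> topspace (simplex_space \<sigma>)" "a \<in> carrier A"
        "\<tau> \<in> Simp X" "\<alpha> \<in> topspace (simplex_space \<tau>)" "c \<in> carrier A"
      and e: "a \<otimes> Lab X (supp \<alpha>, \<sigma>) = c \<otimes> Lab X (supp \<alpha>, \<tau>)"
      by (rule glue_relE)
    have "Lab X (supp \<alpha>, \<sigma>) \<in> carrier A" "Lab X (supp \<alpha>, \<tau>) \<in> carrier A"
      using Lab_closed[OF X] supp_in_simplices[OF K] m by metis+
    then have "(b \<otimes> a) \<otimes> Lab X (supp \<alpha>, \<sigma>) = (b \<otimes> c) \<otimes> Lab X (supp \<alpha>, \<tau>)"
      using m e b by (simp add: m_assoc)
    then have "((\<sigma>, \<alpha>, b \<otimes> a), (\<tau>, \<alpha>, b \<otimes> c)) \<in> glue_rel A TA X"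
      using m b by (simp add: glue_rel_iff del: topspace_simplex_space)
    then have "glue_rel A TA X `` {(\<sigma>, \<alpha>, b \<otimes> a)} = glue_rel A TA X `` {(\<tau>, \<alpha>, b \<otimes> c)}"
      by (rule equiv_class_eq[OF equiv_glue_rel])
    then show "(\<lambda>(\<sigma>, \<alpha>, a). glue_rel A TA X `` {(\<sigma>, \<alpha>, b \<otimes> a)}) p =
        (\<lambda>(\<sigma>, \<alpha>, a). glue_rel A TA X `` {(\<sigma>, \<alpha>, b \<otimes> a)}) q"
      by (simp only: pq prod.case)
  qed
  from UN_equiv_class[OF equiv_glue_rel this p] show ?thesis
    using glue_class_in_total_space[OF p] b by (simp add: realization_def)
qed

lemma push_in_simplex:
  assumes S: "\<sigma> \<subseteq> S" and fin: "finite S" and \<alpha>: "\<alpha> \<in> topspace (simplex_space \<sigma>)"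
  shows "push S f \<alpha> \<in> topspace (simplex_space (f ` \<sigma>))" "supp (push S f \<alpha>) = f ` supp \<alpha>"
proof -
  have finS: "finite \<sigma>"
    by (rule finite_subset[OF S fin])
  have nn: "\<And>s. 0 \<le> \<alpha> s" and z: "\<And>s. s \<notin> \<sigma> \<Longrightarrow> \<alpha> s = 0" and s1: "(\<Sum>s\<in>\<sigma>. \<alpha> s) = 1"
    using \<alpha> by auto
  have eq: "push S f \<alpha> t = (\<Sum>s | s \<in> \<sigma> \<and> f s = t. \<alpha> s)" for t
    unfolding push_def using S fin z by (intro sum.mono_neutral_right) auto
  have "(\<Sum>t\<in>f ` \<sigma>. push S f \<alpha> t) = (\<Sum>s\<in>\<sigma>. \<alpha> s)"
    unfolding eq using finS by (intro sum.group) auto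
  moreover have "push S f \<alpha> t = 0" if "t \<notin> f ` \<sigma>" for t
    unfolding eq using that by (intro sum.neutral) auto
  moreover have "0 \<le> push S f \<alpha> t" for t
    unfolding push_def by (intro sum_nonneg nn)
  ultimately show "push S f \<alpha> \<in> topspace (simplex_space (f ` \<sigma>))"
    using s1 by simp
  have "push S f \<alpha> t \<noteq> 0 \<longleftrightarrow> (\<exists>s. \<alpha> s \<noteq> 0 \<and> f s = t)" for t
    unfolding eq using finS nn z by (subst sum_nonneg_eq_0_iff) auto
  then show "supp (push S f \<alpha>) = f ` supp \<alpha>"
    unfolding supp_def by auto
qed

lemma realization_hom_class:
  assumes X: "monomial_complex A X" and Y: "monomial_complex A Y" and fin: "finite (Vert X)"
    and fl: "(f, \<kappa>) \<in> mono_hom A X Y"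
    and p: "(\<sigma>, \<alpha>, a) \<in> topspace (glue_space TA X)"
  shows "fst (realization_hom A TA X Y (f, \<kappa>)) (glue_rel A TA X `` {(\<sigma>, \<alpha>, a)}) =
    glue_rel A TA Y `` {(f ` \<sigma>, push (Vert X) f \<alpha>, a \<otimes> inv (\<kappa> \<sigma>))}"
proof -
  have K: "abstract_simplicial_complex (Vert X) (Simp X)"
    using X by (simp add: monomial_complex_def)
  have L: "\<And>\<sigma>. \<sigma> \<in> Simp X \<Longrightarrow> f ` \<sigma> \<in> Simp Y" "\<And>\<sigma>. \<sigma> \<in> Simp X \<Longrightarrow> \<kappa> \<sigma> \<in> carrier A"
    and nat: "\<And>\<sigma> \<sigma>'. \<lbrakk>\<sigma> \<in> Simp X; \<sigma>' \<in> Simp X; \<sigma> \<subseteq> \<sigma>'\<rbrakk> \<Longrightarrow>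
           Lab Y (f ` \<sigma>, f ` \<sigma>') \<otimes> \<kappa> \<sigma> = \<kappa> \<sigma>' \<otimes> Lab X (\<sigma>, \<sigma>')"
    using fl unfolding mono_hom_def simplicial_map_def by (auto simp: PiE_iff)
  have key: "a \<otimes> inv (\<kappa> \<sigma>) \<otimes> Lab Y (f ` \<rho>, f ` \<sigma>) = a \<otimes> Lab X (\<rho>, \<sigma>) \<otimes> inv (\<kappa> \<rho>)"
    if "\<rho> \<in> Simp X" "\<sigma> \<in> Simp X" "\<rho> \<subseteq> \<sigma>" "a \<in> carrier A" for \<rho> \<sigma> a
  proof -
    have c: "Lab Y (f ` \<rho>, f ` \<sigma>) \<in> carrier A" "Lab X (\<rho>, \<sigma>) \<in> carrier A"
        "\<kappa> \<rho> \<in> carrier A" "\<kappa> \<sigma> \<in> carrier A"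
      using that L Lab_closed[OF X] Lab_closed[OF Y] by (auto simp: image_mono)
    have "Lab Y (f ` \<rho>, f ` \<sigma>) = \<kappa> \<sigma> \<otimes> Lab X (\<rho>, \<sigma>) \<otimes> inv (\<kappa> \<rho>)"
      by (rule inv_solve_right[THEN iffD2]) (use nat[OF that(1-3)] c in auto)
    moreover have "inv (\<kappa> \<sigma>) \<otimes> (\<kappa> \<sigma> \<otimes> x) = x" if "x \<in> carrier A" for x
      using c that by (simp add: m_assoc[symmetric])
    ultimately show ?thesis
      using c that(4) by (simp add: m_assoc)
  qed
  have "(\<lambda>(\<sigma>, \<alpha>, a). glue_rel A TA Y `` {(f ` \<sigma>, push (Vert X) f \<alpha>, a \<otimes> inv (\<kappa> \<sigma>))})
      respects glue_rel A TA X"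
  proof (rule congruentI)
    fix p q assume "(p, q) \<in> glue_rel A TA X"
    then obtain \<sigma> \<alpha> a \<tau> c where pq: "p = (\<sigma>, \<alpha>, a)" "q = (\<tau>, \<alpha>, c)"
      and m: "\<sigma> \<in> Simp X" "\<alpha> \<in> topspace (simplex_space \<sigma>)" "a \<in> carrier A"
        "\<tau> \<in> Simp X" "\<alpha> \<in> topspace (simplex_space \<tau>)" "c \<in> carrier A"
      and e: "a \<otimes> Lab X (supp \<alpha>, \<sigma>) = c \<otimes> Lab X (supp \<alpha>, \<tau>)"
      by (rule glue_relE)
    have V: "\<sigma> \<subseteq> Vert X" "\<tau> \<subseteq> Vert X"
      using K m(1,4) unfolding abstract_simplicial_complex_def by blast+
    note s = supp_in_simplices[OF K m(1,2)] supp_in_simplices[OF K m(4,5)]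
    have "(a \<otimes> inv (\<kappa> \<sigma>)) \<otimes> Lab Y (f ` supp \<alpha>, f ` \<sigma>) =
        (c \<otimes> inv (\<kappa> \<tau>)) \<otimes> Lab Y (f ` supp \<alpha>, f ` \<tau>)"
      using key[OF s(1) m(1) s(2) m(3)] key[OF s(1) m(4) s(4) m(6)] e by (simp only:)
    then have "((f ` \<sigma>, push (Vert X) f \<alpha>, a \<otimes> inv (\<kappa> \<sigma>)),
        (f ` \<tau>, push (Vert X) f \<alpha>, c \<otimes> inv (\<kappa> \<tau>))) \<in> glue_rel A TA Y"
      using m L push_in_simplex[OF V(1) fin m(2), of f] push_in_simplex[OF V(2) fin m(5), of f]
      by (simp add: glue_rel_iff del: topspace_simplex_space)
    then have "glue_rel A TA Y `` {(f ` \<sigma>, push (Vert X) f \<alpha>, a \<otimes> inv (\<kappa> \<sigma>))} =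
        glue_rel A TA Y `` {(f ` \<tau>, push (Vert X) f \<alpha>, c \<otimes> inv (\<kappa> \<tau>))}"
      by (rule equiv_class_eq[OF equiv_glue_rel])
    then show "(\<lambda>(\<sigma>, \<alpha>, a). glue_rel A TA Y `` {(f ` \<sigma>, push (Vert X) f \<alpha>, a \<otimes> inv (\<kappa> \<sigma>))}) p =
        (\<lambda>(\<sigma>, \<alpha>, a). glue_rel A TA Y `` {(f ` \<sigma>, push (Vert X) f \<alpha>, a \<otimes> inv (\<kappa> \<sigma>))}) q"
      by (simp only: pq prod.case)
  qed
  from UN_equiv_class[OF equiv_glue_rel this p] show ?thesis
    using glue_class_in_total_space[OF p] by (simp add: realization_hom_def)
qed

end

end

theory Submission
  imports Defs
begin

text \<open>
  Let \<open>(f, \<kappa>)\<close> and \<open>(f', \<kappa>')\<close> be contiguous and put \<open>\<tau> = f(\<sigma>) \<union> f'(\<sigma>)\<close>.  By contiguity the element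
  \<open>c(\<sigma>) = m(f(\<sigma>), \<tau>) \<kappa>(\<sigma>) = m(f'(\<sigma>), \<tau>) \<kappa>'(\<sigma>)\<close> is symmetric in the two morphisms, and it is natural in
  \<open>\<sigma>\<close>.  So \<open>([\<sigma>, \<alpha>, a], t) \<mapsto> [\<tau>, (1 - t) |f|(\<alpha>) + t |f'|(\<alpha>), a c(\<sigma>)\<inverse>]\<close> is well defined, and it
  lies over the straight-line homotopy from \<open>|f|\<close> to \<open>|f'|\<close>.

  Continuity is not immediate, since the product of a quotient map with \<open>[0, 1]\<close> has to be
  controlled for an arbitrary topological group.  But each cell \<open>|\<sigma>| \<times> A\<close> maps into the total
  space by a closed injective map, and this property survives taking the product with any space.
  As there are only finitely many cells, continuity can be checked on them.  The bundle is trivial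
  over the open star of each vertex \<open>s\<close>, by \<open>[\<sigma>, \<alpha>, a] \<mapsto> (\<alpha>, a l({s}, \<sigma>))\<close>.
\<close>

section \<open>Congruences on categories\<close>

text \<open>The gluing relation compares labels at the support of a point, and the support of (1 -
  t) |f|(\<alpha>) + t |f'|(\<alpha>) changes with t: at t = 0 it is f(supp \<alpha>), for 0 < t < 1
  it is the union of both images. So well-definedness cannot be argued at the support itself. The
  way out is that multiplicativity of the labels allows the comparison at any simplex between the
  support and both cells; the carrier of supp \<alpha> serves for every t. The inverse in the fibre
  coordinate turns naturality of c into a c(\<sigma>)^-1 m(T(\<rho>), T(\<sigma>)) = a l(\<rho>,
  \<sigma>) c(\<rho>)^-1, which is what the gluing asks for; being a right factor, it commutes with
  the left action. Closed injective maps survive products because they are proper: a fibre has at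
  most one point. Realized morphisms raise the same questions of continuity and well-definedness as
  the homotopy, so both are instances of one construction over a parameter space.\<close>

definition category_congruence ::
  "('o, 'm) category \<Rightarrow> ('o \<Rightarrow> 'o \<Rightarrow> ('m \<times> 'm) set) \<Rightarrow> bool" where
  "category_congruence C R \<longleftrightarrow>
     (\<forall>X\<in>Ob C. \<forall>Y\<in>Ob C. equiv (Hom C X Y) (R X Y)) \<and>
     (\<forall>X\<in>Ob C. \<forall>Y\<in>Ob C. \<forall>Z\<in>Ob C. \<forall>f f' g g'. (f, f') \<in> R X Y \<longrightarrow> (g, g') \<in> R Y Z \<longrightarrow>
        (Cmp C X Y Z g f, Cmp C X Y Z g' f') \<in> R X Z)"

text \<open>Changing both factors of a composite amounts to changing one after the other, and
  transitivity joins the two steps. Both homotopy relations are checked in this one-sided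
  form.\<close>

lemma category_congruenceI:
  assumes "\<And>X Y. X \<in> Ob C \<Longrightarrow> Y \<in> Ob C \<Longrightarrow> equiv (Hom C X Y) (R X Y)"
    and pre: "\<And>X Y Z f g g'. \<lbrakk>X \<in> Ob C; Y \<in> Ob C; Z \<in> Ob C; f \<in> Hom C X Y; (g, g') \<in> R Y Z\<rbrakk>
      \<Longrightarrow> (Cmp C X Y Z g f, Cmp C X Y Z g' f) \<in> R X Z"
    and post: "\<And>X Y Z f f' g. \<lbrakk>X \<in> Ob C; Y \<in> Ob C; Z \<in> Ob C; (f, f') \<in> R X Y; g \<in> Hom C Y Z\<rbrakk>
      \<Longrightarrow> (Cmp C X Y Z g f, Cmp C X Y Z g f') \<in> R X Z"
  shows "category_congruence C R"
  unfolding category_congruence_def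
proof (intro conjI ballI allI impI assms(1))
  fix X Y Z f f' g g'
  assume *: "X \<in> Ob C" "Y \<in> Ob C" "Z \<in> Ob C" "(f, f') \<in> R X Y" "(g, g') \<in> R Y Z"
  have "f' \<in> Hom C X Y" "g \<in> Hom C Y Z" and tr: "trans (R X Z)"
    using assms(1) * by (auto simp: equiv_def)
  with pre[of X Y Z f' g g'] post[of X Y Z f f' g] *
  show "(Cmp C X Y Z g f, Cmp C X Y Z g' f') \<in> R X Z"
    by (blast intro: transD[OF tr])
qed

lemma quotient_category_simps [simp]:
  "Ob (quotient_category C R) = Ob C"
  "Hom (quotient_category C R) X Y = Hom C X Y // R X Y"
  "Idn (quotient_category C R) X = R X X `` {Idn C X}"
  by (simp_all add: quotient_category_def)

lemma ball_quotient: "(\<forall>c\<in>A // r. P c) \<longleftrightarrow> (\<forall>x\<in>A. P (r `` {x}))"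
  by (auto simp: quotient_def)

context
  fixes C :: "('o, 'm) category" and R
  assumes C: "is_category C" and R: "category_congruence C R"
begin

lemma congruence_equiv: "X \<in> Ob C \<Longrightarrow> Y \<in> Ob C \<Longrightarrow> equiv (Hom C X Y) (R X Y)"
  using R by (simp add: category_congruence_def)

text \<open>The union defining the composite runs over all pairs of representatives. The congruence
  makes all its members the same class, and reflexivity makes the index sets nonempty, so the union
  collapses to that class.\<close>

lemma Cmp_quotient_category:
  assumes "X \<in> Ob C" "Y \<in> Ob C" "Z \<in> Ob C" "f \<in> Hom C X Y" "g \<in> Hom C Y Z"
  shows "Cmp (quotient_category C R) X Y Z (R Y Z `` {g}) (R X Y `` {f}) =
    R X Z `` {Cmp C X Y Z g f}"
proof -
  have "R X Z `` {Cmp C X Y Z g' f'} = R X Z `` {Cmp C X Y Z g f}"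
    if "(g, g') \<in> R Y Z" "(f, f') \<in> R X Y" for f' g'
  proof -
    have "(Cmp C X Y Z g f, Cmp C X Y Z g' f') \<in> R X Z"
      using R that assms(1-3) by (simp add: category_congruence_def)
    then show ?thesis
      using equiv_class_eq[OF congruence_equiv[OF assms(1,3)]] by simp
  qed
  moreover have "R Y Z `` {g} \<noteq> {}" "R X Y `` {f} \<noteq> {}"
    using assms equiv_class_self[OF congruence_equiv] by blast+
  ultimately show ?thesis
    by (simp add: quotient_category_def SUP_eq_const)
qed

lemma is_category_quotient: "is_category (quotient_category C R)"
proof -
  have id: "Idn C X \<in> Hom C X X" if "X \<in> Ob C" for X
    using C that by (simp add: is_category_def)
  have cmp: "Cmp C X Y Z g f \<in> Hom C X Z"
    if "X \<in> Ob C" "Y \<in> Ob C" "Z \<in> Ob C" "f \<in> Hom C X Y" "g \<in> Hom C Y Z" for X Y Z f g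
    using C that by (simp add: is_category_def)
  have unit: "Cmp C X X Y f (Idn C X) = f" "Cmp C X Y Y (Idn C Y) f = f"
    if "X \<in> Ob C" "Y \<in> Ob C" "f \<in> Hom C X Y" for X Y f
    using C that by (simp_all add: is_category_def)
  have assoc: "Cmp C W X Z (Cmp C X Y Z h g) f = Cmp C W Y Z h (Cmp C W X Y g f)"
    if "W \<in> Ob C" "X \<in> Ob C" "Y \<in> Ob C" "Z \<in> Ob C"
      "f \<in> Hom C W X" "g \<in> Hom C X Y" "h \<in> Hom C Y Z" for W X Y Z f g h
    using C that by (simp add: is_category_def)
  show ?thesis
    unfolding is_category_def quotient_category_simps ball_quotient
    by (simp add: Cmp_quotient_category id cmp unit assoc quotientI)
qed

lemma is_functor_quotient: "is_functor C (quotient_category C R) (quotient_functor R)"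
  using C unfolding is_functor_def
  by (simp add: is_category_quotient quotient_functor_def quotientI Cmp_quotient_category)

end

text \<open>The universal property of the quotient category. The functor \<open>G\<close> takes on a
  class the union of the classes of all images; \<open>FRS\<close> makes these coincide, and the
  functor laws then descend from those of \<open>F\<close> by evaluation on representatives.\<close>

lemma induced_functor:
  assumes F: "is_functor C D F" and R: "category_congruence C R" and S: "category_congruence D S"
    and FRS: "\<And>X Y f f'. \<lbrakk>X \<in> Ob C; Y \<in> Ob C; (f, f') \<in> R X Y\<rbrakk> \<Longrightarrow>
      (on_hom F X Y f, on_hom F X Y f') \<in> S (on_ob F X) (on_ob F Y)"
  shows "\<exists>G. is_functor (quotient_category C R) (quotient_category D S) G \<and>
    functor_eq C (functor_comp G (quotient_functor R)) (functor_comp (quotient_functor S) F)"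
proof -
  have C: "is_category C" and D: "is_category D"
    and ob: "\<And>X. X \<in> Ob C \<Longrightarrow> on_ob F X \<in> Ob D"
    and hom: "\<And>X Y f. \<lbrakk>X \<in> Ob C; Y \<in> Ob C; f \<in> Hom C X Y\<rbrakk> \<Longrightarrow>
      on_hom F X Y f \<in> Hom D (on_ob F X) (on_ob F Y)"
    using F by (simp_all add: is_functor_def)
  have idn: "\<And>X. X \<in> Ob C \<Longrightarrow> Idn C X \<in> Hom C X X"
    and cmp: "\<And>X Y Z f g. \<lbrakk>X \<in> Ob C; Y \<in> Ob C; Z \<in> Ob C; f \<in> Hom C X Y; g \<in> Hom C Y Z\<rbrakk> \<Longrightarrow>
      Cmp C X Y Z g f \<in> Hom C X Z"
    using C by (simp_all add: is_category_def)
  define G where "G = \<lparr>on_ob = on_ob F,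
    on_hom = \<lambda>X Y c. \<Union>f\<in>c. S (on_ob F X) (on_ob F Y) `` {on_hom F X Y f}\<rparr>"
  have G_ob: "on_ob G = on_ob F"
    by (simp add: G_def)
  have G_class: "on_hom G X Y (R X Y `` {f}) = S (on_ob F X) (on_ob F Y) `` {on_hom F X Y f}"
    if XY: "X \<in> Ob C" "Y \<in> Ob C" "f \<in> Hom C X Y" for X Y f
  proof -
    have "(\<lambda>f. S (on_ob F X) (on_ob F Y) `` {on_hom F X Y f}) respects R X Y"
      using equiv_class_eq[OF congruence_equiv[OF D S ob ob]] XY FRS by (intro congruentI) blast
    from UN_equiv_class[OF congruence_equiv[OF C R] this] show ?thesis
      using XY by (simp add: G_def)
  qed
  have "is_functor (quotient_category C R) (quotient_category D S) G"
    unfolding is_functor_def quotient_category_simps G_ob ball_quotient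
    using F
    by (simp add: is_category_quotient[OF C R] is_category_quotient[OF D S] ob hom idn cmp
        Cmp_quotient_category[OF C R] Cmp_quotient_category[OF D S] G_class is_functor_def
        quotientI)
  moreover have "functor_eq C (functor_comp G (quotient_functor R)) (functor_comp (quotient_functor S) F)"
    by (simp add: functor_eq_def functor_comp_def quotient_functor_def G_ob G_class)
  ultimately show ?thesis by blast
qed

section \<open>Monomial complexes up to homotopy\<close>

lemma monomial_complex_simplex:
  assumes "monomial_complex A X" "\<sigma> \<in> Simp X"
  shows "\<sigma> \<subseteq> Vert X" "finite \<sigma>" "\<sigma> \<noteq> {}"
  using assms by (auto simp: monomial_complex_def abstract_simplicial_complex_def)

lemma monomial_complex_Lab:
  assumes "monomial_complex A X"
  shows "\<lbrakk>\<sigma> \<in> Simp X; \<sigma>' \<in> Simp X; \<sigma> \<subseteq> \<sigma>'\<rbrakk> \<Longrightarrow> Lab X (\<sigma>, \<sigma>') \<in> carrier A"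
    and "\<lbrakk>\<rho> \<in> Simp X; \<sigma> \<in> Simp X; \<tau> \<in> Simp X; \<rho> \<subseteq> \<sigma>; \<sigma> \<subseteq> \<tau>\<rbrakk> \<Longrightarrow>
      Lab X (\<sigma>, \<tau>) \<otimes>\<^bsub>A\<^esub> Lab X (\<rho>, \<sigma>) = Lab X (\<rho>, \<tau>)"
    and "\<sigma> \<in> Simp X \<Longrightarrow> Lab X (\<sigma>, \<sigma>) = \<one>\<^bsub>A\<^esub>"
  using assms by (auto simp: monomial_complex_def PiE_iff)

lemma mono_homD:
  assumes "(f, \<kappa>) \<in> mono_hom A X Y"
  shows "f \<in> Vert X \<rightarrow>\<^sub>E Vert Y" "\<sigma> \<in> Simp X \<Longrightarrow> f ` \<sigma> \<in> Simp Y"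
    "\<kappa> \<in> extensional (Simp X)" "\<sigma> \<in> Simp X \<Longrightarrow> \<kappa> \<sigma> \<in> carrier A"
    "\<lbrakk>\<sigma> \<in> Simp X; \<sigma>' \<in> Simp X; \<sigma> \<subseteq> \<sigma>'\<rbrakk> \<Longrightarrow>
      Lab Y (f ` \<sigma>, f ` \<sigma>') \<otimes>\<^bsub>A\<^esub> \<kappa> \<sigma> = \<kappa> \<sigma>' \<otimes>\<^bsub>A\<^esub> Lab X (\<sigma>, \<sigma>')"
  using assms by (auto simp: mono_hom_def simplicial_map_def PiE_iff)

lemma mono_homI:
  assumes "f \<in> Vert X \<rightarrow>\<^sub>E Vert Y" "\<And>\<sigma>. \<sigma> \<in> Simp X \<Longrightarrow> f ` \<sigma> \<in> Simp Y"
    "\<kappa> \<in> Simp X \<rightarrow>\<^sub>E carrier A"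
    "\<And>\<sigma> \<sigma>'. \<lbrakk>\<sigma> \<in> Simp X; \<sigma>' \<in> Simp X; \<sigma> \<subseteq> \<sigma>'\<rbrakk> \<Longrightarrow>
      Lab Y (f ` \<sigma>, f ` \<sigma>') \<otimes>\<^bsub>A\<^esub> \<kappa> \<sigma> = \<kappa> \<sigma>' \<otimes>\<^bsub>A\<^esub> Lab X (\<sigma>, \<sigma>')"
  shows "(f, \<kappa>) \<in> mono_hom A X Y"
  using assms by (auto simp: mono_hom_def simplicial_map_def)

lemma compose_image_subset: "\<sigma> \<subseteq> S \<Longrightarrow> compose S g f ` \<sigma> = g ` f ` \<sigma>"
  by (force simp: compose_def)

text \<open>Reduces statements about homotopic morphisms to contiguous ones: composition on either
  side and realization all act on chains link by link.\<close>

lemma trancl_map: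
  assumes "(x, y) \<in> r\<^sup>+" "\<And>x y. (x, y) \<in> r \<Longrightarrow> (F x, F y) \<in> s"
  shows "(F x, F y) \<in> s\<^sup>+"
  using assms(1) by induction (auto intro: assms(2) trancl_into_trancl)

context group
begin

lemma mono_id_in_mono_hom:
  assumes X: "monomial_complex G X"
  shows "mono_id G X \<in> mono_hom G X X"
proof -
  have "(\<lambda>s\<in>Vert X. s) ` \<sigma> = \<sigma>" if "\<sigma> \<in> Simp X" for \<sigma>
    using monomial_complex_simplex(1)[OF X that] by (auto simp: subset_iff)
  then show ?thesis
    unfolding mono_id_def using monomial_complex_Lab(1)[OF X]
    by (intro mono_homI) auto
qed

text \<open>The naturality square of \<open>f\<close> for \<sigma> \<subseteq> \<sigma>' is pasted
  to that of \<open>g\<close> for the images of these simplices.\<close>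

lemma mono_comp_in_mono_hom:
  assumes X: "monomial_complex G X" and Y: "monomial_complex G Y" and Z: "monomial_complex G Z"
    and f: "f \<in> mono_hom G X Y" and g: "g \<in> mono_hom G Y Z"
  shows "mono_comp G X g f \<in> mono_hom G X Z"
proof -
  obtain f1 \<kappa> g1 \<mu> where eq: "f = (f1, \<kappa>)" "g = (g1, \<mu>)" by fastforce
  note f = f[unfolded eq] and g = g[unfolded eq]
  note im = compose_image_subset[OF monomial_complex_simplex(1)[OF X]]
  show ?thesis
    unfolding eq mono_comp_def prod.case
  proof (rule mono_homI)
    show "compose (Vert X) g1 f1 \<in> Vert X \<rightarrow>\<^sub>E Vert Z"
      using mono_homD(1)[OF f] mono_homD(1)[OF g] by (auto simp: compose_def PiE_iff)
    show "(\<lambda>\<sigma>\<in>Simp X. \<mu> (f1 ` \<sigma>) \<otimes> \<kappa> \<sigma>) \<in> Simp X \<rightarrow>\<^sub>E carrier G"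
      using mono_homD(2,4)[OF f] mono_homD(4)[OF g] by auto
    show "compose (Vert X) g1 f1 ` \<sigma> \<in> Simp Z" if "\<sigma> \<in> Simp X" for \<sigma>
      using that mono_homD(2)[OF f] mono_homD(2)[OF g] by (simp add: im)
    fix \<sigma> \<sigma>' assume \<sigma>: "\<sigma> \<in> Simp X" "\<sigma>' \<in> Simp X" "\<sigma> \<subseteq> \<sigma>'"
    have s: "f1 ` \<sigma> \<in> Simp Y" "f1 ` \<sigma>' \<in> Simp Y" "f1 ` \<sigma> \<subseteq> f1 ` \<sigma>'"
      "g1 ` f1 ` \<sigma> \<in> Simp Z" "g1 ` f1 ` \<sigma>' \<in> Simp Z" "g1 ` f1 ` \<sigma> \<subseteq> g1 ` f1 ` \<sigma>'"
      using \<sigma> mono_homD(2)[OF f] mono_homD(2)[OF g] by auto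
    have c: "\<kappa> \<sigma> \<in> carrier G" "\<kappa> \<sigma>' \<in> carrier G" "\<mu> (f1 ` \<sigma>) \<in> carrier G"
      "\<mu> (f1 ` \<sigma>') \<in> carrier G" "Lab X (\<sigma>, \<sigma>') \<in> carrier G"
      "Lab Y (f1 ` \<sigma>, f1 ` \<sigma>') \<in> carrier G" "Lab Z (g1 ` f1 ` \<sigma>, g1 ` f1 ` \<sigma>') \<in> carrier G"
      using \<sigma> s mono_homD(4)[OF f] mono_homD(4)[OF g] monomial_complex_Lab(1)[OF X]
        monomial_complex_Lab(1)[OF Y] monomial_complex_Lab(1)[OF Z] by simp_all
    have "Lab Z (g1 ` f1 ` \<sigma>, g1 ` f1 ` \<sigma>') \<otimes> (\<mu> (f1 ` \<sigma>) \<otimes> \<kappa> \<sigma>) =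
        \<mu> (f1 ` \<sigma>') \<otimes> Lab Y (f1 ` \<sigma>, f1 ` \<sigma>') \<otimes> \<kappa> \<sigma>"
      using mono_homD(5)[OF g s(1-3)] c by (simp add: m_assoc[symmetric])
    also have "\<dots> = \<mu> (f1 ` \<sigma>') \<otimes> \<kappa> \<sigma>' \<otimes> Lab X (\<sigma>, \<sigma>')"
      using mono_homD(5)[OF f \<sigma>] c by (simp add: m_assoc)
    finally show "Lab Z (compose (Vert X) g1 f1 ` \<sigma>, compose (Vert X) g1 f1 ` \<sigma>') \<otimes>
        (\<lambda>\<sigma>\<in>Simp X. \<mu> (f1 ` \<sigma>) \<otimes> \<kappa> \<sigma>) \<sigma> =
        (\<lambda>\<sigma>\<in>Simp X. \<mu> (f1 ` \<sigma>) \<otimes> \<kappa> \<sigma>) \<sigma>' \<otimes> Lab X (\<sigma>, \<sigma>')"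
      using \<sigma> by (simp add: im)
  qed
qed

lemma mono_comp_unit:
  assumes X: "monomial_complex G X" and Y: "monomial_complex G Y" and f: "f \<in> mono_hom G X Y"
  shows "mono_comp G X f (mono_id G X) = f" "mono_comp G X (mono_id G Y) f = f"
proof -
  obtain f1 \<kappa> where eq: "f = (f1, \<kappa>)" by fastforce
  note f = f[unfolded eq]
  have im: "(\<lambda>s\<in>Vert X. s) ` \<sigma> = \<sigma>" if "\<sigma> \<in> Simp X" for \<sigma>
    using monomial_complex_simplex(1)[OF X that] by (auto simp: subset_iff)
  have "f1 \<in> Vert X \<rightarrow> Vert Y" "f1 \<in> extensional (Vert X)"
    using mono_homD(1)[OF f] by (auto simp: PiE_iff)
  moreover have "(\<lambda>\<sigma>\<in>Simp X. \<kappa> ((\<lambda>s\<in>Vert X. s) ` \<sigma>) \<otimes> (\<lambda>\<sigma>\<in>Simp X. \<one>) \<sigma>) = \<kappa>"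
  proof -
    have "(\<lambda>\<sigma>\<in>Simp X. \<kappa> ((\<lambda>s\<in>Vert X. s) ` \<sigma>) \<otimes> (\<lambda>\<sigma>\<in>Simp X. \<one>) \<sigma>) = restrict \<kappa> (Simp X)"
      by (rule restrict_ext) (simp only: im restrict_apply if_True mono_homD(4)[OF f] r_one)
    then show ?thesis
      using mono_homD(3)[OF f] by (simp only: extensional_restrict)
  qed
  moreover have "(\<lambda>\<sigma>\<in>Simp X. (\<lambda>\<sigma>\<in>Simp Y. \<one>) (f1 ` \<sigma>) \<otimes> \<kappa> \<sigma>) = \<kappa>"
    using mono_homD(2,3,4)[OF f] by (intro extensionalityI[of _ "Simp X"]) auto
  ultimately show "mono_comp G X f (mono_id G X) = f" "mono_comp G X (mono_id G Y) f = f"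
    by (simp_all add: eq mono_comp_def mono_id_def Id_compose compose_Id)
qed

lemma mono_comp_assoc:
  assumes W: "monomial_complex G W"
    and f: "f \<in> mono_hom G W X" and g: "g \<in> mono_hom G X Y" and h: "h \<in> mono_hom G Y Z"
  shows "mono_comp G W (mono_comp G X h g) f = mono_comp G W h (mono_comp G W g f)"
proof -
  obtain f1 \<kappa> g1 \<mu> h1 \<nu> where eq: "f = (f1, \<kappa>)" "g = (g1, \<mu>)" "h = (h1, \<nu>)"
    by (meson surj_pair)
  note f = f[unfolded eq] and g = g[unfolded eq] and h = h[unfolded eq]
  have "compose (Vert W) (compose (Vert X) h1 g1) f1 = compose (Vert W) h1 (compose (Vert W) g1 f1)"
    using mono_homD(1)[OF f] mono_homD(1)[OF g] by (auto simp: compose_def fun_eq_iff)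
  moreover have "(\<lambda>\<sigma>\<in>Simp W. (\<lambda>\<sigma>\<in>Simp X. \<nu> (g1 ` \<sigma>) \<otimes> \<mu> \<sigma>) (f1 ` \<sigma>) \<otimes> \<kappa> \<sigma>) =
      (\<lambda>\<sigma>\<in>Simp W. \<nu> (compose (Vert W) g1 f1 ` \<sigma>) \<otimes> (\<lambda>\<sigma>\<in>Simp W. \<mu> (f1 ` \<sigma>) \<otimes> \<kappa> \<sigma>) \<sigma>)"
    using mono_homD(2,4)[OF f] mono_homD(2,4)[OF g] mono_homD(4)[OF h]
    by (intro restrict_ext)
      (simp add: compose_image_subset[OF monomial_complex_simplex(1)[OF W]] m_assoc)
  ultimately show ?thesis
    by (simp add: eq mono_comp_def)
qed

lemma is_category_simp_cat: "is_category (simp_cat G)"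
  unfolding is_category_def simp_cat_def category.simps mem_Collect_eq
  by (intro conjI ballI; unfold mem_Collect_eq; (elim conjE)?;
      (rule mono_id_in_mono_hom | rule mono_comp_in_mono_hom | rule mono_comp_unit | rule mono_comp_assoc);
      assumption)

lemma contiguousD:
  assumes "((f, \<kappa>), (f', \<kappa>')) \<in> contiguous G X Y"
  shows "(f, \<kappa>) \<in> mono_hom G X Y" "(f', \<kappa>') \<in> mono_hom G X Y"
    "\<sigma> \<in> Simp X \<Longrightarrow> f ` \<sigma> \<union> f' ` \<sigma> \<in> Simp Y"
    "\<sigma> \<in> Simp X \<Longrightarrow> Lab Y (f ` \<sigma>, f ` \<sigma> \<union> f' ` \<sigma>) \<otimes> \<kappa> \<sigma> =
      Lab Y (f' ` \<sigma>, f ` \<sigma> \<union> f' ` \<sigma>) \<otimes> \<kappa>' \<sigma>"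
  using assms by (auto simp: contiguous_def)

lemma contiguous_refl: "f \<in> mono_hom G X Y \<Longrightarrow> (f, f) \<in> contiguous G X Y"
  using mono_homD(2)[of "fst f" "snd f" G X Y] by (cases f) (auto simp: contiguous_def)

lemma contiguous_sym: "(f, g) \<in> contiguous G X Y \<Longrightarrow> (g, f) \<in> contiguous G X Y"
  by (auto simp: contiguous_def Un_commute)

text \<open>Contiguity is already reflexive on morphisms and symmetric; only transitivity is added
  by the closure.\<close>

lemma equiv_simp_homotopic: "equiv (mono_hom G X Y) (simp_homotopic G X Y)"
  unfolding simp_homotopic_def
proof (rule equivI)
  show "(contiguous G X Y)\<^sup>+ \<subseteq> mono_hom G X Y \<times> mono_hom G X Y"
    by (rule trancl_subset_Sigma) (auto simp: contiguous_def)
  then show "refl_on (mono_hom G X Y) ((contiguous G X Y)\<^sup>+)"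
    by (auto simp: refl_on_def intro: contiguous_refl)
  show "sym ((contiguous G X Y)\<^sup>+)"
    by (rule sym_trancl, rule symI, rule contiguous_sym)
qed (rule trans_trancl)

text \<open>This is the contiguity of \<open>g\<close> and \<open>g'\<close> at the image simplex
  f(\<sigma>), multiplied on the right by \<kappa>(\<sigma>).\<close>

lemma contiguous_mono_comp_left:
  assumes X: "monomial_complex G X" and Y: "monomial_complex G Y" and Z: "monomial_complex G Z"
    and f: "f \<in> mono_hom G X Y" and g: "(g, g') \<in> contiguous G Y Z"
  shows "(mono_comp G X g f, mono_comp G X g' f) \<in> contiguous G X Z"
proof -
  obtain f1 \<kappa> g1 \<mu> g1' \<mu>' where eq: "f = (f1, \<kappa>)" "g = (g1, \<mu>)" "g' = (g1', \<mu>')"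
    by (meson surj_pair)
  note f = f[unfolded eq] and g = g[unfolded eq]
  have hom: "mono_comp G X (g1, \<mu>) (f1, \<kappa>) \<in> mono_hom G X Z"
    "mono_comp G X (g1', \<mu>') (f1, \<kappa>) \<in> mono_hom G X Z"
    using mono_comp_in_mono_hom[OF X Y Z f] contiguousD(1,2)[OF g] by auto
  have "Lab Z (g1 ` f1 ` \<sigma>, g1 ` f1 ` \<sigma> \<union> g1' ` f1 ` \<sigma>) \<otimes> (\<mu> (f1 ` \<sigma>) \<otimes> \<kappa> \<sigma>) =
      Lab Z (g1' ` f1 ` \<sigma>, g1 ` f1 ` \<sigma> \<union> g1' ` f1 ` \<sigma>) \<otimes> (\<mu>' (f1 ` \<sigma>) \<otimes> \<kappa> \<sigma>)"
    if \<sigma>: "\<sigma> \<in> Simp X" for \<sigma>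
  proof -
    have s: "f1 ` \<sigma> \<in> Simp Y" "\<kappa> \<sigma> \<in> carrier G"
      using mono_homD[OF f] \<sigma> by auto
    have c: "\<mu> (f1 ` \<sigma>) \<in> carrier G" "\<mu>' (f1 ` \<sigma>) \<in> carrier G"
      "Lab Z (g1 ` f1 ` \<sigma>, g1 ` f1 ` \<sigma> \<union> g1' ` f1 ` \<sigma>) \<in> carrier G"
      "Lab Z (g1' ` f1 ` \<sigma>, g1 ` f1 ` \<sigma> \<union> g1' ` f1 ` \<sigma>) \<in> carrier G"
      using s contiguousD(3)[OF g] mono_homD(2,4)[OF contiguousD(1)[OF g]]
        mono_homD(2,4)[OF contiguousD(2)[OF g]] by (auto intro!: monomial_complex_Lab(1)[OF Z])
    then show ?thesis
      using contiguousD(4)[OF g s(1)] s(2) by (simp add: m_assoc[symmetric])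
  qed
  then show ?thesis
    using hom contiguousD(3)[OF g] mono_homD(2)[OF f]
    by (simp add: eq contiguous_def mono_comp_def
        compose_image_subset[OF monomial_complex_simplex(1)[OF X]])
qed

text \<open>Naturality of \<mu> along the inclusions of f(\<sigma>) and f'(\<sigma>) into their
  union pulls the common left factor \<mu>(f(\<sigma>) \<union> f'(\<sigma>)) out of both sides.
  What remains is the contiguity of \<open>f\<close> and \<open>f'\<close>.\<close>

lemma contiguous_mono_comp_right:
  assumes X: "monomial_complex G X" and Y: "monomial_complex G Y" and Z: "monomial_complex G Z"
    and f: "(f, f') \<in> contiguous G X Y" and g: "g \<in> mono_hom G Y Z"
  shows "(mono_comp G X g f, mono_comp G X g f') \<in> contiguous G X Z"
proof -
  obtain f1 \<kappa> f1' \<kappa>' g1 \<mu> where eq: "f = (f1, \<kappa>)" "f' = (f1', \<kappa>')" "g = (g1, \<mu>)"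
    by (meson surj_pair)
  note f = f[unfolded eq] and g = g[unfolded eq]
  have hom: "mono_comp G X (g1, \<mu>) (f1, \<kappa>) \<in> mono_hom G X Z"
    "mono_comp G X (g1, \<mu>) (f1', \<kappa>') \<in> mono_hom G X Z"
    using mono_comp_in_mono_hom[OF X Y Z _ g] contiguousD(1,2)[OF f] by auto
  have "Lab Z (g1 ` f1 ` \<sigma>, g1 ` f1 ` \<sigma> \<union> g1 ` f1' ` \<sigma>) \<otimes> (\<mu> (f1 ` \<sigma>) \<otimes> \<kappa> \<sigma>) =
      Lab Z (g1 ` f1' ` \<sigma>, g1 ` f1 ` \<sigma> \<union> g1 ` f1' ` \<sigma>) \<otimes> (\<mu> (f1' ` \<sigma>) \<otimes> \<kappa>' \<sigma>)"
    if \<sigma>: "\<sigma> \<in> Simp X" for \<sigma>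
  proof -
    let ?T = "f1 ` \<sigma> \<union> f1' ` \<sigma>"
    have key: "Lab Z (g1 ` e ` \<sigma>, g1 ` ?T) \<otimes> (\<mu> (e ` \<sigma>) \<otimes> \<nu> \<sigma>) =
        \<mu> ?T \<otimes> (Lab Y (e ` \<sigma>, ?T) \<otimes> \<nu> \<sigma>)"
      if e: "(e, \<nu>) \<in> mono_hom G X Y" "e ` \<sigma> \<subseteq> ?T" for e \<nu>
    proof -
      have T: "?T \<in> Simp Y"
        by (rule contiguousD(3)[OF f \<sigma>])
      have s: "e ` \<sigma> \<in> Simp Y" "\<nu> \<sigma> \<in> carrier G"
        using mono_homD[OF e(1)] \<sigma> by auto
      have "Lab Z (g1 ` e ` \<sigma>, g1 ` ?T) \<in> carrier G"
        by (intro monomial_complex_Lab(1)[OF Z] mono_homD(2)[OF g] s T image_mono e)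
      moreover have "\<mu> (e ` \<sigma>) \<in> carrier G" "\<mu> ?T \<in> carrier G" "Lab Y (e ` \<sigma>, ?T) \<in> carrier G"
        by (intro monomial_complex_Lab(1)[OF Y] mono_homD(4)[OF g] s T e)+
      ultimately show ?thesis
        using mono_homD(5)[OF g s(1) T e(2)] s(2) by (simp only: m_assoc[symmetric] m_closed)
    qed
    show ?thesis
      using key[OF contiguousD(1)[OF f]] key[OF contiguousD(2)[OF f]] contiguousD(4)[OF f \<sigma>]
      by (simp add: image_Un)
  qed
  moreover have "g1 ` f1 ` \<sigma> \<union> g1 ` f1' ` \<sigma> \<in> Simp Z" if "\<sigma> \<in> Simp X" for \<sigma>
    using mono_homD(2)[OF g contiguousD(3)[OF f that]] by (simp add: image_Un)
  ultimately show ?thesis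
    using hom
    by (simp add: eq contiguous_def mono_comp_def
        compose_image_subset[OF monomial_complex_simplex(1)[OF X]])
qed

lemma simp_homotopic_congruence: "category_congruence (simp_cat G) (simp_homotopic G)"
proof (rule category_congruenceI, unfold simp_cat_def category.simps mem_Collect_eq)
  fix X Y Z f g g'
  assume "monomial_complex G X \<and> finite (Vert X)" "monomial_complex G Y \<and> finite (Vert Y)"
    "monomial_complex G Z \<and> finite (Vert Z)"
    and "f \<in> mono_hom G X Y" "(g, g') \<in> simp_homotopic G Y Z"
  then show "(mono_comp G X g f, mono_comp G X g' f) \<in> simp_homotopic G X Z"
    unfolding simp_homotopic_def
    by (intro trancl_map[where F = "\<lambda>g. mono_comp G X g f" and r = "contiguous G Y Z"])
      (auto intro: contiguous_mono_comp_left)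
next
  fix X Y Z f f' g
  assume "monomial_complex G X \<and> finite (Vert X)" "monomial_complex G Y \<and> finite (Vert Y)"
    "monomial_complex G Z \<and> finite (Vert Z)"
    and "(f, f') \<in> simp_homotopic G X Y" "g \<in> mono_hom G Y Z"
  then show "(mono_comp G X g f, mono_comp G X g f') \<in> simp_homotopic G X Z"
    unfolding simp_homotopic_def
    by (intro trancl_map[where F = "\<lambda>f. mono_comp G X g f" and r = "contiguous G X Y"])
      (auto intro: contiguous_mono_comp_right)
qed (rule equiv_simp_homotopic)

end

section \<open>Fibered bundles up to homotopy\<close>

lemma fibered_bundleD:
  assumes "fibered_bundle A TA B"
  shows "a \<in> carrier A \<Longrightarrow> continuous_map (Tot B) (Tot B) (Act B a)"
    "\<lbrakk>a \<in> carrier A; e \<in> topspace (Tot B)\<rbrakk> \<Longrightarrow> Act B a e \<in> topspace (Tot B)"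
    "continuous_map (Tot B) (Base B) (Proj B)"
    "e \<in> topspace (Tot B) \<Longrightarrow> Proj B e \<in> topspace (Base B)"
    "\<lbrakk>a \<in> carrier A; e \<in> topspace (Tot B)\<rbrakk> \<Longrightarrow> Proj B (Act B a e) = Proj B e"
proof -
  show 1: "a \<in> carrier A \<Longrightarrow> continuous_map (Tot B) (Tot B) (Act B a)"
    using assms by (simp add: fibered_bundle_def homeomorphic_imp_continuous_map)
  then show "\<lbrakk>a \<in> carrier A; e \<in> topspace (Tot B)\<rbrakk> \<Longrightarrow> Act B a e \<in> topspace (Tot B)"
    by (auto simp: continuous_map_def)
  show 2: "continuous_map (Tot B) (Base B) (Proj B)"
    using assms by (simp add: fibered_bundle_def)
  then show "e \<in> topspace (Tot B) \<Longrightarrow> Proj B e \<in> topspace (Base B)"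
    by (auto simp: continuous_map_def)
  show "\<lbrakk>a \<in> carrier A; e \<in> topspace (Tot B)\<rbrakk> \<Longrightarrow> Proj B (Act B a e) = Proj B e"
    using assms by (simp add: fibered_bundle_def)
qed

lemma bundle_homD:
  assumes "(\<phi>, f) \<in> bundle_hom A B B'"
  shows "continuous_map (Tot B) (Tot B') \<phi>" "\<phi> \<in> extensional (topspace (Tot B))"
    "continuous_map (Base B) (Base B') f" "f \<in> extensional (topspace (Base B))"
    "\<lbrakk>a \<in> carrier A; e \<in> topspace (Tot B)\<rbrakk> \<Longrightarrow> \<phi> (Act B a e) = Act B' a (\<phi> e)"
    "e \<in> topspace (Tot B) \<Longrightarrow> Proj B' (\<phi> e) = f (Proj B e)"
    "e \<in> topspace (Tot B) \<Longrightarrow> \<phi> e \<in> topspace (Tot B')"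
    "x \<in> topspace (Base B) \<Longrightarrow> f x \<in> topspace (Base B')"
  using assms by (auto simp: bundle_hom_def continuous_map_def)

lemma continuous_map_compose_topspace:
  assumes "continuous_map X Y f" "continuous_map Y Z g"
  shows "continuous_map X Z (compose (topspace X) g f)"
  using continuous_map_compose[OF assms] by (rule continuous_map_eq) (simp add: compose_def)

lemma bundle_id_in_bundle_hom:
  assumes "fibered_bundle A TA B"
  shows "(\<lambda>e\<in>topspace (Tot B). e, \<lambda>x\<in>topspace (Base B). x) \<in> bundle_hom A B B"
proof -
  have "continuous_map X X (\<lambda>e\<in>topspace X. e)" for X :: "'x topology"
    by (rule continuous_map_eq[of _ _ id]) auto
  then show ?thesis
    using fibered_bundleD[OF assms] by (auto simp: bundle_hom_def)
qed

lemma bundle_comp_in_bundle_hom: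
  assumes B: "fibered_bundle A TA B" and f: "(\<phi>, f) \<in> bundle_hom A B B'"
    and g: "(\<psi>, g) \<in> bundle_hom A B' B''"
  shows "(compose (topspace (Tot B)) \<psi> \<phi>, compose (topspace (Base B)) g f) \<in> bundle_hom A B B''"
  using bundle_homD[OF f] bundle_homD[OF g] fibered_bundleD[OF B]
  by (simp add: bundle_hom_def continuous_map_compose_topspace) (simp add: compose_def)

lemma is_category_top_cat: "is_category (top_cat A TA)"
  unfolding is_category_def top_cat_def category.simps
proof (intro conjI ballI; unfold mem_Collect_eq)
  fix X :: "('a, 'b, 'c) fib_bundle" assume "fibered_bundle A TA X"
  then show "(\<lambda>e\<in>topspace (Tot X). e, \<lambda>x\<in>topspace (Base X). x) \<in> bundle_hom A X X"
    by (rule bundle_id_in_bundle_hom)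
next
  fix X Y Z :: "('a, 'b, 'c) fib_bundle" and f g :: "('b \<Rightarrow> 'b) \<times> ('c \<Rightarrow> 'c)"
  assume "fibered_bundle A TA X" "f \<in> bundle_hom A X Y" "g \<in> bundle_hom A Y Z"
  then show "(case g of (\<phi>', f') \<Rightarrow> \<lambda>(\<phi>, f).
      (compose (topspace (Tot X)) \<phi>' \<phi>, compose (topspace (Base X)) f' f)) f \<in> bundle_hom A X Z"
    using bundle_comp_in_bundle_hom by (cases f, cases g) simp
next
  fix X Y :: "('a, 'b, 'c) fib_bundle" and f :: "('b \<Rightarrow> 'b) \<times> ('c \<Rightarrow> 'c)"
  assume "f \<in> bundle_hom A X Y"
  moreover obtain f1 f2 where "f = (f1, f2)" by fastforce
  ultimately have f: "(f1, f2) \<in> bundle_hom A X Y" and eq: "f = (f1, f2)" by auto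
  have "f1 \<in> topspace (Tot X) \<rightarrow> topspace (Tot Y)" "f2 \<in> topspace (Base X) \<rightarrow> topspace (Base Y)"
    using bundle_homD(7,8)[OF f] by auto
  then show "(case f of (\<phi>', f') \<Rightarrow> \<lambda>(\<phi>, f).
        (compose (topspace (Tot X)) \<phi>' \<phi>, compose (topspace (Base X)) f' f))
      (\<lambda>e\<in>topspace (Tot X). e, \<lambda>x\<in>topspace (Base X). x) = f"
    "(case (\<lambda>e\<in>topspace (Tot Y). e, \<lambda>x\<in>topspace (Base Y). x) of (\<phi>', f') \<Rightarrow> \<lambda>(\<phi>, f).
        (compose (topspace (Tot X)) \<phi>' \<phi>, compose (topspace (Base X)) f' f)) f = f"
    using bundle_homD(2,4)[OF f] by (simp_all add: eq Id_compose compose_Id)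
next
  fix W X Y Z :: "('a, 'b, 'c) fib_bundle" and f g h :: "('b \<Rightarrow> 'b) \<times> ('c \<Rightarrow> 'c)"
  assume "f \<in> bundle_hom A W X"
  moreover obtain f1 f2 g1 g2 h1 h2 where eq: "f = (f1, f2)" "g = (g1, g2)" "h = (h1, h2)"
    by (meson surj_pair)
  ultimately have f: "(f1, f2) \<in> bundle_hom A W X" by simp
  have "f1 \<in> topspace (Tot W) \<rightarrow> topspace (Tot X)" "f2 \<in> topspace (Base W) \<rightarrow> topspace (Base X)"
    using bundle_homD(7,8)[OF f] by auto
  then show "(case (case h of (\<phi>', f') \<Rightarrow> \<lambda>(\<phi>, f).
          (compose (topspace (Tot X)) \<phi>' \<phi>, compose (topspace (Base X)) f' f)) g of
        (\<phi>', f') \<Rightarrow> \<lambda>(\<phi>, f).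
          (compose (topspace (Tot W)) \<phi>' \<phi>, compose (topspace (Base W)) f' f)) f =
      (case h of (\<phi>', f') \<Rightarrow> \<lambda>(\<phi>, f).
          (compose (topspace (Tot W)) \<phi>' \<phi>, compose (topspace (Base W)) f' f))
        ((case g of (\<phi>', f') \<Rightarrow> \<lambda>(\<phi>, f).
          (compose (topspace (Tot W)) \<phi>' \<phi>, compose (topspace (Base W)) f' f)) f)"
    by (simp add: eq compose_assoc)
qed

text \<open>Concatenation of homotopies at double speed, by pasting along two closed halves that
  meet at time 1/2. Transitivity uses it twice, for the total spaces and for the bases.\<close>

lemma continuous_map_concat:
  assumes H1: "continuous_map (prod_topology X unit_interval) Y H1"
    and H2: "continuous_map (prod_topology X unit_interval) Y H2"
    and eq: "\<And>x. x \<in> topspace X \<Longrightarrow> H1 (x, 1) = H2 (x, 0)"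
  shows "continuous_map (prod_topology X unit_interval) Y
    (\<lambda>p. if snd p \<le> 1/2 then H1 (fst p, 2 * snd p) else H2 (fst p, 2 * snd p - 1))"
proof (rule continuous_map_cases_le)
  let ?P = "prod_topology X unit_interval"
  have fst: "continuous_map ?P X fst" and snd: "continuous_map ?P euclideanreal snd"
    using continuous_map_fst continuous_map_snd continuous_map_in_subtopology by blast+
  show "continuous_map ?P euclideanreal snd" by (rule snd)
  show "continuous_map ?P euclideanreal (\<lambda>_. 1/2)" by simp
  have "continuous_map (subtopology ?P {x \<in> topspace ?P. snd x \<le> 1/2}) ?P (\<lambda>p. (fst p, 2 * snd p))"
    by (intro continuous_map_pairedI continuous_map_into_subtopology continuous_map_from_subtopology
      continuous_intros fst snd) (auto simp: topspace_subtopology)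
  from continuous_map_compose[OF this H1]
  show "continuous_map (subtopology ?P {x \<in> topspace ?P. snd x \<le> 1/2}) Y (\<lambda>p. H1 (fst p, 2 * snd p))"
    by (simp add: o_def)
  have "continuous_map (subtopology ?P {x \<in> topspace ?P. 1/2 \<le> snd x}) ?P (\<lambda>p. (fst p, 2 * snd p - 1))"
    by (intro continuous_map_pairedI continuous_map_into_subtopology continuous_map_from_subtopology
      continuous_intros fst snd) (auto simp: topspace_subtopology)
  from continuous_map_compose[OF this H2]
  show "continuous_map (subtopology ?P {x \<in> topspace ?P. 1/2 \<le> snd x}) Y (\<lambda>p. H2 (fst p, 2 * snd p - 1))"
    by (simp add: o_def)
  show "H1 (fst x, 2 * snd x) = H2 (fst x, 2 * snd x - 1)"
    if "x \<in> topspace ?P" "snd x = 1/2" for x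
    using that(1) eq[of "fst x"] unfolding that(2) by auto
qed

text \<open>The condition under the existential quantifiers of \<open>bundle_homotopic\<close>, made
  a predicate of the witnesses \<open>H\<close> and \<open>h\<close> so that its parts can be
  addressed as named facts once witnesses are obtained.\<close>

definition bundle_homotopy where
  "bundle_homotopy A B B' \<phi> f \<phi>' f' H h \<longleftrightarrow>
     continuous_map (prod_topology (Tot B) unit_interval) (Tot B') H \<and>
     continuous_map (prod_topology (Base B) unit_interval) (Base B') h \<and>
     (\<forall>a\<in>carrier A. \<forall>e\<in>topspace (Tot B). \<forall>t\<in>{0..1}. H (Act B a e, t) = Act B' a (H (e, t))) \<and>
     (\<forall>e\<in>topspace (Tot B). \<forall>t\<in>{0..1}. Proj B' (H (e, t)) = h (Proj B e, t)) \<and>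
     (\<forall>e\<in>topspace (Tot B). H (e, 0) = \<phi> e \<and> H (e, 1) = \<phi>' e) \<and>
     (\<forall>x\<in>topspace (Base B). h (x, 0) = f x \<and> h (x, 1) = f' x)"

lemma bundle_homotopyD:
  assumes "bundle_homotopy A B B' \<phi> f \<phi>' f' H h"
  shows "continuous_map (prod_topology (Tot B) unit_interval) (Tot B') H"
    "continuous_map (prod_topology (Base B) unit_interval) (Base B') h"
    "\<lbrakk>a \<in> carrier A; e \<in> topspace (Tot B); 0 \<le> t; t \<le> 1\<rbrakk> \<Longrightarrow> H (Act B a e, t) = Act B' a (H (e, t))"
    "\<lbrakk>e \<in> topspace (Tot B); 0 \<le> t; t \<le> 1\<rbrakk> \<Longrightarrow> Proj B' (H (e, t)) = h (Proj B e, t)"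
    "e \<in> topspace (Tot B) \<Longrightarrow> H (e, 0) = \<phi> e" "e \<in> topspace (Tot B) \<Longrightarrow> H (e, 1) = \<phi>' e"
    "x \<in> topspace (Base B) \<Longrightarrow> h (x, 0) = f x" "x \<in> topspace (Base B) \<Longrightarrow> h (x, 1) = f' x"
  using assms by (simp_all add: bundle_homotopy_def)

lemma bundle_homotopicE:
  assumes "((\<phi>, f), (\<phi>', f')) \<in> bundle_homotopic A B B'"
  obtains H h where "(\<phi>, f) \<in> bundle_hom A B B'" "(\<phi>', f') \<in> bundle_hom A B B'"
    "bundle_homotopy A B B' \<phi> f \<phi>' f' H h"
  using assms unfolding bundle_homotopic_def bundle_homotopy_def by blast

lemma bundle_homotopicI:
  assumes "(\<phi>, f) \<in> bundle_hom A B B'" "(\<phi>', f') \<in> bundle_hom A B B'"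
    "continuous_map (prod_topology (Tot B) unit_interval) (Tot B') H"
    "continuous_map (prod_topology (Base B) unit_interval) (Base B') h"
    "\<And>a e t. \<lbrakk>a \<in> carrier A; e \<in> topspace (Tot B); 0 \<le> t; t \<le> 1\<rbrakk> \<Longrightarrow>
      H (Act B a e, t) = Act B' a (H (e, t))"
    "\<And>e t. \<lbrakk>e \<in> topspace (Tot B); 0 \<le> t; t \<le> 1\<rbrakk> \<Longrightarrow> Proj B' (H (e, t)) = h (Proj B e, t)"
    "\<And>e. e \<in> topspace (Tot B) \<Longrightarrow> H (e, 0) = \<phi> e" "\<And>e. e \<in> topspace (Tot B) \<Longrightarrow> H (e, 1) = \<phi>' e"
    "\<And>x. x \<in> topspace (Base B) \<Longrightarrow> h (x, 0) = f x" "\<And>x. x \<in> topspace (Base B) \<Longrightarrow> h (x, 1) = f' x"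
  shows "((\<phi>, f), (\<phi>', f')) \<in> bundle_homotopic A B B'"
  unfolding bundle_homotopic_def mem_Collect_eq prod.case
  using assms by (intro conjI exI[of _ H] exI[of _ h]) simp_all

lemma equiv_bundle_homotopic:
  assumes B: "fibered_bundle A TA B"
  shows "equiv (bundle_hom A B B') (bundle_homotopic A B B')"
proof (rule equivI)
  show "bundle_homotopic A B B' \<subseteq> bundle_hom A B B' \<times> bundle_hom A B B'"
    by (auto simp: bundle_homotopic_def)
  have "((\<phi>, f), (\<phi>, f)) \<in> bundle_homotopic A B B'" if "(\<phi>, f) \<in> bundle_hom A B B'" for \<phi> f
    by (rule bundle_homotopicI[OF that that, of "\<lambda>p. \<phi> (fst p)" "\<lambda>p. f (fst p)"])
      (use bundle_homD[OF that] continuous_map_compose[OF continuous_map_fst, unfolded o_def] in auto)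
  then show "refl_on (bundle_hom A B B') (bundle_homotopic A B B')"
    by (auto simp: refl_on_def bundle_homotopic_def)
  have rev: "continuous_map (prod_topology X unit_interval) (prod_topology X unit_interval)
      (\<lambda>p. (fst p, 1 - snd p))" for X :: "'x topology"
    by (intro continuous_map_pairedI continuous_map_into_subtopology continuous_intros
        continuous_map_into_fulltopology[OF continuous_map_snd]) auto
  show "sym (bundle_homotopic A B B')"
  proof (rule symI, clarify)
    fix \<phi> f \<phi>' f' assume "((\<phi>, f), (\<phi>', f')) \<in> bundle_homotopic A B B'"
    then obtain H h where H: "(\<phi>, f) \<in> bundle_hom A B B'" "(\<phi>', f') \<in> bundle_hom A B B'"
      "bundle_homotopy A B B' \<phi> f \<phi>' f' H h"
      by (rule bundle_homotopicE)
    note HD = bundle_homotopyD[OF H(3)]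
    show "((\<phi>', f'), (\<phi>, f)) \<in> bundle_homotopic A B B'"
      by (rule bundle_homotopicI[OF H(2,1) continuous_map_compose[OF rev HD(1)]
            continuous_map_compose[OF rev HD(2)]])
        (simp_all add: HD)
  qed
  show "trans (bundle_homotopic A B B')"
  proof (rule transI, clarify)
    fix \<phi> f \<phi>' f' \<phi>'' f''
    assume 1: "((\<phi>, f), (\<phi>', f')) \<in> bundle_homotopic A B B'"
      and 2: "((\<phi>', f'), (\<phi>'', f'')) \<in> bundle_homotopic A B B'"
    from 1 obtain H h where H: "(\<phi>, f) \<in> bundle_hom A B B'" "(\<phi>', f') \<in> bundle_hom A B B'"
      "bundle_homotopy A B B' \<phi> f \<phi>' f' H h"
      by (rule bundle_homotopicE)
    note HD = bundle_homotopyD[OF H(3)]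
    from 2 obtain K k where K: "(\<phi>', f') \<in> bundle_hom A B B'" "(\<phi>'', f'') \<in> bundle_hom A B B'"
      "bundle_homotopy A B B' \<phi>' f' \<phi>'' f'' K k"
      by (rule bundle_homotopicE)
    note KD = bundle_homotopyD[OF K(3)]
    show "((\<phi>, f), (\<phi>'', f'')) \<in> bundle_homotopic A B B'"
      by (rule bundle_homotopicI[OF H(1) K(2) continuous_map_concat[OF HD(1) KD(1)]
            continuous_map_concat[OF HD(2) KD(2)]]) (simp_all add: HD KD)
  qed
qed

text \<open>The given homotopies are precomposed with \<phi> \<times> id and f \<times> id.\<close>

lemma bundle_homotopic_comp_left:
  assumes B: "fibered_bundle A TA B" and f: "(\<phi>, f) \<in> bundle_hom A B B'"
    and g: "((\<psi>, g), (\<psi>', g')) \<in> bundle_homotopic A B' B''"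
  shows "((compose (topspace (Tot B)) \<psi> \<phi>, compose (topspace (Base B)) g f),
      (compose (topspace (Tot B)) \<psi>' \<phi>, compose (topspace (Base B)) g' f))
    \<in> bundle_homotopic A B B''"
proof -
  from g obtain H h where H: "(\<psi>, g) \<in> bundle_hom A B' B''" "(\<psi>', g') \<in> bundle_hom A B' B''"
    "bundle_homotopy A B' B'' \<psi> g \<psi>' g' H h"
    by (rule bundle_homotopicE)
  note HD = bundle_homotopyD[OF H(3)]
  have pair: "continuous_map (prod_topology X unit_interval) (prod_topology Y unit_interval)
      (\<lambda>p. (u (fst p), snd p))" if "continuous_map X Y u"
    for X :: "'x topology" and Y :: "'y topology" and u
    by (intro continuous_map_pairedI continuous_map_snd
        continuous_map_compose[OF continuous_map_fst that, unfolded o_def])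
  note pair = pair[OF bundle_homD(1)[OF f]] pair[OF bundle_homD(3)[OF f]]
  show ?thesis
    by (rule bundle_homotopicI[OF bundle_comp_in_bundle_hom[OF B f H(1)]
          bundle_comp_in_bundle_hom[OF B f H(2)]
          continuous_map_compose[OF pair(1) HD(1)]
          continuous_map_compose[OF pair(2) HD(2)]])
      (simp_all add: compose_def HD bundle_homD(5-)[OF f])
qed

lemma bundle_homotopic_comp_right:
  assumes B: "fibered_bundle A TA B" and f: "((\<phi>, f), (\<phi>', f')) \<in> bundle_homotopic A B B'"
    and g: "(\<psi>, g) \<in> bundle_hom A B' B''"
  shows "((compose (topspace (Tot B)) \<psi> \<phi>, compose (topspace (Base B)) g f),
      (compose (topspace (Tot B)) \<psi> \<phi>', compose (topspace (Base B)) g f'))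
    \<in> bundle_homotopic A B B''"
proof -
  from f obtain H h where H: "(\<phi>, f) \<in> bundle_hom A B B'" "(\<phi>', f') \<in> bundle_hom A B B'"
    "bundle_homotopy A B B' \<phi> f \<phi>' f' H h"
    by (rule bundle_homotopicE)
  note HD = bundle_homotopyD[OF H(3)]
  \<comment> \<open>The morphism (\<psi>, g) is equivariant and covers \<open>g\<close> only at
    points of its total space, so the values of \<open>H\<close> must be placed there before \<psi>
    is applied to them.\<close>
  have "H (e, t) \<in> topspace (Tot B')" if "e \<in> topspace (Tot B)" "0 \<le> t" "t \<le> 1" for e t
    using continuous_map_image_subset_topspace[OF HD(1)] that
    by (auto simp: image_subset_iff)
  then show ?thesis
    by (intro bundle_homotopicI[OF bundle_comp_in_bundle_hom[OF B H(1) g]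
          bundle_comp_in_bundle_hom[OF B H(2) g]
          continuous_map_compose[OF HD(1) bundle_homD(1)[OF g]]
          continuous_map_compose[OF HD(2) bundle_homD(3)[OF g]]])
      (simp_all add: compose_def HD bundle_homD(5-)[OF g])
qed

lemma bundle_homotopic_congruence: "category_congruence (top_cat A TA) (bundle_homotopic A)"
  by (rule category_congruenceI)
    (auto simp: top_cat_def equiv_bundle_homotopic
      intro: bundle_homotopic_comp_left bundle_homotopic_comp_right)

section \<open>The topology of the realization\<close>

declare topspace_simplex_space [simp del]

text \<open>The preimage of a closed set is the finite union of the \<open>k i\<close>-images of
  closed sets of \<open>W i\<close>. Unlike the universal property of a quotient map, the criterion
  passes to products with any space in which the maps \<open>k i\<close> \<times> id are still
  closed.\<close>

lemma continuous_map_closed_cover: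
  assumes fin: "finite I"
    and cl: "\<And>i. i \<in> I \<Longrightarrow> closed_map (W i) X (k i)"
    and cov: "topspace X \<subseteq> (\<Union>i\<in>I. k i ` topspace (W i))"
    and f: "\<And>i. i \<in> I \<Longrightarrow> continuous_map (W i) Y (\<lambda>w. f (k i w))"
  shows "continuous_map X Y f"
  unfolding continuous_map_closedin
proof (intro conjI funcsetI allI impI)
  show "f x \<in> topspace Y" if "x \<in> topspace X" for x
    using that cov f by (fastforce simp: continuous_map_def)
  fix C assume C: "closedin Y C"
  have sub: "k i ` topspace (W i) \<subseteq> topspace X" if "i \<in> I" for i
    using cl[OF that] closedin_subset unfolding closed_map_def by blast
  have "{x \<in> topspace X. f x \<in> C} = (\<Union>i\<in>I. k i ` {w \<in> topspace (W i). f (k i w) \<in> C})"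
    using cov sub by fastforce
  moreover have "closedin X (k i ` {w \<in> topspace (W i). f (k i w) \<in> C})" if "i \<in> I" for i
    using cl[OF that] closedin_continuous_map_preimage[OF f[OF that] C] by (simp add: closed_map_def)
  ultimately show "closedin X {x \<in> topspace X. f x \<in> C}"
    using fin by (auto intro: closedin_Union)
qed

text \<open>The counterpart for images: a closed set is covered by the images of its closed
  preimages in the pieces. It gives the trivializations a continuous inverse without writing one
  down.\<close>

lemma closed_map_closed_cover:
  assumes fin: "finite I"
    and k: "\<And>i. i \<in> I \<Longrightarrow> continuous_map (W i) X (k i)"
    and cov: "topspace X \<subseteq> (\<Union>i\<in>I. k i ` topspace (W i))"
    and f: "\<And>i. i \<in> I \<Longrightarrow> closed_map (W i) Y (\<lambda>w. f (k i w))"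
  shows "closed_map X Y f"
  unfolding closed_map_def
proof (intro allI impI)
  fix C assume C: "closedin X C"
  then have "f ` C = (\<Union>i\<in>I. (\<lambda>w. f (k i w)) ` {w \<in> topspace (W i). k i w \<in> C})"
    using cov closedin_subset[OF C] by fastforce
  moreover have "closedin Y ((\<lambda>w. f (k i w)) ` {w \<in> topspace (W i). k i w \<in> C})" if "i \<in> I" for i
    using f[OF that] closedin_continuous_map_preimage[OF k[OF that] C] by (simp add: closed_map_def)
  ultimately show "closedin Y (f ` C)"
    using fin by (auto intro: closedin_Union)
qed

text \<open>Closedness alone is not stable under products: the map from the real line to a point is
  closed, a projection of the plane to a line is not. Injectivity makes the closed map proper, and
  properness is stable.\<close>

lemma closed_map_prod_id:
  assumes "closed_map X Y f" "inj_on f (topspace X)"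
  shows "closed_map (prod_topology X Z) (prod_topology Y Z) (\<lambda>(x, z). (f x, z))"
proof -
  have "proper_map (prod_topology X Z) (prod_topology Y Z) (\<lambda>(x, z). (f x, id z))"
    unfolding proper_map_prod using closed_injective_imp_proper_map[OF assms] proper_map_id by blast
  then show ?thesis
    by (simp add: proper_imp_closed_map)
qed

text \<open>Functions vanishing outside both sets have the same sum over either set as over the
  intersection. Disjoint simplices are included: over the empty set the sum is 0, not 1, so there
  are no points.\<close>

lemma simplex_space_Int:
  assumes "finite \<sigma>" "finite \<tau>"
  shows "topspace (simplex_space \<sigma>) \<inter> topspace (simplex_space \<tau>) = topspace (simplex_space (\<sigma> \<inter> \<tau>))"
proof -
  have "sum \<alpha> \<rho> = sum \<alpha> (\<sigma> \<inter> \<tau>)" if "\<rho> \<in> {\<sigma>, \<tau>}" "\<forall>s. s \<notin> \<sigma> \<inter> \<tau> \<longrightarrow> \<alpha> s = 0"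
    for \<alpha> :: "'a \<Rightarrow> real" and \<rho>
    using that assms by (intro sum.mono_neutral_right) auto
  from this[of \<sigma>] this[of \<tau>] show ?thesis
    unfolding topspace_simplex_space by (intro equalityI subsetI) (simp_all, metis)
qed

lemma topspace_simplex_space_mono:
  "\<lbrakk>\<sigma> \<subseteq> \<tau>; finite \<tau>\<rbrakk> \<Longrightarrow> topspace (simplex_space \<sigma>) \<subseteq> topspace (simplex_space \<tau>)"
  using simplex_space_Int[of \<sigma> \<tau>] finite_subset[of \<sigma> \<tau>] by (simp add: Int_absorb2 flip: simplex_space_Int) blast

lemma topspace_simplex_space_supp:
  assumes "\<alpha> \<in> topspace (simplex_space \<sigma>)" "finite \<sigma>"
  shows "\<alpha> \<in> topspace (simplex_space (supp \<alpha>))"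
proof -
  have "supp \<alpha> \<subseteq> \<sigma>"
    using assms by (auto simp: supp_def topspace_simplex_space)
  then have "sum \<alpha> (supp \<alpha>) = sum \<alpha> \<sigma>"
    using assms(2) by (intro sum.mono_neutral_left) (auto simp: supp_def)
  then show ?thesis
    using assms(1) by (auto simp: supp_def topspace_simplex_space)
qed

lemma simplex_space_eq: "simplex_space \<sigma> = subtopology (powertop_real UNIV) (topspace (simplex_space \<sigma>))"
  unfolding topspace_simplex_space by (rule simplex_space_def)

text \<open>All simplices are closed subspaces of the same space of functions, so the topology of a
  face is the one induced from the larger simplex.\<close>

lemma simplex_space_face:
  assumes "\<sigma> \<subseteq> \<tau>" "finite \<tau>"
  shows "simplex_space \<sigma> = subtopology (simplex_space \<tau>) (topspace (simplex_space \<sigma>))"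
    and "closedin (simplex_space \<tau>) (topspace (simplex_space \<sigma>))"
proof -
  note sub = topspace_simplex_space_mono[OF assms]
  show "simplex_space \<sigma> = subtopology (simplex_space \<tau>) (topspace (simplex_space \<sigma>))"
    using simplex_space_eq[of \<sigma>] simplex_space_eq[of \<tau>] sub
    by (metis subtopology_subtopology inf.absorb2)
  show "closedin (simplex_space \<tau>) (topspace (simplex_space \<sigma>))"
    using closedin_subset_topspace[OF closedin_simplex sub] finite_subset[OF assms]
    by (simp flip: simplex_space_eq)
qed

lemma continuous_map_simplex_face:
  assumes "\<sigma> \<subseteq> \<tau>" "finite \<tau>"
  shows "continuous_map (simplex_space \<sigma>) (simplex_space \<tau>) (\<lambda>\<alpha>. \<alpha>)"
  by (subst simplex_space_face(1)[OF assms])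
    (rule continuous_map_from_subtopology[OF continuous_map_id, unfolded id_def])

context
  fixes S :: "'s set" and K
  assumes K: "abstract_simplicial_complex S K" and fin: "finite S"
begin

lemma topspace_complex_space_UN: "topspace (complex_space K) = (\<Union>\<sigma>\<in>K. topspace (simplex_space \<sigma>))"
  by (force simp: complex_space_def)

lemma finite_complex: "finite K" and finite_simplex: "\<sigma> \<in> K \<Longrightarrow> finite \<sigma>"
proof -
  have "K \<subseteq> Pow S"
    using K by (auto simp: abstract_simplicial_complex_def)
  then show "finite K"
    using fin finite_subset by blast
qed (use K in \<open>auto simp: abstract_simplicial_complex_def\<close>)

lemma continuous_map_simplex_inclusion:
  assumes "\<sigma> \<in> K" shows "continuous_map (simplex_space \<sigma>) (complex_space K) (\<lambda>\<alpha>. \<alpha>)"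
proof -
  have "topspace (simplex_space \<sigma>) \<subseteq> topspace (complex_space K)"
    using assms by (auto simp: topspace_complex_space_UN)
  then show ?thesis
    using continuous_map_from_subtopology_mono[OF continuous_map_id, unfolded id_def]
    by (subst complex_space_eq_subspace[OF K fin], subst simplex_space_eq)
      (auto simp: continuous_map_in_subtopology continuous_map_from_subtopology)
qed

text \<open>A closed subset of a simplex is closed in the whole space of functions, and the complex
  carries the subspace topology from there by \<open>complex_space_eq_subspace\<close>.\<close>

lemma closed_map_simplex_inclusion:
  assumes "\<sigma> \<in> K" shows "closed_map (simplex_space \<sigma>) (complex_space K) (\<lambda>\<alpha>. \<alpha>)"
  unfolding closed_map_def
proof (intro allI impI)
  fix U assume U: "closedin (simplex_space \<sigma>) U"
  then have "closedin (powertop_real UNIV) U"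
    using closedin_simplex[OF finite_simplex[OF assms]] simplex_space_eq closedin_trans_full by metis
  moreover have "U \<subseteq> topspace (complex_space K)"
    using assms closedin_subset[OF U] by (auto simp: topspace_complex_space_UN)
  ultimately show "closedin (complex_space K) ((\<lambda>\<alpha>. \<alpha>) ` U)"
    using closedin_subset_topspace by (subst complex_space_eq_subspace[OF K fin]) simp
qed

lemma continuous_map_from_complex_prod:
  assumes "\<And>\<sigma>. \<sigma> \<in> K \<Longrightarrow> continuous_map (prod_topology (simplex_space \<sigma>) Z) Y g"
  shows "continuous_map (prod_topology (complex_space K) Z) Y g"
proof (rule continuous_map_closed_cover[OF finite_complex])
  fix \<sigma> assume \<sigma>: "\<sigma> \<in> K"
  show "closed_map (prod_topology (simplex_space \<sigma>) Z) (prod_topology (complex_space K) Z) (\<lambda>(x, z). (x, z))"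
    by (rule closed_map_prod_id[OF closed_map_simplex_inclusion[OF \<sigma>]]) auto
  show "continuous_map (prod_topology (simplex_space \<sigma>) Z) Y (\<lambda>w. g (case w of (x, z) \<Rightarrow> (x, z)))"
    using assms[OF \<sigma>] by simp
qed (auto simp: topspace_complex_space_UN)

end

section \<open>Cells of the total space\<close>

context topological_group
begin

lemma continuous_map_right_mult:
  assumes "g \<in> carrier A" shows "continuous_map TA TA (\<lambda>a. a \<otimes> g)"
proof -
  have "continuous_map TA (prod_topology TA TA) (\<lambda>a. (a, g))"
    using assms by (intro continuous_map_pairedI) (auto simp: topspace_TA)
  from continuous_map_compose[OF this continuous_mult] show ?thesis
    by (simp add: o_def)
qed

lemma continuous_map_left_mult:
  assumes "g \<in> carrier A" shows "continuous_map TA TA (\<lambda>a. g \<otimes> a)"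
proof -
  have "continuous_map TA (prod_topology TA TA) (\<lambda>a. (g, a))"
    using assms by (intro continuous_map_pairedI) (auto simp: topspace_TA)
  from continuous_map_compose[OF this continuous_mult] show ?thesis
    by (simp add: o_def)
qed

lemma glue_class_eq_iff:
  assumes "p \<in> topspace (glue_space TA X)" "q \<in> topspace (glue_space TA X)"
  shows "glue_rel A TA X `` {p} = glue_rel A TA X `` {q} \<longleftrightarrow> (p, q) \<in> glue_rel A TA X"
  using eq_equiv_class_iff[OF equiv_glue_rel] assms by blast

lemma topspace_glue_iff:
  "(\<sigma>, \<alpha>, a) \<in> topspace (glue_space TA X) \<longleftrightarrow>
    \<sigma> \<in> Simp X \<and> \<alpha> \<in> topspace (simplex_space \<sigma>) \<and> a \<in> carrier A"
  by (auto simp: topspace_glue_space)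

lemma total_spaceE:
  assumes "e \<in> topspace (total_space A TA X)"
  obtains \<sigma> \<alpha> a where "e = glue_rel A TA X `` {(\<sigma>, \<alpha>, a)}" "(\<sigma>, \<alpha>, a) \<in> topspace (glue_space TA X)"
  using assms by (auto simp: total_space_def)

text \<open>The characteristic map of the cell |\<sigma>| \<times> A: the gluing map restricted to
  one summand.\<close>

definition cell ::
  "('s, 'a) mono_complex \<Rightarrow> 's set \<Rightarrow> ('s \<Rightarrow> real) \<times> 'a \<Rightarrow> ('s set \<times> ('s \<Rightarrow> real) \<times> 'a) set" where
  "cell X \<sigma> p = glue_rel A TA X `` {(\<sigma>, p)}"

context
  fixes X :: "('s, 'a) mono_complex"
  assumes X: "monomial_complex A X" and finX: "finite (Vert X)"
begin

lemma simplices_complex: "abstract_simplicial_complex (Vert X) (Simp X)"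
  using X by (simp add: monomial_complex_def)

lemma simplex_face: "\<lbrakk>\<sigma> \<in> Simp X; \<tau> \<subseteq> \<sigma>; \<tau> \<noteq> {}\<rbrakk> \<Longrightarrow> \<tau> \<in> Simp X"
  using simplices_complex unfolding abstract_simplicial_complex_def by meson

text \<open>Labels factor through \<rho> as l(supp \<alpha>, \<sigma>) = l(\<rho>, \<sigma>) l(supp
  \<alpha>, \<rho>), and the common right factor cancels. Hence the gluing can be read off at a
  simplex that does not vary with the support.\<close>

lemma glue_rel_above_supp:
  assumes p: "(\<sigma>, \<alpha>, a) \<in> topspace (glue_space TA X)" "(\<tau>, \<alpha>, b) \<in> topspace (glue_space TA X)"
    and \<rho>: "\<rho> \<in> Simp X" "supp \<alpha> \<subseteq> \<rho>" "\<rho> \<subseteq> \<sigma>" "\<rho> \<subseteq> \<tau>"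
  shows "((\<sigma>, \<alpha>, a), (\<tau>, \<alpha>, b)) \<in> glue_rel A TA X \<longleftrightarrow> a \<otimes> Lab X (\<rho>, \<sigma>) = b \<otimes> Lab X (\<rho>, \<tau>)"
proof -
  note p' = p[unfolded topspace_glue_iff]
  have s: "supp \<alpha> \<in> Simp X"
    using supp_in_simplices[OF simplices_complex] p' by blast
  have c: "Lab X (supp \<alpha>, \<rho>) \<in> carrier A" "Lab X (\<rho>, \<sigma>) \<in> carrier A" "Lab X (\<rho>, \<tau>) \<in> carrier A"
    using p' \<rho> s by (auto intro: monomial_complex_Lab(1)[OF X])
  have "Lab X (supp \<alpha>, \<sigma>) = Lab X (\<rho>, \<sigma>) \<otimes> Lab X (supp \<alpha>, \<rho>)"
    "Lab X (supp \<alpha>, \<tau>) = Lab X (\<rho>, \<tau>) \<otimes> Lab X (supp \<alpha>, \<rho>)"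
    using p' \<rho> s by (auto intro: monomial_complex_Lab(2)[OF X, symmetric])
  then show ?thesis
    using p' c by (simp add: glue_rel_iff m_assoc[symmetric])
qed

text \<open>The same cancellation with the factorization l(\<rho>, \<sigma>) = l(supp \<alpha>,
  \<sigma>) l(\<rho>, supp \<alpha>). With \<rho> = {s} it makes the fibre coordinate over the open
  star of s well defined and injective on fibres.\<close>

lemma glue_rel_below_supp:
  assumes p: "(\<sigma>, \<alpha>, a) \<in> topspace (glue_space TA X)" "(\<tau>, \<alpha>, b) \<in> topspace (glue_space TA X)"
    and \<rho>: "\<rho> \<in> Simp X" "\<rho> \<subseteq> supp \<alpha>"
  shows "((\<sigma>, \<alpha>, a), (\<tau>, \<alpha>, b)) \<in> glue_rel A TA X \<longleftrightarrow> a \<otimes> Lab X (\<rho>, \<sigma>) = b \<otimes> Lab X (\<rho>, \<tau>)"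
proof -
  note p' = p[unfolded topspace_glue_iff]
  have s: "supp \<alpha> \<in> Simp X" "supp \<alpha> \<subseteq> \<sigma>" "supp \<alpha> \<subseteq> \<tau>"
    using supp_in_simplices[OF simplices_complex] p' by blast+
  have c: "Lab X (\<rho>, supp \<alpha>) \<in> carrier A" "Lab X (supp \<alpha>, \<sigma>) \<in> carrier A" "Lab X (supp \<alpha>, \<tau>) \<in> carrier A"
    using p' \<rho> s by (auto intro: monomial_complex_Lab(1)[OF X])
  have "Lab X (\<rho>, \<sigma>) = Lab X (supp \<alpha>, \<sigma>) \<otimes> Lab X (\<rho>, supp \<alpha>)"
    "Lab X (\<rho>, \<tau>) = Lab X (supp \<alpha>, \<tau>) \<otimes> Lab X (\<rho>, supp \<alpha>)"
    using p' \<rho> s by (auto intro: monomial_complex_Lab(2)[OF X, symmetric])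
  then show ?thesis
    using p' c by (simp add: glue_rel_iff m_assoc[symmetric])
qed

lemma topspace_total_space_cells:
  "topspace (total_space A TA X) =
    (\<Union>\<sigma>\<in>Simp X. cell X \<sigma> ` topspace (prod_topology (simplex_space \<sigma>) TA))"
  by (auto simp: total_space_def topspace_glue_space cell_def topspace_TA)

lemma continuous_map_cell:
  assumes "\<sigma> \<in> Simp X"
  shows "continuous_map (prod_topology (simplex_space \<sigma>) TA) (total_space A TA X) (cell X \<sigma>)"
proof -
  have "continuous_map (glue_space TA X) (total_space A TA X) (\<lambda>p. glue_rel A TA X `` {p})"
    unfolding total_space_def by (rule quotient_imp_continuous_map[OF quotient_map_quotient_topology])
  with continuous_map_component_injection[OF assms]
  have "continuous_map (prod_topology (simplex_space \<sigma>) TA) (total_space A TA X)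
      ((\<lambda>p. glue_rel A TA X `` {p}) \<circ> (\<lambda>p. (\<sigma>, p)))"
    unfolding glue_space_def by (rule continuous_map_compose)
  then show ?thesis
    by (simp add: cell_def[abs_def] o_def)
qed

text \<open>Within one cell the gluing can be compared at \<rho> = \<sigma>, where the label is the
  unit.\<close>

lemma inj_on_cell:
  assumes "\<sigma> \<in> Simp X"
  shows "inj_on (cell X \<sigma>) (topspace (prod_topology (simplex_space \<sigma>) TA))"
proof (rule inj_onI, clarsimp)
  fix \<alpha> a \<beta> b
  assume p: "\<alpha> \<in> topspace (simplex_space \<sigma>)" "a \<in> topspace TA" "\<beta> \<in> topspace (simplex_space \<sigma>)"
    "b \<in> topspace TA" and "cell X \<sigma> (\<alpha>, a) = cell X \<sigma> (\<beta>, b)"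
  then have r: "((\<sigma>, \<alpha>, a), (\<sigma>, \<beta>, b)) \<in> glue_rel A TA X"
    using assms by (simp add: cell_def glue_class_eq_iff topspace_glue_iff topspace_TA)
  then have "\<alpha> = \<beta>"
    by (simp add: glue_rel_iff)
  moreover have "a = b"
    using r p assms glue_rel_above_supp[of \<sigma> \<alpha> a \<sigma> b \<sigma>] supp_in_simplices(2)[OF simplices_complex]
      monomial_complex_Lab(3)[OF X assms] \<open>\<alpha> = \<beta>\<close>
    by (simp add: topspace_glue_iff topspace_TA)
  ultimately show "\<alpha> = \<beta> \<and> a = b" ..
qed

text \<open>
  Over \<open>\<sigma> \<inter> \<tau>\<close> the gluing of the cells of \<open>\<sigma>\<close> and \<open>\<tau>\<close> is right multiplication by an element
  that does not depend on the point, although the relation involves its support.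
\<close>

lemma closed_map_cell:
  assumes \<sigma>: "\<sigma> \<in> Simp X"
  shows "closed_map (prod_topology (simplex_space \<sigma>) TA) (total_space A TA X) (cell X \<sigma>)"
  unfolding closed_map_def
proof (intro allI impI)
  fix C assume C: "closedin (prod_topology (simplex_space \<sigma>) TA) C"
  then have subC: "C \<subseteq> topspace (simplex_space \<sigma>) \<times> carrier A"
    using closedin_subset by (force simp: topspace_TA)
  let ?q = "\<lambda>p. glue_rel A TA X `` {p}"
  \<comment> \<open>By the quotient topology, the image of \<open>C\<close> is closed once its
    preimage in the disjoint union is closed in every summand. \<open>?D\<close> is the part of this
    preimage lying in the summand \<tau>.\<close>
  have "closedin (prod_topology (simplex_space \<tau>) TA)
      {p. (\<tau>, p) \<in> {p \<in> topspace (glue_space TA X). ?q p \<in> cell X \<sigma> ` C}}" (is "closedin _ ?D")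
    if \<tau>: "\<tau> \<in> Simp X" for \<tau>
  proof -
    have D: "(\<alpha>, b) \<in> ?D \<longleftrightarrow> \<alpha> \<in> topspace (simplex_space \<tau>) \<and> b \<in> carrier A \<and>
        (\<exists>a. (\<alpha>, a) \<in> C \<and> ((\<sigma>, \<alpha>, a), (\<tau>, \<alpha>, b)) \<in> glue_rel A TA X)" for \<alpha> b
    proof -
      have q: "?q (\<tau>, \<alpha>, b) = cell X \<sigma> (\<beta>, a) \<longleftrightarrow> ((\<sigma>, \<beta>, a), (\<tau>, \<alpha>, b)) \<in> glue_rel A TA X"
        if "\<alpha> \<in> topspace (simplex_space \<tau>)" "b \<in> carrier A" "(\<beta>, a) \<in> C" for \<beta> a
        using that subC \<sigma> \<tau> unfolding cell_def eq_commute[of "?q (\<tau>, \<alpha>, b)"]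
        by (intro glue_class_eq_iff) (auto simp: topspace_glue_iff)
      show ?thesis
      proof (rule iffI, goal_cases)
        case 1
        then obtain \<beta> a where m: "\<alpha> \<in> topspace (simplex_space \<tau>)" "b \<in> carrier A" "(\<beta>, a) \<in> C"
          and e: "?q (\<tau>, \<alpha>, b) = cell X \<sigma> (\<beta>, a)"
          by (auto simp: topspace_glue_iff)
        have r: "((\<sigma>, \<beta>, a), (\<tau>, \<alpha>, b)) \<in> glue_rel A TA X"
          using q[OF m] e by (rule iffD1)
        then have "\<beta> = \<alpha>"
          by (simp add: glue_rel_iff)
        with m r show ?case by blast
      next
        case 2
        then obtain a where m: "\<alpha> \<in> topspace (simplex_space \<tau>)" "b \<in> carrier A" "(\<alpha>, a) \<in> C"
          and r: "((\<sigma>, \<alpha>, a), (\<tau>, \<alpha>, b)) \<in> glue_rel A TA X" by blast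
        have "?q (\<tau>, \<alpha>, b) = cell X \<sigma> (\<alpha>, a)"
          using q[OF m] r by (rule iffD2)
        with m \<tau> show ?case by (simp add: topspace_glue_iff)
      qed
    qed
    have fin: "finite \<sigma>" "finite \<tau>"
      using \<sigma> \<tau> monomial_complex_simplex(2)[OF X] by auto
    show ?thesis
    \<comment> \<open>The empty set is not a simplex and has no labels, so disjoint cells are
      treated apart; they have no points to identify.\<close>
    proof (cases "\<sigma> \<inter> \<tau> = {}")
      case True
      then have "topspace (simplex_space \<sigma>) \<inter> topspace (simplex_space \<tau>) = {}"
        unfolding simplex_space_Int[OF fin] by (simp add: topspace_simplex_space)
      then have "p \<notin> ?D" for p
        using D[of "fst p" "snd p"] subC unfolding prod.collapse by blast
      then have "?D = {}"
        by blast
      then show ?thesis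
        by (simp only: closedin_empty)
    next
      case False
      define \<rho> where "\<rho> = \<sigma> \<inter> \<tau>"
      have \<rho>: "\<rho> \<in> Simp X" "\<rho> \<subseteq> \<sigma>" "\<rho> \<subseteq> \<tau>"
        using simplex_face[OF \<sigma> _ False] by (simp_all add: \<rho>_def)
      \<comment> \<open>The transition element between the two cells, found by solving a l(\<rho>,
        \<sigma>) = b l(\<rho>, \<tau>) for a.\<close>
      define g where "g = Lab X (\<rho>, \<tau>) \<otimes> inv (Lab X (\<rho>, \<sigma>))"
      have c: "Lab X (\<rho>, \<tau>) \<in> carrier A" "Lab X (\<rho>, \<sigma>) \<in> carrier A"
        using \<rho> \<sigma> \<tau> by (auto intro: monomial_complex_Lab(1)[OF X])
      then have g: "g \<in> carrier A"
        by (simp add: g_def)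
      have Int: "\<alpha> \<in> topspace (simplex_space \<rho>) \<longleftrightarrow>
          \<alpha> \<in> topspace (simplex_space \<sigma>) \<and> \<alpha> \<in> topspace (simplex_space \<tau>)" for \<alpha>
        using simplex_space_Int[OF fin] unfolding \<rho>_def by blast
      have rel: "((\<sigma>, \<alpha>, a), (\<tau>, \<alpha>, b)) \<in> glue_rel A TA X \<longleftrightarrow> a = b \<otimes> g"
        if "\<alpha> \<in> topspace (simplex_space \<rho>)" "a \<in> carrier A" "b \<in> carrier A" for \<alpha> a b
      proof -
        have "((\<sigma>, \<alpha>, a), (\<tau>, \<alpha>, b)) \<in> glue_rel A TA X \<longleftrightarrow> a \<otimes> Lab X (\<rho>, \<sigma>) = b \<otimes> Lab X (\<rho>, \<tau>)"
          using that Int \<sigma> \<tau> supp_in_simplices(2)[OF simplices_complex \<rho>(1)]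
          by (intro glue_rel_above_supp \<rho>) (auto simp: topspace_glue_iff)
        also have "\<dots> \<longleftrightarrow> a = b \<otimes> g"
        proof -
          have "b \<otimes> g = b \<otimes> Lab X (\<rho>, \<tau>) \<otimes> inv (Lab X (\<rho>, \<sigma>))"
            using that c by (simp add: g_def m_assoc)
          moreover have "a = b \<otimes> Lab X (\<rho>, \<tau>) \<otimes> inv (Lab X (\<rho>, \<sigma>)) \<longleftrightarrow>
              b \<otimes> Lab X (\<rho>, \<tau>) = a \<otimes> Lab X (\<rho>, \<sigma>)"
            using that c by (intro inv_solve_right) auto
          ultimately show ?thesis
            by (simp only: eq_commute[of "a \<otimes> Lab X (\<rho>, \<sigma>)"])
        qed
        finally show ?thesis .
      qed
      have "(\<alpha>, b) \<in> ?D \<longleftrightarrow> \<alpha> \<in> topspace (simplex_space \<rho>) \<and> b \<in> carrier A \<and> (\<alpha>, b \<otimes> g) \<in> C" for \<alpha> b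
      proof -
        have Ca: "\<alpha> \<in> topspace (simplex_space \<sigma>)" "a \<in> carrier A" if "(\<alpha>, a) \<in> C" for a
          using that subC by auto
        have "\<alpha> \<in> topspace (simplex_space \<tau>) \<and> b \<in> carrier A \<and>
            (\<exists>a. (\<alpha>, a) \<in> C \<and> ((\<sigma>, \<alpha>, a), (\<tau>, \<alpha>, b)) \<in> glue_rel A TA X) \<longleftrightarrow>
          \<alpha> \<in> topspace (simplex_space \<rho>) \<and> b \<in> carrier A \<and> (\<alpha>, b \<otimes> g) \<in> C"
          unfolding Int using Ca rel[of \<alpha> _ b, unfolded Int] by (metis (no_types, lifting))
        with D[of \<alpha> b] show ?thesis by (rule trans)
      qed
      then have "p \<in> ?D \<longleftrightarrow> p \<in> topspace (prod_topology (simplex_space \<rho>) TA) \<and> (fst p, snd p \<otimes> g) \<in> C" for p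
        unfolding topspace_prod_topology topspace_TA mem_Times_iff
        by (cases p) (simp only: fst_conv snd_conv conj_assoc)
      then have "{p. p \<in> ?D} =
          {p \<in> topspace (prod_topology (simplex_space \<rho>) TA). (fst p, snd p \<otimes> g) \<in> C}"
        by (rule Collect_cong)
      then have "?D = {p \<in> topspace (prod_topology (simplex_space \<rho>) TA). (fst p, snd p \<otimes> g) \<in> C}"
        unfolding Collect_mem_eq .
      moreover have "continuous_map (prod_topology (simplex_space \<rho>) TA) (prod_topology (simplex_space \<sigma>) TA)
          (\<lambda>p. (fst p, snd p \<otimes> g))"
      proof (intro continuous_map_pairedI)
        show "continuous_map (prod_topology (simplex_space \<rho>) TA) (simplex_space \<sigma>) fst"
          using continuous_map_compose[OF continuous_map_fst continuous_map_simplex_face[OF \<rho>(2) fin(1)]]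
          by (simp add: o_def)
        show "continuous_map (prod_topology (simplex_space \<rho>) TA) TA (\<lambda>p. snd p \<otimes> g)"
          using continuous_map_compose[OF continuous_map_snd continuous_map_right_mult[OF g]]
          by (simp add: o_def)
      qed
      ultimately have "closedin (prod_topology (simplex_space \<rho>) TA) ?D"
        using closedin_continuous_map_preimage[OF _ C] by (simp only:)
      \<comment> \<open>So far \<open>?D\<close> is closed in the cell over the common face. That
        cell is a closed subspace of the cell of \<tau>, so closedness passes to the latter.\<close>
      then have "closedin (subtopology (prod_topology (simplex_space \<tau>) TA)
          (topspace (simplex_space \<rho>) \<times> topspace TA)) ?D"
        using simplex_space_face(1)[OF \<rho>(3) fin(2)] prod_topology_subtopology(1) by metis
      moreover have "closedin (prod_topology (simplex_space \<tau>) TA) (topspace (simplex_space \<rho>) \<times> topspace TA)"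
        by (simp add: closedin_prod_Times_iff simplex_space_face(2)[OF \<rho>(3) fin(2)])
      ultimately show ?thesis
        by (rule closedin_trans_full)
    qed
  qed
  then have "closedin (glue_space TA X) {p \<in> topspace (glue_space TA X). ?q p \<in> cell X \<sigma> ` C}"
    unfolding glue_space_def closedin_sum_topology by (auto simp: o_def)
  moreover have "cell X \<sigma> ` C \<subseteq> topspace (total_space A TA X)"
    using subC \<sigma> by (auto simp: topspace_total_space_cells topspace_TA)
  moreover have "quotient_map (glue_space TA X) (total_space A TA X) ?q"
    unfolding total_space_def by (rule quotient_map_quotient_topology)
  ultimately show "closedin (total_space A TA X) (cell X \<sigma> ` C)"
    by (simp add: quotient_map_closedin)
qed

lemma continuous_map_from_total_prod:
  assumes "\<And>\<sigma>. \<sigma> \<in> Simp X \<Longrightarrow> continuous_map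
    (prod_topology (prod_topology (simplex_space \<sigma>) TA) Z) Y (\<lambda>(p, z). f (cell X \<sigma> p, z))"
  shows "continuous_map (prod_topology (total_space A TA X) Z) Y f"
proof (rule continuous_map_closed_cover[OF finite_complex[OF simplices_complex finX]])
  fix \<sigma> assume \<sigma>: "\<sigma> \<in> Simp X"
  show "closed_map (prod_topology (prod_topology (simplex_space \<sigma>) TA) Z)
      (prod_topology (total_space A TA X) Z) (\<lambda>(x, z). (cell X \<sigma> x, z))"
    by (rule closed_map_prod_id[OF closed_map_cell[OF \<sigma>] inj_on_cell[OF \<sigma>]])
  show "continuous_map (prod_topology (prod_topology (simplex_space \<sigma>) TA) Z) Y
      (\<lambda>w. f (case w of (x, z) \<Rightarrow> (cell X \<sigma> x, z)))"
    using assms[OF \<sigma>] by (simp add: case_prod_unfold)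
qed (auto simp: topspace_total_space_cells image_iff Bex_def; blast)

lemma continuous_map_from_total:
  assumes "\<And>\<sigma>. \<sigma> \<in> Simp X \<Longrightarrow>
    continuous_map (prod_topology (simplex_space \<sigma>) TA) Y (\<lambda>p. f (cell X \<sigma> p))"
  shows "continuous_map (total_space A TA X) Y f"
  by (rule continuous_map_closed_cover[OF finite_complex[OF simplices_complex finX] closed_map_cell _ assms])
    (auto simp: topspace_total_space_cells)

end

text \<open>
  If \<open>T \<sigma> = f ` \<sigma>\<close>, \<open>c = \<kappa>\<close> and \<open>g\<close> does not depend on \<open>z\<close>, then this is the realization of \<open>(f, \<kappa>)\<close>.
  If \<open>T \<sigma> = f ` \<sigma> \<union> f' ` \<sigma>\<close> and \<open>g\<close> is the straight line from \<open>|f|\<close> to \<open>|f'|\<close>, then it is the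
  homotopy between the realizations of two contiguous morphisms.
\<close>

definition carried_map ::
  "('t, 'a) mono_complex \<Rightarrow> ('s set \<Rightarrow> 't set) \<Rightarrow> ('s set \<Rightarrow> 'a) \<Rightarrow> (('s \<Rightarrow> real) \<times> 'z \<Rightarrow> 't \<Rightarrow> real)
    \<Rightarrow> ('s set \<times> ('s \<Rightarrow> real) \<times> 'a) set \<times> 'z \<Rightarrow> ('t set \<times> ('t \<Rightarrow> real) \<times> 'a) set" where
  "carried_map Y T c g = (\<lambda>(e, z).
     \<Union>(\<sigma>, \<alpha>, a)\<in>e. glue_rel A TA Y `` {(T \<sigma>, g (\<alpha>, z), a \<otimes> inv (c \<sigma>))})"

context
  fixes X :: "('s, 'a) mono_complex" and Y :: "('t, 'a) mono_complex"
    and T :: "'s set \<Rightarrow> 't set" and c :: "'s set \<Rightarrow> 'a"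
    and g :: "('s \<Rightarrow> real) \<times> 'z \<Rightarrow> 't \<Rightarrow> real" and Z :: "'z topology"
  assumes X: "monomial_complex A X" and finX: "finite (Vert X)"
    and Y: "monomial_complex A Y" and finY: "finite (Vert Y)"
    and T: "\<And>\<sigma>. \<sigma> \<in> Simp X \<Longrightarrow> T \<sigma> \<in> Simp Y"
    and T_mono: "\<And>\<rho> \<sigma>. \<lbrakk>\<rho> \<in> Simp X; \<sigma> \<in> Simp X; \<rho> \<subseteq> \<sigma>\<rbrakk> \<Longrightarrow> T \<rho> \<subseteq> T \<sigma>"
    and c: "\<And>\<sigma>. \<sigma> \<in> Simp X \<Longrightarrow> c \<sigma> \<in> carrier A"
    and natural: "\<And>\<rho> \<sigma>. \<lbrakk>\<rho> \<in> Simp X; \<sigma> \<in> Simp X; \<rho> \<subseteq> \<sigma>\<rbrakk> \<Longrightarrow>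
      Lab Y (T \<rho>, T \<sigma>) \<otimes> c \<rho> = c \<sigma> \<otimes> Lab X (\<rho>, \<sigma>)"
    and g: "\<And>\<sigma>. \<sigma> \<in> Simp X \<Longrightarrow>
      continuous_map (prod_topology (simplex_space \<sigma>) Z) (simplex_space (T \<sigma>)) g"
begin

lemma carrier_simplex:
  "\<lbrakk>\<sigma> \<in> Simp X; \<alpha> \<in> topspace (simplex_space \<sigma>); z \<in> topspace Z\<rbrakk> \<Longrightarrow>
    g (\<alpha>, z) \<in> topspace (simplex_space (T \<sigma>))"
  using g by (auto simp: continuous_map_def Pi_iff)

text \<open>Two representatives of a point, in the cells of \<sigma> and \<tau>, have images in the
  cells of T(\<sigma>) and T(\<tau>). These are compared at T(supp \<alpha>), which lies below both
  carriers and contains the support of g(\<alpha>, z) for every z.\<close>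

lemma carried_map_class:
  assumes p: "(\<sigma>, \<alpha>, a) \<in> topspace (glue_space TA X)" and z: "z \<in> topspace Z"
  shows "carried_map Y T c g (glue_rel A TA X `` {(\<sigma>, \<alpha>, a)}, z) =
    glue_rel A TA Y `` {(T \<sigma>, g (\<alpha>, z), a \<otimes> inv (c \<sigma>))}"
proof -
  note K = simplices_complex[OF X finX]
  \<comment> \<open>\<open>natural\<close> solved for the label of \<open>Y\<close> and multiplied
    on the left by a c(\<sigma>)^-1. For \<rho> = supp \<alpha> the right-hand side involves the
    representative only through the product that the gluing keeps fixed.\<close>
  have key: "a \<otimes> inv (c \<sigma>) \<otimes> Lab Y (T \<rho>, T \<sigma>) = a \<otimes> Lab X (\<rho>, \<sigma>) \<otimes> inv (c \<rho>)"
    if "\<rho> \<in> Simp X" "\<sigma> \<in> Simp X" "\<rho> \<subseteq> \<sigma>" "a \<in> carrier A" for \<rho> \<sigma> a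
  proof -
    have C: "Lab Y (T \<rho>, T \<sigma>) \<in> carrier A" "Lab X (\<rho>, \<sigma>) \<in> carrier A"
        "c \<rho> \<in> carrier A" "c \<sigma> \<in> carrier A"
      using that T T_mono c Lab_closed[OF X] Lab_closed[OF Y] by auto
    have "Lab Y (T \<rho>, T \<sigma>) = c \<sigma> \<otimes> Lab X (\<rho>, \<sigma>) \<otimes> inv (c \<rho>)"
      by (rule inv_solve_right[THEN iffD2]) (use natural[OF that(1-3)] C in auto)
    moreover have "inv (c \<sigma>) \<otimes> (c \<sigma> \<otimes> x) = x" if "x \<in> carrier A" for x
      using C that by (simp add: m_assoc[symmetric])
    ultimately show ?thesis
      using C that(4) by (simp add: m_assoc)
  qed
  have "(\<lambda>(\<sigma>, \<alpha>, a). glue_rel A TA Y `` {(T \<sigma>, g (\<alpha>, z), a \<otimes> inv (c \<sigma>))}) respects glue_rel A TA X"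
  proof (rule congruentI)
    fix p q assume "(p, q) \<in> glue_rel A TA X"
    then obtain \<sigma> \<alpha> a \<tau> b where pq: "p = (\<sigma>, \<alpha>, a)" "q = (\<tau>, \<alpha>, b)"
      and m: "\<sigma> \<in> Simp X" "\<alpha> \<in> topspace (simplex_space \<sigma>)" "a \<in> carrier A"
        "\<tau> \<in> Simp X" "\<alpha> \<in> topspace (simplex_space \<tau>)" "b \<in> carrier A"
      and e: "a \<otimes> Lab X (supp \<alpha>, \<sigma>) = b \<otimes> Lab X (supp \<alpha>, \<tau>)"
      by (rule glue_relE)
    note s = supp_in_simplices[OF K m(1,2)] supp_in_simplices[OF K m(4,5)]
    \<comment> \<open>The point \<alpha> already lies in the simplex on its support, so the carrier
      condition can be applied to this smallest face rather than to \<sigma> or \<tau>.\<close>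
    have "g (\<alpha>, z) \<in> topspace (simplex_space (T (supp \<alpha>)))"
      using topspace_simplex_space_supp[OF m(2) finite_simplex[OF K finX m(1)]] s(1) z
      by (intro carrier_simplex)
    then have "supp (g (\<alpha>, z)) \<subseteq> T (supp \<alpha>)"
      using supp_in_simplices(2)[OF simplices_complex[OF Y finY]] T s(1) by blast
    moreover have "(a \<otimes> inv (c \<sigma>)) \<otimes> Lab Y (T (supp \<alpha>), T \<sigma>) =
        (b \<otimes> inv (c \<tau>)) \<otimes> Lab Y (T (supp \<alpha>), T \<tau>)"
      using key[OF s(1) m(1) s(2) m(3)] key[OF s(1) m(4) s(4) m(6)] e by (simp only:)
    ultimately have "((T \<sigma>, g (\<alpha>, z), a \<otimes> inv (c \<sigma>)), (T \<tau>, g (\<alpha>, z), b \<otimes> inv (c \<tau>))) \<in> glue_rel A TA Y"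
      using m c T T_mono s carrier_simplex[OF _ _ z]
      by (subst glue_rel_above_supp[OF Y finY, where \<rho> = "T (supp \<alpha>)"]) (simp_all add: topspace_glue_iff)
    then have "glue_rel A TA Y `` {(T \<sigma>, g (\<alpha>, z), a \<otimes> inv (c \<sigma>))} =
        glue_rel A TA Y `` {(T \<tau>, g (\<alpha>, z), b \<otimes> inv (c \<tau>))}"
      by (rule equiv_class_eq[OF equiv_glue_rel])
    then show "(\<lambda>(\<sigma>, \<alpha>, a). glue_rel A TA Y `` {(T \<sigma>, g (\<alpha>, z), a \<otimes> inv (c \<sigma>))}) p =
        (\<lambda>(\<sigma>, \<alpha>, a). glue_rel A TA Y `` {(T \<sigma>, g (\<alpha>, z), a \<otimes> inv (c \<sigma>))}) q"
      by (simp only: pq prod.case)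
  qed
  from UN_equiv_class[OF equiv_glue_rel this p] show ?thesis
    by (simp add: carried_map_def)
qed

lemma carried_map_glue:
  assumes "(\<sigma>, \<alpha>, a) \<in> topspace (glue_space TA X)" "z \<in> topspace Z"
  shows "(T \<sigma>, g (\<alpha>, z), a \<otimes> inv (c \<sigma>)) \<in> topspace (glue_space TA Y)"
  using assms T c carrier_simplex by (simp add: topspace_glue_iff)

text \<open>On the cell of \<sigma> the map is \<open>g\<close> paired with right multiplication by
  the fixed element c(\<sigma>)^-1, followed by the characteristic map of T(\<sigma>).\<close>

lemma continuous_map_carried_map:
  "continuous_map (prod_topology (total_space A TA X) Z) (total_space A TA Y) (carried_map Y T c g)"
proof (rule continuous_map_from_total_prod[OF X finX])
  fix \<sigma> assume \<sigma>: "\<sigma> \<in> Simp X"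
  let ?P = "prod_topology (prod_topology (simplex_space \<sigma>) TA) Z"
  have fst: "continuous_map ?P (simplex_space \<sigma>) (\<lambda>p. fst (fst p))"
    and snd: "continuous_map ?P TA (\<lambda>p. snd (fst p))"
    using continuous_map_compose[OF continuous_map_fst continuous_map_fst]
      continuous_map_compose[OF continuous_map_fst continuous_map_snd] by (simp_all add: o_def)
  have "continuous_map ?P (simplex_space (T \<sigma>)) (\<lambda>p. g (fst (fst p), snd p))"
    using continuous_map_compose[OF continuous_map_pairedI[OF fst continuous_map_snd] g[OF \<sigma>]]
    by (simp add: o_def)
  moreover have "continuous_map ?P TA (\<lambda>p. snd (fst p) \<otimes> inv (c \<sigma>))"
    using continuous_map_compose[OF snd continuous_map_right_mult[OF inv_closed[OF c[OF \<sigma>]]]]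
    by (simp add: o_def)
  ultimately have "continuous_map ?P (total_space A TA Y)
      (cell Y (T \<sigma>) \<circ> (\<lambda>p. (g (fst (fst p), snd p), snd (fst p) \<otimes> inv (c \<sigma>))))"
    by (intro continuous_map_compose[OF _ continuous_map_cell[OF Y finY T[OF \<sigma>]]] continuous_map_pairedI)
  then show "continuous_map ?P (total_space A TA Y) (\<lambda>(p, z). carried_map Y T c g (cell X \<sigma> p, z))"
  proof (rule continuous_map_eq)
    fix p assume "p \<in> topspace ?P"
    moreover obtain \<alpha> a z where "p = ((\<alpha>, a), z)"
      by (metis surj_pair)
    ultimately show "(cell Y (T \<sigma>) \<circ> (\<lambda>p. (g (fst (fst p), snd p), snd (fst p) \<otimes> inv (c \<sigma>)))) p =
        (case p of (p, z) \<Rightarrow> carried_map Y T c g (cell X \<sigma> p, z))"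
      using carried_map_class[of \<sigma> \<alpha> a z] \<sigma>
      by (simp add: cell_def topspace_glue_iff topspace_TA)
  qed
qed

text \<open>The action multiplies the fibre coordinate on the left and the twist c(\<sigma>)^-1 on
  the right, so associativity makes them commute.\<close>

lemma carried_map_Act:
  assumes b: "b \<in> carrier A" and e: "e \<in> topspace (total_space A TA X)" and z: "z \<in> topspace Z"
  shows "carried_map Y T c g (Act (realization A TA X) b e, z) =
    Act (realization A TA Y) b (carried_map Y T c g (e, z))"
proof -
  obtain \<sigma> \<alpha> a where e: "e = glue_rel A TA X `` {(\<sigma>, \<alpha>, a)}"
    and p: "(\<sigma>, \<alpha>, a) \<in> topspace (glue_space TA X)"
    using e by (rule total_spaceE)
  have "(\<sigma>, \<alpha>, b \<otimes> a) \<in> topspace (glue_space TA X)"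
    using p b by (simp add: topspace_glue_iff)
  then show ?thesis
    using p c b carried_map_class[OF _ z] realization_Act[OF X p b]
      realization_Act[OF Y carried_map_glue[OF p z] b]
    by (simp add: e topspace_glue_iff m_assoc)
qed

lemma carried_map_Proj:
  assumes e: "e \<in> topspace (total_space A TA X)" and z: "z \<in> topspace Z"
  shows "Proj (realization A TA Y) (carried_map Y T c g (e, z)) = g (Proj (realization A TA X) e, z)"
proof -
  obtain \<sigma> \<alpha> a where e: "e = glue_rel A TA X `` {(\<sigma>, \<alpha>, a)}"
    and p: "(\<sigma>, \<alpha>, a) \<in> topspace (glue_space TA X)"
    using e by (rule total_spaceE)
  show ?thesis
    unfolding e carried_map_class[OF p z] realization_Proj[OF p]
    by (rule realization_Proj[OF carried_map_glue[OF p z]])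
qed

lemma continuous_map_carried_base:
  "continuous_map (prod_topology (complex_space (Simp X)) Z) (complex_space (Simp Y)) g"
proof (rule continuous_map_from_complex_prod[OF simplices_complex[OF X finX] finX])
  fix \<sigma> assume \<sigma>: "\<sigma> \<in> Simp X"
  show "continuous_map (prod_topology (simplex_space \<sigma>) Z) (complex_space (Simp Y)) g"
    using continuous_map_compose[OF g[OF \<sigma>]
        continuous_map_simplex_inclusion[OF simplices_complex[OF Y finY] finY T[OF \<sigma>]]]
    by (simp add: o_def)
qed

end

section \<open>The realization is a fibered bundle\<close>

lemma realization_simps [simp]:
  "Tot (realization A TA X) = total_space A TA X"
  "Base (realization A TA X) = complex_space (Simp X)"
  by (simp_all add: realization_def)

text \<open>
  The fibre coordinate over the open star of \<open>s\<close>; over other points the image need not be a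
  singleton, so the value is junk.
\<close>

definition star_coordinate ::
  "('s, 'a) mono_complex \<Rightarrow> 's \<Rightarrow> ('s set \<times> ('s \<Rightarrow> real) \<times> 'a) set \<Rightarrow> 'a" where
  "star_coordinate X s e = the_elem ((\<lambda>(\<sigma>, \<alpha>, a). a \<otimes> Lab X ({s}, \<sigma>)) ` e)"

section \<open>The action, the projection and local triviality\<close>

context
  fixes X :: "('s, 'a) mono_complex"
  assumes X: "monomial_complex A X" and fin: "finite (Vert X)"
begin

lemma glue_left_mult:
  "\<lbrakk>(\<sigma>, \<alpha>, a) \<in> topspace (glue_space TA X); b \<in> carrier A\<rbrakk> \<Longrightarrow>
    (\<sigma>, \<alpha>, b \<otimes> a) \<in> topspace (glue_space TA X)"
  by (simp add: topspace_glue_iff)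

lemma Act_in_total_space:
  assumes "b \<in> carrier A" "e \<in> topspace (total_space A TA X)"
  shows "Act (realization A TA X) b e \<in> topspace (total_space A TA X)"
  using assms(2)
  by (rule total_spaceE)
    (simp add: realization_Act[OF X _ assms(1)] glue_class_in_total_space glue_left_mult assms(1))

lemma Act_mult:
  assumes b: "b \<in> carrier A" and b': "b' \<in> carrier A" and e: "e \<in> topspace (total_space A TA X)"
  shows "Act (realization A TA X) (b \<otimes> b') e = Act (realization A TA X) b (Act (realization A TA X) b' e)"
  using e
proof (rule total_spaceE)
  fix \<sigma> \<alpha> a assume e: "e = glue_rel A TA X `` {(\<sigma>, \<alpha>, a)}" and p: "(\<sigma>, \<alpha>, a) \<in> topspace (glue_space TA X)"
  show ?thesis
    using b b' p realization_Act[OF X p] realization_Act[OF X glue_left_mult[OF p b'] b]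
    by (simp add: e m_assoc topspace_glue_iff)
qed

lemma Act_one:
  assumes "e \<in> topspace (total_space A TA X)" shows "Act (realization A TA X) \<one> e = e"
  using assms
  by (rule total_spaceE) (simp add: realization_Act[OF X] topspace_glue_iff)

lemma Act_inv:
  assumes "b \<in> carrier A" "e \<in> topspace (total_space A TA X)"
  shows "Act (realization A TA X) (inv b) (Act (realization A TA X) b e) = e"
    "Act (realization A TA X) b (Act (realization A TA X) (inv b) e) = e"
  using assms by (simp_all add: Act_mult[symmetric] Act_one)

lemma Act_extensional: "b \<in> carrier A \<Longrightarrow> Act (realization A TA X) b \<in> extensional (topspace (total_space A TA X))"
  by (simp add: realization_def)

lemma continuous_map_Act:
  assumes b: "b \<in> carrier A"
  shows "continuous_map (total_space A TA X) (total_space A TA X) (Act (realization A TA X) b)"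
proof (rule continuous_map_from_total[OF X fin])
  fix \<sigma> assume \<sigma>: "\<sigma> \<in> Simp X"
  have "continuous_map (prod_topology (simplex_space \<sigma>) TA) (prod_topology (simplex_space \<sigma>) TA)
      (\<lambda>p. (fst p, b \<otimes> snd p))"
    using continuous_map_compose[OF continuous_map_snd continuous_map_left_mult[OF b]]
    by (intro continuous_map_pairedI continuous_map_fst) (simp add: o_def)
  from continuous_map_compose[OF this continuous_map_cell[OF X fin \<sigma>]]
  show "continuous_map (prod_topology (simplex_space \<sigma>) TA) (total_space A TA X)
      (\<lambda>p. Act (realization A TA X) b (cell X \<sigma> p))"
    by (rule continuous_map_eq)
      (use \<sigma> in \<open>auto simp: cell_def realization_Act[OF X _ b] topspace_glue_iff topspace_TA\<close>)
qed

lemma homeomorphic_map_Act: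
  assumes b: "b \<in> carrier A"
  shows "homeomorphic_map (total_space A TA X) (total_space A TA X) (Act (realization A TA X) b)"
  unfolding homeomorphic_map_maps homeomorphic_maps_def
  using continuous_map_Act[OF b] continuous_map_Act[OF inv_closed[OF b]] Act_inv[OF b]
  by (intro exI[of _ "Act (realization A TA X) (inv b)"]) auto

lemma group_action_realization:
  "group_action A (topspace (total_space A TA X)) (Act (realization A TA X))"
proof -
  let ?E = "topspace (total_space A TA X)" and ?act = "Act (realization A TA X)"
  have Bij: "?act b \<in> Bij ?E" if "b \<in> carrier A" for b
    unfolding Bij_def using Act_extensional[OF that] Act_in_total_space Act_inv[OF that] that
    by (auto intro!: bij_betw_byWitness[where f' = "?act (inv b)"])
  have "?act (b \<otimes> b') = compose ?E (?act b) (?act b')" if "b \<in> carrier A" "b' \<in> carrier A" for b b'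
    using that Act_mult Act_extensional[of "b \<otimes> b'"]
    by (intro extensionalityI[where A = ?E]) (auto simp: compose_def)
  with Bij have "?act \<in> hom A (BijGroup ?E)"
    by (simp add: hom_def BijGroup_def)
  then show ?thesis
    by (intro group_action.intro group_hom.intro group_hom_axioms.intro is_group group_BijGroup)
qed

lemma Proj_in_base:
  assumes "e \<in> topspace (total_space A TA X)"
  shows "Proj (realization A TA X) e \<in> topspace (complex_space (Simp X))"
  using assms
  by (rule total_spaceE)
    (auto simp: realization_Proj topspace_glue_iff topspace_complex_space_UN[OF simplices_complex[OF X fin] fin])

lemma Proj_Act:
  assumes "b \<in> carrier A" "e \<in> topspace (total_space A TA X)"
  shows "Proj (realization A TA X) (Act (realization A TA X) b e) = Proj (realization A TA X) e"
  using assms(2)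
  by (rule total_spaceE) (simp add: realization_Act[OF X _ assms(1)] realization_Proj glue_left_mult assms(1))

lemma Proj_surj: "Proj (realization A TA X) ` topspace (total_space A TA X) = topspace (complex_space (Simp X))"
proof (intro equalityI subsetI)
  fix \<alpha> assume "\<alpha> \<in> topspace (complex_space (Simp X))"
  then obtain \<sigma> where "\<sigma> \<in> Simp X" "\<alpha> \<in> topspace (simplex_space \<sigma>)"
    by (auto simp: topspace_complex_space_UN[OF simplices_complex[OF X fin] fin])
  then have p: "(\<sigma>, \<alpha>, \<one>) \<in> topspace (glue_space TA X)"
    by (simp add: topspace_glue_iff)
  show "\<alpha> \<in> Proj (realization A TA X) ` topspace (total_space A TA X)"
    using realization_Proj[OF p] glue_class_in_total_space[OF p] by (metis image_eqI)
qed (auto simp: Proj_in_base)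

lemma continuous_map_Proj:
  "continuous_map (total_space A TA X) (complex_space (Simp X)) (Proj (realization A TA X))"
proof (rule continuous_map_from_total[OF X fin])
  fix \<sigma> assume \<sigma>: "\<sigma> \<in> Simp X"
  note continuous_map_compose[OF continuous_map_fst
      continuous_map_simplex_inclusion[OF simplices_complex[OF X fin] fin \<sigma>]]
  then show "continuous_map (prod_topology (simplex_space \<sigma>) TA) (complex_space (Simp X))
      (\<lambda>p. Proj (realization A TA X) (cell X \<sigma> p))"
    by (rule continuous_map_eq)
      (use \<sigma> in \<open>auto simp: cell_def realization_Proj topspace_glue_iff topspace_TA\<close>)
qed

lemma openin_star:
  "openin (complex_space (Simp X)) {\<alpha> \<in> topspace (complex_space (Simp X)). \<alpha> s \<noteq> 0}"
proof -
  have "continuous_map (complex_space (Simp X)) euclideanreal (\<lambda>\<alpha>. \<alpha> s)"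
    by (subst complex_space_eq_subspace[OF simplices_complex[OF X fin] fin], intro continuous_map_from_subtopology
        continuous_map_product_projection[where X = "\<lambda>_. euclideanreal", OF UNIV_I])
  then have "openin (complex_space (Simp X)) {\<alpha> \<in> topspace (complex_space (Simp X)). \<alpha> s \<in> - {0}}"
    by (rule openin_continuous_map_preimage) auto
  then show ?thesis by simp
qed

text \<open>All representatives share \<alpha>, and {s} is a face of its support. Thus
  \<open>glue_rel_below_supp\<close> gives all of them the same value, and the image in
  \<open>the_elem\<close> is a singleton.\<close>

lemma star_coordinate_class:
  assumes p: "(\<sigma>, \<alpha>, a) \<in> topspace (glue_space TA X)" and s: "s \<in> supp \<alpha>"
  shows "star_coordinate X s (glue_rel A TA X `` {(\<sigma>, \<alpha>, a)}) = a \<otimes> Lab X ({s}, \<sigma>)"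
proof -
  note K = simplices_complex[OF X fin]
  have s': "{s} \<in> Simp X"
    using p s supp_in_simplices[OF K] simplex_face[OF X fin, of "supp \<alpha>" "{s}"] by (auto simp: topspace_glue_iff)
  have "(\<lambda>(\<sigma>, \<alpha>, a). a \<otimes> Lab X ({s}, \<sigma>)) q = (\<lambda>(\<sigma>, \<alpha>, a). a \<otimes> Lab X ({s}, \<sigma>)) (\<sigma>, \<alpha>, a)"
    if q: "q \<in> glue_rel A TA X `` {(\<sigma>, \<alpha>, a)}" for q
  proof -
    obtain \<tau> b where q_eq: "q = (\<tau>, \<alpha>, b)" and r: "((\<sigma>, \<alpha>, a), (\<tau>, \<alpha>, b)) \<in> glue_rel A TA X"
      using q by (cases q) (simp add: glue_rel_iff)
    then have q': "(\<tau>, \<alpha>, b) \<in> topspace (glue_space TA X)"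
      by (simp add: glue_rel_iff topspace_glue_iff)
    show ?thesis
      using glue_rel_below_supp[OF X fin p q' s'] r s by (simp add: q_eq)
  qed
  moreover have "glue_rel A TA X `` {(\<sigma>, \<alpha>, a)} \<noteq> {}"
    using equiv_class_self[OF equiv_glue_rel p] by blast
  ultimately have "the_elem ((\<lambda>(\<sigma>, \<alpha>, a). a \<otimes> Lab X ({s}, \<sigma>)) ` (glue_rel A TA X `` {(\<sigma>, \<alpha>, a)})) =
      (\<lambda>(\<sigma>, \<alpha>, a). a \<otimes> Lab X ({s}, \<sigma>)) (\<sigma>, \<alpha>, a)"
    by (intro the_elem_image_unique)
  then show ?thesis
    by (simp add: star_coordinate_def)
qed

text \<open>The map is shown to be a continuous closed bijection. Continuity and closedness are
  checked on the finitely many cells whose simplex contains s, where the map is a simplex inclusion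
  times a right translation; injectivity is \<open>glue_rel_below_supp\<close> at {s}.\<close>

lemma star_trivialization:
  defines "U \<equiv> \<lambda>s. {\<alpha> \<in> topspace (complex_space (Simp X)). \<alpha> s \<noteq> 0}"
  shows "homeomorphic_map
      (subtopology (total_space A TA X) {e \<in> topspace (total_space A TA X). Proj (realization A TA X) e \<in> U s})
      (prod_topology (subtopology (complex_space (Simp X)) (U s)) TA)
      (\<lambda>e. (Proj (realization A TA X) e, star_coordinate X s e))"
    (is "homeomorphic_map ?E ?B ?\<psi>")
proof -
  note K = simplices_complex[OF X fin]
  \<comment> \<open>The part of the cell of \<sigma> above the open star of s. It is empty if s is
    not in \<sigma>, so the simplices in \<open>I\<close> suffice for a cover.\<close>
  define W where "W \<sigma> = {p \<in> topspace (prod_topology (simplex_space \<sigma>) TA). fst p s \<noteq> 0}" for \<sigma>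
  define I where "I = {\<sigma> \<in> Simp X. s \<in> \<sigma>}"
  have finI: "finite I"
    using finite_complex[OF K fin] by (simp add: I_def)
  have V: "?B = subtopology (prod_topology (complex_space (Simp X)) TA) (U s \<times> carrier A)"
    by (simp add: prod_topology_subtopology topspace_TA)
  have base: "topspace (simplex_space \<sigma>) \<subseteq> topspace (complex_space (Simp X))" if "\<sigma> \<in> Simp X" for \<sigma>
    using that by (auto simp: topspace_complex_space_UN[OF K fin])
  have \<psi>: "?\<psi> (cell X \<sigma> (\<alpha>, a)) = (\<alpha>, a \<otimes> Lab X ({s}, \<sigma>))"
    if "\<sigma> \<in> Simp X" "\<alpha> \<in> topspace (simplex_space \<sigma>)" "a \<in> carrier A" "\<alpha> s \<noteq> 0" for \<sigma> \<alpha> a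
    using that by (simp add: cell_def realization_Proj topspace_glue_iff
        star_coordinate_class supp_def)
  have top: "topspace ?E = {e \<in> topspace (total_space A TA X). Proj (realization A TA X) e \<in> U s}"
    by auto
  have pre: "{p \<in> topspace (prod_topology (simplex_space \<sigma>) TA). cell X \<sigma> p \<in> topspace ?E} = W \<sigma>"
    if "\<sigma> \<in> I" for \<sigma>
    unfolding W_def
  proof (rule Collect_cong, rule conj_cong[OF refl])
    fix p assume p: "p \<in> topspace (prod_topology (simplex_space \<sigma>) TA)"
    obtain \<alpha> a where p_eq: "p = (\<alpha>, a)" by fastforce
    have g: "(\<sigma>, \<alpha>, a) \<in> topspace (glue_space TA X)"
      using p that by (simp add: p_eq topspace_glue_iff I_def topspace_TA)
    then have "\<alpha> \<in> topspace (complex_space (Simp X))"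
      using base by (auto simp: topspace_glue_iff)
    then show "cell X \<sigma> p \<in> topspace ?E \<longleftrightarrow> fst p s \<noteq> 0"
      unfolding top p_eq cell_def
      by (simp add: realization_Proj[OF g] glue_class_in_total_space[OF g] U_def)
  qed
  have cover: "topspace ?E \<subseteq> (\<Union>\<sigma>\<in>I. cell X \<sigma> ` topspace (subtopology (prod_topology (simplex_space \<sigma>) TA) (W \<sigma>)))"
  proof
    fix e assume e: "e \<in> topspace ?E"
    then have "e \<in> topspace (total_space A TA X)" by simp
    then obtain \<sigma> \<alpha> a where p: "(\<sigma>, \<alpha>, a) \<in> topspace (glue_space TA X)"
      and eq: "e = glue_rel A TA X `` {(\<sigma>, \<alpha>, a)}"
      by (rule total_spaceE)
    then have "\<alpha> s \<noteq> 0"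
      using e by (simp add: realization_Proj U_def)
    moreover have "s \<in> \<sigma>"
      using p calculation by (auto simp: topspace_glue_iff topspace_simplex_space)
    ultimately show "e \<in> (\<Union>\<sigma>\<in>I. cell X \<sigma> ` topspace (subtopology (prod_topology (simplex_space \<sigma>) TA) (W \<sigma>)))"
      using p by (auto simp: eq topspace_glue_iff I_def W_def cell_def topspace_TA intro!: bexI[of _ \<sigma>] imageI)
  qed
  have k_cont: "continuous_map (subtopology (prod_topology (simplex_space \<sigma>) TA) (W \<sigma>)) ?E (cell X \<sigma>)"
    if "\<sigma> \<in> I" for \<sigma>
    using that pre[OF that] continuous_map_cell[OF X fin, of \<sigma>] unfolding top
    by (auto simp: I_def continuous_map_in_subtopology continuous_map_from_subtopology)
  have k_closed: "closed_map (subtopology (prod_topology (simplex_space \<sigma>) TA) (W \<sigma>)) ?E (cell X \<sigma>)"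
    if "\<sigma> \<in> I" for \<sigma>
    using that pre[OF that] unfolding top
    by (intro closed_map_restriction closed_map_cell[OF X fin]) (simp_all add: I_def)
  \<comment> \<open>\<open>?\<psi>\<close> in the coordinates of a cell. Unlike
    \<open>?\<psi>\<close>, this formula is meaningful on the whole cell, so closedness can be
    proved there and restricted to the star afterwards.\<close>
  define m where "m \<sigma> p = (fst p, snd p \<otimes> Lab X ({s}, \<sigma>))" for \<sigma> and p :: "('s \<Rightarrow> real) \<times> 'a"
  have \<psi>_cell: "m \<sigma> p = ?\<psi> (cell X \<sigma> p)" if "\<sigma> \<in> I" "p \<in> W \<sigma>" for \<sigma> p
    using that \<psi>[of \<sigma> "fst p" "snd p"] by (auto simp: m_def W_def I_def topspace_TA)
  have lab: "Lab X ({s}, \<sigma>) \<in> carrier A" if "\<sigma> \<in> I" for \<sigma>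
    using that simplex_face[OF X fin, of \<sigma> "{s}"] by (auto simp: I_def intro!: monomial_complex_Lab(1)[OF X])
  have m: "continuous_map (subtopology (prod_topology (simplex_space \<sigma>) TA) (W \<sigma>)) ?B (m \<sigma>) \<and>
      closed_map (subtopology (prod_topology (simplex_space \<sigma>) TA) (W \<sigma>)) ?B (m \<sigma>)"
    if \<sigma>: "\<sigma> \<in> I" for \<sigma>
  proof -
    let ?P = "prod_topology (simplex_space \<sigma>) TA" and ?Q = "prod_topology (complex_space (Simp X)) TA"
    have \<sigma>': "\<sigma> \<in> Simp X" using \<sigma> by (simp add: I_def)
    \<comment> \<open>Both factors of \<open>m\<close> \<sigma> are proper, the translation as a
      homeomorphism and the inclusion as a closed injective map; hence so is the product.\<close>
    have "homeomorphic_maps TA TA (\<lambda>a. a \<otimes> Lab X ({s}, \<sigma>)) (\<lambda>a. a \<otimes> inv (Lab X ({s}, \<sigma>)))"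
      unfolding homeomorphic_maps_def topspace_TA using lab[OF \<sigma>]
      by (auto intro: continuous_map_right_mult simp: m_assoc)
    then have "proper_map TA TA (\<lambda>a. a \<otimes> Lab X ({s}, \<sigma>))"
      using homeomorphic_imp_proper_map homeomorphic_maps_map by blast
    moreover have "proper_map (simplex_space \<sigma>) (complex_space (Simp X)) (\<lambda>\<alpha>. \<alpha>)"
      using closed_map_simplex_inclusion[OF K fin \<sigma>'] by (intro closed_injective_imp_proper_map) auto
    ultimately have "proper_map ?P ?Q (\<lambda>(x, y). (x, y \<otimes> Lab X ({s}, \<sigma>)))"
      unfolding proper_map_prod by blast
    then have cl: "closed_map ?P ?Q (m \<sigma>)"
      by (simp add: m_def[abs_def] case_prod_unfold proper_imp_closed_map)
    have co: "continuous_map ?P ?Q (m \<sigma>)"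
      unfolding m_def[abs_def]
      using continuous_map_compose[OF continuous_map_fst continuous_map_simplex_inclusion[OF K fin \<sigma>']]
        continuous_map_compose[OF continuous_map_snd continuous_map_right_mult[OF lab[OF \<sigma>]]]
      by (intro continuous_map_pairedI) (simp_all add: o_def)
    \<comment> \<open>\<open>W\<close> \<sigma> is the full preimage of the star, and a closed map
      stays closed when restricted to a full preimage.\<close>
    have pre: "{p \<in> topspace ?P. m \<sigma> p \<in> U s \<times> carrier A} = W \<sigma>"
      using base[OF \<sigma>'] lab[OF \<sigma>] by (auto simp: m_def W_def U_def topspace_TA)
    show ?thesis
      unfolding V using closed_map_restriction[OF cl pre] co pre
      by (auto simp: continuous_map_in_subtopology continuous_map_from_subtopology)
  qed
  have topW: "topspace (subtopology (prod_topology (simplex_space \<sigma>) TA) (W \<sigma>)) = W \<sigma>" for \<sigma>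
    by (auto simp: W_def)
  have cont: "continuous_map ?E ?B ?\<psi>"
  proof (rule continuous_map_closed_cover[OF finI k_closed cover])
    show "continuous_map (subtopology (prod_topology (simplex_space \<sigma>) TA) (W \<sigma>)) ?B (\<lambda>w. ?\<psi> (cell X \<sigma> w))"
      if "\<sigma> \<in> I" for \<sigma>
      using m[OF that, THEN conjunct1] by (rule continuous_map_eq) (use \<psi>_cell that topW in auto)
  qed
  have closed: "closed_map ?E ?B ?\<psi>"
  proof (rule closed_map_closed_cover[OF finI k_cont cover])
    show "closed_map (subtopology (prod_topology (simplex_space \<sigma>) TA) (W \<sigma>)) ?B (\<lambda>w. ?\<psi> (cell X \<sigma> w))"
      if "\<sigma> \<in> I" for \<sigma>
      using m[OF that, THEN conjunct2] by (rule closed_map_eq) (use \<psi>_cell that topW in auto)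
  qed
  have surj: "?\<psi> ` topspace ?E = topspace ?B"
  proof
    show "?\<psi> ` topspace ?E \<subseteq> topspace ?B"
      by (rule continuous_map_image_subset_topspace[OF cont])
    show "topspace ?B \<subseteq> ?\<psi> ` topspace ?E"
    proof
      fix y assume y: "y \<in> topspace ?B"
      obtain \<alpha> b where y_eq: "y = (\<alpha>, b)" by fastforce
      have \<alpha>: "\<alpha> \<in> topspace (complex_space (Simp X))" "\<alpha> s \<noteq> 0" and b: "b \<in> carrier A"
        using y by (auto simp: y_eq U_def topspace_TA)
      then obtain \<sigma> where \<sigma>: "\<sigma> \<in> Simp X" "\<alpha> \<in> topspace (simplex_space \<sigma>)"
        by (auto simp: topspace_complex_space_UN[OF K fin])
      have \<sigma>I: "\<sigma> \<in> I"
        using \<sigma> \<alpha>(2) by (auto simp: I_def topspace_simplex_space)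
      \<comment> \<open>The second coordinate solves a l({s}, \<sigma>) = b for a.\<close>
      let ?p = "(\<alpha>, b \<otimes> inv (Lab X ({s}, \<sigma>)))"
      have p: "?p \<in> W \<sigma>"
        using \<sigma> \<alpha> b lab[OF \<sigma>I] by (simp add: W_def topspace_TA)
      have "m \<sigma> ?p = y"
        using b lab[OF \<sigma>I] by (simp add: m_def y_eq m_assoc)
      then have "y = ?\<psi> (cell X \<sigma> ?p)"
        using \<psi>_cell[OF \<sigma>I p] by simp
      moreover have "cell X \<sigma> ?p \<in> topspace ?E"
        using pre[OF \<sigma>I] p by blast
      ultimately show "y \<in> ?\<psi> ` topspace ?E" by (rule image_eqI)
    qed
  qed
  have inj: "inj_on ?\<psi> (topspace ?E)"
  proof (rule inj_onI)
    fix d e assume d: "d \<in> topspace ?E" and e: "e \<in> topspace ?E" and eq: "?\<psi> d = ?\<psi> e"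
    from d have "d \<in> topspace (total_space A TA X)" by simp
    then obtain \<sigma> \<alpha> a where d_eq: "d = glue_rel A TA X `` {(\<sigma>, \<alpha>, a)}"
      and p: "(\<sigma>, \<alpha>, a) \<in> topspace (glue_space TA X)" by (rule total_spaceE)
    from e have "e \<in> topspace (total_space A TA X)" by simp
    then obtain \<tau> \<beta> b where e_eq: "e = glue_rel A TA X `` {(\<tau>, \<beta>, b)}"
      and q: "(\<tau>, \<beta>, b) \<in> topspace (glue_space TA X)" by (rule total_spaceE)
    have "\<alpha> = \<beta>"
      using eq by (simp add: d_eq e_eq realization_Proj[OF p] realization_Proj[OF q])
    note q = q[folded this] and e_eq = e_eq[folded this]
    have s: "s \<in> supp \<alpha>"
      using d by (simp add: d_eq realization_Proj[OF p] U_def supp_def)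
    have "a \<otimes> Lab X ({s}, \<sigma>) = b \<otimes> Lab X ({s}, \<tau>)"
      using eq by (simp add: d_eq e_eq star_coordinate_class[OF p s] star_coordinate_class[OF q s])
    moreover have "{s} \<in> Simp X"
      using p s supp_in_simplices[OF K] simplex_face[OF X fin, of "supp \<alpha>" "{s}"]
      by (auto simp: topspace_glue_iff)
    ultimately have "((\<sigma>, \<alpha>, a), (\<tau>, \<alpha>, b)) \<in> glue_rel A TA X"
      using s glue_rel_below_supp[OF X fin p q, of "{s}"] by simp
    then show "d = e"
      unfolding d_eq e_eq by (rule equiv_class_eq[OF equiv_glue_rel])
  qed
  show ?thesis
    by (rule bijective_closed_imp_homeomorphic_map[OF cont closed surj inj])
qed

lemma star_coordinate_Act:
  assumes b: "b \<in> carrier A" and e: "e \<in> topspace (total_space A TA X)"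
    and s: "Proj (realization A TA X) e s \<noteq> 0"
  shows "star_coordinate X s (Act (realization A TA X) b e) = b \<otimes> star_coordinate X s e"
proof -
  obtain \<sigma> \<alpha> a where eq: "e = glue_rel A TA X `` {(\<sigma>, \<alpha>, a)}"
    and p: "(\<sigma>, \<alpha>, a) \<in> topspace (glue_space TA X)"
    using e by (rule total_spaceE)
  have s': "s \<in> supp \<alpha>"
    using s by (simp add: eq realization_Proj[OF p] supp_def)
  have "supp \<alpha> \<subseteq> \<sigma>" "\<sigma> \<in> Simp X"
    using p supp_in_simplices[OF simplices_complex[OF X fin]] by (auto simp: topspace_glue_iff)
  then have "Lab X ({s}, \<sigma>) \<in> carrier A"
    using s' simplex_face[OF X fin, of \<sigma> "{s}"] by (auto intro!: monomial_complex_Lab(1)[OF X])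
  then show ?thesis
    using p b realization_Act[OF X p b] star_coordinate_class[OF p s']
      star_coordinate_class[OF glue_left_mult[OF p b] s']
    by (simp add: eq topspace_glue_iff m_assoc)
qed

lemma fibered_bundle_realization: "fibered_bundle A TA (realization A TA X)"
  unfolding fibered_bundle_def realization_simps
proof (intro conjI ballI)
  show "Act (realization A TA X) \<in> extensional (carrier A)"
    "Proj (realization A TA X) \<in> extensional (topspace (total_space A TA X))"
    by (simp_all add: realization_def)
  fix x assume x: "x \<in> topspace (complex_space (Simp X))"
  then obtain \<sigma> where \<sigma>: "\<sigma> \<in> Simp X" "x \<in> topspace (simplex_space \<sigma>)"
    by (auto simp: topspace_complex_space_UN[OF simplices_complex[OF X fin] fin])
  \<comment> \<open>Any vertex of the support provides an open star that contains \<open>x\<close>,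
    so the open stars cover the base.\<close>
  have "supp x \<noteq> {}"
    using supp_in_simplices(1)[OF simplices_complex[OF X fin] \<sigma>] monomial_complex_simplex(3)[OF X] by blast
  then obtain s where s: "x s \<noteq> 0"
    by (auto simp: supp_def)
  let ?U = "{\<alpha> \<in> topspace (complex_space (Simp X)). \<alpha> s \<noteq> 0}"
  show "\<exists>U. openin (complex_space (Simp X)) U \<and> x \<in> U \<and>
      (\<exists>\<psi>. homeomorphic_map
          (subtopology (total_space A TA X) {e \<in> topspace (total_space A TA X). Proj (realization A TA X) e \<in> U})
          (prod_topology (subtopology (complex_space (Simp X)) U) TA) \<psi> \<and>
        (\<forall>e\<in>topspace (total_space A TA X). Proj (realization A TA X) e \<in> U \<longrightarrow>
           fst (\<psi> e) = Proj (realization A TA X) e \<and>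
           (\<forall>a\<in>carrier A. \<psi> (Act (realization A TA X) a e) = (fst (\<psi> e), a \<otimes> snd (\<psi> e)))))"
    using x s star_coordinate_Act Proj_Act
    by (intro exI[of _ ?U] conjI openin_star exI[of _ "\<lambda>e. (Proj (realization A TA X) e, star_coordinate X s e)"]
        star_trivialization) auto
qed (simp_all add: group_action_realization homeomorphic_map_Act continuous_map_Proj Proj_surj Proj_Act)

end

end

section \<open>Realization and homotopy\<close>

lemma push_id:
  assumes "\<And>s. s \<notin> S \<Longrightarrow> \<alpha> s = 0"
  shows "push S (\<lambda>s\<in>S. s) \<alpha> = \<alpha>"
proof
  fix t
  have "{s. s \<in> S \<and> (\<lambda>s\<in>S. s) s = t} = (if t \<in> S then {t} else {})"
    by auto
  then show "push S (\<lambda>s\<in>S. s) \<alpha> t = \<alpha> t"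
    using assms[of t] by (auto simp: push_def)
qed

text \<open>The sum over a fibre of the composite is grouped by the value of
  \<open>f\<close>.\<close>

lemma push_compose:
  assumes "finite S" "finite T" "f \<in> S \<rightarrow> T"
  shows "push S (compose S g f) \<alpha> = push T g (push S f \<alpha>)"
proof
  fix u
  have "(\<Sum>t\<in>{t \<in> T. g t = u}. \<Sum>s\<in>{s \<in> {s \<in> S. g (f s) = u}. f s = t}. \<alpha> s) =
      (\<Sum>s\<in>{s \<in> S. g (f s) = u}. \<alpha> s)"
    using assms by (intro sum.group) auto
  moreover have "{s \<in> {s \<in> S. g (f s) = u}. f s = t} = {s. s \<in> S \<and> f s = t}" if "g t = u" for t
    using that by auto
  moreover have "{s \<in> S. g (f s) = u} = {s. s \<in> S \<and> compose S g f s = u}"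
    by (auto simp: compose_eq)
  ultimately show "push S (compose S g f) \<alpha> u = push T g (push S f \<alpha>) u"
    by (simp add: push_def)
qed

lemma continuous_map_push:
  assumes "finite S" "continuous_map W (powertop_real UNIV) u"
  shows "continuous_map W (powertop_real UNIV) (\<lambda>w. push S f (u w))"
  using assms unfolding continuous_map_componentwise_UNIV push_def
  by (intro allI continuous_map_sum) auto

lemma continuous_map_into_simplex:
  "continuous_map W (simplex_space \<sigma>) u \<longleftrightarrow>
    continuous_map W (powertop_real UNIV) u \<and> u \<in> topspace W \<rightarrow> topspace (simplex_space \<sigma>)"
  by (subst simplex_space_eq) (simp add: continuous_map_in_subtopology image_subset_iff_funcset)

text \<open>A simplex is convex and continuity is coordinatewise. Both ends must lie in the same
  simplex, which is what contiguity supplies with f(\<sigma>) \<union> f'(\<sigma>).\<close>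

lemma continuous_map_simplex_segment:
  assumes u: "continuous_map W (simplex_space \<sigma>) u" and v: "continuous_map W (simplex_space \<sigma>) v"
  shows "continuous_map (prod_topology W unit_interval) (simplex_space \<sigma>)
    (\<lambda>(w, t) s. (1 - t) * u w s + t * v w s)"
  unfolding continuous_map_into_simplex
proof
  have snd: "continuous_map (prod_topology W unit_interval) euclideanreal snd"
    using continuous_map_snd continuous_map_in_subtopology by blast
  have comp: "continuous_map (prod_topology W unit_interval) euclideanreal (\<lambda>p. h (fst p) s)"
    if "continuous_map W (simplex_space \<sigma>) h" for h s
    using continuous_map_compose[OF continuous_map_fst, of W euclideanreal "\<lambda>w. h w s" unit_interval] that
    unfolding continuous_map_into_simplex continuous_map_componentwise_UNIV by (simp add: o_def)
  show "continuous_map (prod_topology W unit_interval) (powertop_real UNIV)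
      (\<lambda>(w, t) s. (1 - t) * u w s + t * v w s)"
    unfolding continuous_map_componentwise_UNIV case_prod_unfold
    by (intro allI continuous_map_add continuous_map_real_mult continuous_map_diff snd comp[OF u] comp[OF v])
      simp
  have "(\<lambda>s. (1 - t) * \<alpha> s + t * \<beta> s) \<in> topspace (simplex_space \<sigma>)"
    if "\<alpha> \<in> topspace (simplex_space \<sigma>)" "\<beta> \<in> topspace (simplex_space \<sigma>)" "0 \<le> t" "t \<le> 1" for \<alpha> \<beta> t
    using that by (simp add: topspace_simplex_space sum.distrib flip: sum_distrib_left)
  then show "(\<lambda>(w, t) s. (1 - t) * u w s + t * v w s) \<in>
      topspace (prod_topology W unit_interval) \<rightarrow> topspace (simplex_space \<sigma>)"
    using u v unfolding continuous_map_into_simplex by (auto simp: Pi_iff)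
qed

section \<open>Realization of morphisms and of contiguities\<close>

context topological_group
begin

lemma continuous_map_push_simplex:
  assumes "\<sigma> \<subseteq> S" "finite S"
  shows "continuous_map (simplex_space \<sigma>) (simplex_space (f ` \<sigma>)) (push S f)"
proof -
  have "continuous_map (simplex_space \<sigma>) (powertop_real UNIV) (\<lambda>\<alpha>. \<alpha>)"
    by (subst simplex_space_eq) (rule continuous_map_from_subtopology[OF continuous_map_id, unfolded id_def])
  from continuous_map_push[OF assms(2) this] show ?thesis
    unfolding continuous_map_into_simplex using push_in_simplex(1)[OF assms] by auto
qed

text \<open>The realization is the slice at 0 of a carried map whose \<open>?g\<close> ignores its
  parameter in the unit interval. Continuity, equivariance and compatibility with the projections
  are therefore inherited from the general construction.\<close>

lemma realization_hom_in_bundle_hom: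
  assumes X: "monomial_complex A X" and finX: "finite (Vert X)"
    and Y: "monomial_complex A Y" and finY: "finite (Vert Y)" and f: "(f, \<kappa>) \<in> mono_hom A X Y"
  shows "realization_hom A TA X Y (f, \<kappa>) \<in> bundle_hom A (realization A TA X) (realization A TA Y)"
proof -
  let ?g = "\<lambda>(\<alpha>, z :: real). push (Vert X) f \<alpha>"
  note homD = mono_homD[OF f]
  have g: "continuous_map (prod_topology (simplex_space \<sigma>) unit_interval) (simplex_space (f ` \<sigma>)) ?g"
    if "\<sigma> \<in> Simp X" for \<sigma>
    using continuous_map_compose[OF continuous_map_fst
        continuous_map_push_simplex[OF monomial_complex_simplex(1)[OF X that] finX]]
    by (simp add: o_def case_prod_unfold)
  note carried = X finX Y finY homD(2) image_mono homD(4) homD(5) g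
  let ?H = "carried_map Y ((`) f) \<kappa> ?g" and ?F = "realization_hom A TA X Y (f, \<kappa>)"
  have at0: "continuous_map W (prod_topology W unit_interval) (\<lambda>w. (w, 0))" for W :: "'w topology"
    by (intro continuous_map_pairedI) auto
  have H: "?H (e, 0) = fst ?F e" if e: "e \<in> topspace (total_space A TA X)" for e
    using e
  proof (rule total_spaceE)
    fix \<sigma> \<alpha> a assume "e = glue_rel A TA X `` {(\<sigma>, \<alpha>, a)}" and p: "(\<sigma>, \<alpha>, a) \<in> topspace (glue_space TA X)"
    then show ?thesis
      using carried_map_class[OF carried, of \<sigma> \<alpha> a 0] realization_hom_class[OF X Y finX f p] by simp
  qed
  have h: "?g (\<alpha>, 0) = snd ?F \<alpha>" if "\<alpha> \<in> topspace (complex_space (Simp X))" for \<alpha>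
    using that by (simp add: realization_hom_def)
  have "continuous_map (total_space A TA X) (total_space A TA Y) (fst ?F)"
    using continuous_map_compose[OF at0 continuous_map_carried_map[OF carried]]
  proof (rule continuous_map_eq)
    show "(?H \<circ> (\<lambda>w. (w, 0))) e = fst ?F e" if "e \<in> topspace (total_space A TA X)" for e
      unfolding o_apply by (rule H[OF that])
  qed
  moreover have "continuous_map (complex_space (Simp X)) (complex_space (Simp Y)) (snd ?F)"
    using continuous_map_compose[OF at0 continuous_map_carried_base[OF carried]]
  proof (rule continuous_map_eq)
    show "(?g \<circ> (\<lambda>w. (w, 0))) \<alpha> = snd ?F \<alpha>" if "\<alpha> \<in> topspace (complex_space (Simp X))" for \<alpha>
      unfolding o_apply by (rule h[OF that])
  qed
  moreover have "fst ?F (Act (realization A TA X) a e) = Act (realization A TA Y) a (fst ?F e)"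
    if "a \<in> carrier A" "e \<in> topspace (total_space A TA X)" for a e
    using carried_map_Act[OF carried that, of 0] H that Act_in_total_space[OF X finX that] by simp
  moreover have "Proj (realization A TA Y) (fst ?F e) = snd ?F (Proj (realization A TA X) e)"
    if "e \<in> topspace (total_space A TA X)" for e
    using carried_map_Proj[OF carried that, of 0] H[OF that] h[OF Proj_in_base[OF X finX that]] by simp
  ultimately have "(fst ?F, snd ?F) \<in> bundle_hom A (realization A TA X) (realization A TA Y)"
    unfolding bundle_hom_def by simp
      (simp add: realization_hom_def)
  then show ?thesis by simp
qed

text \<open>Rewrites a point of the cell of \<sigma> in a larger cell, with l = m(\<sigma>, \<tau>)
  absorbed into the inverse: a (l k)^-1 l = a k^-1. It identifies the ends of the homotopy, which
  are computed in the cell of T(\<sigma>), with the realizations, computed in f(\<sigma>) or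
  f'(\<sigma>).\<close>

lemma glue_class_enlarge:
  assumes Y: "monomial_complex A Y" and fin: "finite (Vert Y)"
    and \<tau>: "\<tau> \<in> Simp Y" "\<sigma> \<subseteq> \<tau>" and p: "(\<sigma>, \<beta>, a \<otimes> inv k) \<in> topspace (glue_space TA Y)"
    and c: "a \<in> carrier A" "k \<in> carrier A"
  shows "glue_rel A TA Y `` {(\<tau>, \<beta>, a \<otimes> inv (Lab Y (\<sigma>, \<tau>) \<otimes> k))} = glue_rel A TA Y `` {(\<sigma>, \<beta>, a \<otimes> inv k)}"
proof -
  note p' = p[unfolded topspace_glue_iff]
  have l: "Lab Y (\<sigma>, \<tau>) \<in> carrier A"
    using p' \<tau> by (auto intro: monomial_complex_Lab(1)[OF Y])
  have "\<beta> \<in> topspace (simplex_space \<tau>)"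
    using p' topspace_simplex_space_mono[OF \<tau>(2) monomial_complex_simplex(2)[OF Y \<tau>(1)]] by blast
  then have q: "(\<tau>, \<beta>, a \<otimes> inv (Lab Y (\<sigma>, \<tau>) \<otimes> k)) \<in> topspace (glue_space TA Y)"
    using \<tau> c l by (simp add: topspace_glue_iff)
  have "a \<otimes> inv (Lab Y (\<sigma>, \<tau>) \<otimes> k) \<otimes> Lab Y (\<sigma>, \<tau>) = a \<otimes> inv k \<otimes> Lab Y (\<sigma>, \<sigma>)"
    using c l p' monomial_complex_Lab(3)[OF Y] by (simp add: inv_mult_group m_assoc)
  then have "((\<tau>, \<beta>, a \<otimes> inv (Lab Y (\<sigma>, \<tau>) \<otimes> k)), (\<sigma>, \<beta>, a \<otimes> inv k)) \<in> glue_rel A TA Y"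
    using p' \<tau> supp_in_simplices(2)[OF simplices_complex[OF Y fin]]
    by (subst glue_rel_above_supp[OF Y fin q p, of \<sigma>]) auto
  then show ?thesis
    by (rule equiv_class_eq[OF equiv_glue_rel])
qed

lemma contiguous_imp_bundle_homotopic:
  assumes X: "monomial_complex A X" and finX: "finite (Vert X)"
    and Y: "monomial_complex A Y" and finY: "finite (Vert Y)"
    and f: "((f, \<kappa>), (f', \<kappa>')) \<in> contiguous A X Y"
  shows "(realization_hom A TA X Y (f, \<kappa>), realization_hom A TA X Y (f', \<kappa>'))
    \<in> bundle_homotopic A (realization A TA X) (realization A TA Y)"
proof -
  note f1 = contiguousD(1)[OF f] and f2 = contiguousD(2)[OF f]
  note f1D = mono_homD[OF f1] and f2D = mono_homD[OF f2]
  define T where "T \<sigma> = f ` \<sigma> \<union> f' ` \<sigma>" for \<sigma>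
  define c where "c \<sigma> = Lab Y (f ` \<sigma>, T \<sigma>) \<otimes> \<kappa> \<sigma>" for \<sigma>
  let ?g = "\<lambda>(\<alpha>, t) s. (1 - t) * push (Vert X) f \<alpha> s + t * push (Vert X) f' \<alpha> s"
  have T: "T \<sigma> \<in> Simp Y" if "\<sigma> \<in> Simp X" for \<sigma>
    using contiguousD(3)[OF f that] by (simp add: T_def)
  have T_sub: "f ` \<sigma> \<subseteq> T \<sigma>" "f' ` \<sigma> \<subseteq> T \<sigma>" for \<sigma>
    by (auto simp: T_def)
  have T_mono: "T \<rho> \<subseteq> T \<sigma>" if "\<rho> \<subseteq> \<sigma>" for \<rho> \<sigma>
    using that by (auto simp: T_def)
  have c': "c \<sigma> = Lab Y (f' ` \<sigma>, T \<sigma>) \<otimes> \<kappa>' \<sigma>" if "\<sigma> \<in> Simp X" for \<sigma>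
    using contiguousD(4)[OF f that] by (simp add: c_def T_def)
  have c: "c \<sigma> \<in> carrier A" if "\<sigma> \<in> Simp X" for \<sigma>
    using that f1D(2,4) T T_sub monomial_complex_Lab(1)[OF Y] by (simp add: c_def)
  \<comment> \<open>The label from f(\<rho>) to T(\<sigma>) is the same through T(\<rho>) and
    through f(\<sigma>); the second route brings in the naturality of \<kappa>.\<close>
  have natural: "Lab Y (T \<rho>, T \<sigma>) \<otimes> c \<rho> = c \<sigma> \<otimes> Lab X (\<rho>, \<sigma>)"
    if \<rho>\<sigma>: "\<rho> \<in> Simp X" "\<sigma> \<in> Simp X" "\<rho> \<subseteq> \<sigma>" for \<rho> \<sigma>
  proof -
    have s: "f ` \<rho> \<in> Simp Y" "f ` \<sigma> \<in> Simp Y" "f ` \<rho> \<subseteq> f ` \<sigma>" "T \<rho> \<in> Simp Y" "T \<sigma> \<in> Simp Y"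
      "T \<rho> \<subseteq> T \<sigma>" "f ` \<rho> \<subseteq> T \<sigma>"
      using that f1D(2) T T_mono T_sub(1)[of \<rho>] by (blast+)
    have C: "Lab Y (T \<rho>, T \<sigma>) \<in> carrier A" "Lab Y (f ` \<rho>, T \<rho>) \<in> carrier A"
      "Lab Y (f ` \<sigma>, T \<sigma>) \<in> carrier A" "Lab Y (f ` \<rho>, f ` \<sigma>) \<in> carrier A"
      "\<kappa> \<rho> \<in> carrier A" "\<kappa> \<sigma> \<in> carrier A" "Lab X (\<rho>, \<sigma>) \<in> carrier A"
      using s that T_sub f1D(4) monomial_complex_Lab(1)[OF X] monomial_complex_Lab(1)[OF Y] by simp_all
    have "Lab Y (T \<rho>, T \<sigma>) \<otimes> c \<rho> = Lab Y (f ` \<rho>, T \<sigma>) \<otimes> \<kappa> \<rho>"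
      using C monomial_complex_Lab(2)[OF Y s(1,4,5) T_sub(1) s(6)] by (simp add: c_def m_assoc[symmetric])
    also have "\<dots> = Lab Y (f ` \<sigma>, T \<sigma>) \<otimes> (Lab Y (f ` \<rho>, f ` \<sigma>) \<otimes> \<kappa> \<rho>)"
      using C monomial_complex_Lab(2)[OF Y s(1,2,5,3) T_sub(1)] by (simp add: m_assoc[symmetric])
    also have "\<dots> = c \<sigma> \<otimes> Lab X (\<rho>, \<sigma>)"
      using C f1D(5)[OF \<rho>\<sigma>] by (simp add: c_def m_assoc)
    finally show ?thesis .
  qed
  have g: "continuous_map (prod_topology (simplex_space \<sigma>) unit_interval) (simplex_space (T \<sigma>)) ?g"
    if "\<sigma> \<in> Simp X" for \<sigma>
  proof -
    have fin: "finite (T \<sigma>)"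
      using monomial_complex_simplex(2)[OF Y T[OF that]] .
    have "continuous_map (simplex_space \<sigma>) (simplex_space (T \<sigma>)) (push (Vert X) h)"
      if "h ` \<sigma> \<subseteq> T \<sigma>" for h
      using continuous_map_compose[OF continuous_map_push_simplex[OF
            monomial_complex_simplex(1)[OF X \<open>\<sigma> \<in> Simp X\<close>] finX] continuous_map_simplex_face[OF that fin]]
      by (simp add: o_def)
    from continuous_map_simplex_segment[OF this[OF T_sub(1)] this[OF T_sub(2)]] show ?thesis .
  qed
  note carried = X finX Y finY T T_mono c natural g
  let ?H = "carried_map Y T c ?g"
  have mem: "(h ` \<sigma>, push (Vert X) h \<alpha>, a \<otimes> inv (\<nu> \<sigma>)) \<in> topspace (glue_space TA Y)"
    if "(h, \<nu>) \<in> mono_hom A X Y" "(\<sigma>, \<alpha>, a) \<in> topspace (glue_space TA X)" for h \<nu> \<sigma> \<alpha> a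
    using that mono_homD(2,4)[OF that(1)]
      push_in_simplex(1)[OF monomial_complex_simplex(1)[OF X] finX, of \<sigma> \<alpha> h]
    by (simp add: topspace_glue_iff)
  \<comment> \<open>The two expressions for \<open>c\<close> enter here: the definition at time 0,
    where \<open>?g\<close> is the push-forward along \<open>f\<close>, and \<open>c'\<close> at
    time 1, where it is the one along \<open>f'\<close>.\<close>
  have H0: "?H (e, 0) = fst (realization_hom A TA X Y (f, \<kappa>)) e"
    and H1: "?H (e, 1) = fst (realization_hom A TA X Y (f', \<kappa>')) e"
    if e: "e \<in> topspace (total_space A TA X)" for e
  proof -
    obtain \<sigma> \<alpha> a where e: "e = glue_rel A TA X `` {(\<sigma>, \<alpha>, a)}"
      and p: "(\<sigma>, \<alpha>, a) \<in> topspace (glue_space TA X)"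
      using e by (rule total_spaceE)
    have \<sigma>: "\<sigma> \<in> Simp X" "a \<in> carrier A"
      using p by (simp_all add: topspace_glue_iff)
    show "?H (e, 0) = fst (realization_hom A TA X Y (f, \<kappa>)) e"
      using carried_map_class[OF carried p, of 0] \<sigma>
        glue_class_enlarge[OF Y finY T T_sub(1) mem[OF f1 p] _ f1D(4)]
      by (simp add: e realization_hom_class[OF X Y finX f1 p] c_def[of \<sigma>])
    show "?H (e, 1) = fst (realization_hom A TA X Y (f', \<kappa>')) e"
      using carried_map_class[OF carried p, of 1] \<sigma>
        glue_class_enlarge[OF Y finY T T_sub(2) mem[OF f2 p] _ f2D(4)]
      by (simp add: e realization_hom_class[OF X Y finX f2 p] c'[OF \<sigma>(1)])
  qed
  have "((fst (realization_hom A TA X Y (f, \<kappa>)), snd (realization_hom A TA X Y (f, \<kappa>))),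
      (fst (realization_hom A TA X Y (f', \<kappa>')), snd (realization_hom A TA X Y (f', \<kappa>'))))
    \<in> bundle_homotopic A (realization A TA X) (realization A TA Y)"
    using realization_hom_in_bundle_hom[OF X finX Y finY f1] realization_hom_in_bundle_hom[OF X finX Y finY f2]
      continuous_map_carried_map[OF carried] continuous_map_carried_base[OF carried]
      carried_map_Act[OF carried] carried_map_Proj[OF carried] H0 H1
    \<comment> \<open>In the first pass \<open>realization_hom\<close> stays folded so that the
      facts about its components apply; the end conditions on the base need it unfolded.\<close>
    by (intro bundle_homotopicI[of _ _ _ _ _ _ _ ?H ?g])
      (simp_all, simp_all add: realization_hom_def)
  then show ?thesis by simp
qed

text \<open>A chain of contiguities becomes a chain of bundle homotopies, and that relation is
  transitive, hence equal to its own transitive closure.\<close>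

lemma simp_homotopic_imp_bundle_homotopic:
  assumes X: "monomial_complex A X" and finX: "finite (Vert X)"
    and Y: "monomial_complex A Y" and finY: "finite (Vert Y)"
    and f: "(f, f') \<in> simp_homotopic A X Y"
  shows "(realization_hom A TA X Y f, realization_hom A TA X Y f')
    \<in> bundle_homotopic A (realization A TA X) (realization A TA Y)"
proof -
  let ?R = "bundle_homotopic A (realization A TA X) (realization A TA Y)"
  have "(realization_hom A TA X Y g, realization_hom A TA X Y g') \<in> ?R"
    if "(g, g') \<in> contiguous A X Y" for g g'
    using contiguous_imp_bundle_homotopic[OF X finX Y finY, of "fst g" "snd g" "fst g'" "snd g'"] that by simp
  then have "(realization_hom A TA X Y f, realization_hom A TA X Y f') \<in> ?R\<^sup>+"
    using trancl_map[OF f[unfolded simp_homotopic_def], of "realization_hom A TA X Y"] by blast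
  moreover have "trans ?R"
    using equiv_bundle_homotopic[OF fibered_bundle_realization[OF X finX], of "realization A TA Y"]
    by (simp add: equiv_def)
  ultimately show ?thesis by simp
qed

lemma realization_hom_extensional:
  "fst (realization_hom A TA X Y f) \<in> extensional (topspace (total_space A TA X))"
  "snd (realization_hom A TA X Y f) \<in> extensional (topspace (complex_space (Simp X)))"
  by (simp_all add: realization_hom_def split: prod.splits)

lemma realization_hom_id:
  assumes X: "monomial_complex A X" and fin: "finite (Vert X)"
  shows "realization_hom A TA X X (mono_id A X) =
    (\<lambda>e\<in>topspace (total_space A TA X). e, \<lambda>x\<in>topspace (complex_space (Simp X)). x)"
    (is "?F = _")
proof (rule prod_eqI)
  have push: "push (Vert X) (\<lambda>s\<in>Vert X. s) \<alpha> = \<alpha>" if "\<alpha> \<in> topspace (complex_space (Simp X))" for \<alpha>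
    using that unfolding topspace_complex_space[OF simplices_complex[OF X fin] fin] by (auto intro!: push_id)
  show "snd ?F = snd (\<lambda>e\<in>topspace (total_space A TA X). e, \<lambda>x\<in>topspace (complex_space (Simp X)). x)"
    by (auto simp: realization_hom_def mono_id_def push)
  show "fst ?F = fst (\<lambda>e\<in>topspace (total_space A TA X). e, \<lambda>x\<in>topspace (complex_space (Simp X)). x)"
  proof (rule extensionalityI[OF realization_hom_extensional(1)], simp)
    fix e assume "e \<in> topspace (total_space A TA X)"
    then show "fst ?F e = fst (\<lambda>e\<in>topspace (total_space A TA X). e, \<lambda>x\<in>topspace (complex_space (Simp X)). x) e"
    proof (rule total_spaceE)
      fix \<sigma> \<alpha> a assume e: "e = glue_rel A TA X `` {(\<sigma>, \<alpha>, a)}" and p: "(\<sigma>, \<alpha>, a) \<in> topspace (glue_space TA X)"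
      have "\<alpha> \<in> topspace (complex_space (Simp X))" "\<sigma> \<in> Simp X" "a \<in> carrier A"
        using p by (auto simp: topspace_glue_iff topspace_complex_space_UN[OF simplices_complex[OF X fin] fin])
      moreover have "(\<lambda>s\<in>Vert X. s) ` \<sigma> = \<sigma>"
        using monomial_complex_simplex(1)[OF X \<open>\<sigma> \<in> Simp X\<close>] by (auto simp: subset_iff)
      ultimately show ?thesis
        using realization_hom_class[OF X X fin mono_id_in_mono_hom[OF X, unfolded mono_id_def] p]
          glue_class_in_total_space[OF p] by (simp add: mono_id_def e push)
    qed
  qed
qed

text \<open>The label of the composite enters inverted, and (\<mu> \<kappa>)^-1 = \<kappa>^-1
  \<mu>^-1 is the order in which the two realizations multiply successively from the right.\<close>

lemma realization_hom_comp:
  assumes X: "monomial_complex A X" and finX: "finite (Vert X)"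
    and Y: "monomial_complex A Y" and finY: "finite (Vert Y)"
    and Z: "monomial_complex A Z" and finZ: "finite (Vert Z)"
    and f: "(f, \<kappa>) \<in> mono_hom A X Y" and g: "(g, \<mu>) \<in> mono_hom A Y Z"
  shows "realization_hom A TA X Z (mono_comp A X (g, \<mu>) (f, \<kappa>)) =
    (compose (topspace (total_space A TA X)) (fst (realization_hom A TA Y Z (g, \<mu>))) (fst (realization_hom A TA X Y (f, \<kappa>))),
     compose (topspace (complex_space (Simp X))) (snd (realization_hom A TA Y Z (g, \<mu>))) (snd (realization_hom A TA X Y (f, \<kappa>))))"
    (is "?F = (?\<phi>, ?h)")
proof -
  have gf: "(compose (Vert X) g f, \<lambda>\<sigma>\<in>Simp X. \<mu> (f ` \<sigma>) \<otimes> \<kappa> \<sigma>) \<in> mono_hom A X Z"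
    using mono_comp_in_mono_hom[OF X Y Z f g] by (simp add: mono_comp_def)
  have push: "push (Vert X) (compose (Vert X) g f) \<alpha> = push (Vert Y) g (push (Vert X) f \<alpha>)" for \<alpha>
    using mono_homD(1)[OF f] by (intro push_compose finX finY) auto
  have "snd ?F = ?h"
  proof (rule extensionalityI[OF realization_hom_extensional(2)], simp)
    fix \<alpha> assume \<alpha>: "\<alpha> \<in> topspace (complex_space (Simp X))"
    have "(fst (realization_hom A TA X Y (f, \<kappa>)), snd (realization_hom A TA X Y (f, \<kappa>)))
        \<in> bundle_hom A (realization A TA X) (realization A TA Y)"
      using realization_hom_in_bundle_hom[OF X finX Y finY f] by simp
    from bundle_homD(8)[OF this] \<alpha>
    have "push (Vert X) f \<alpha> \<in> topspace (complex_space (Simp Y))"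
      by simp (simp add: realization_hom_def)
    then show "snd ?F \<alpha> = ?h \<alpha>"
      using \<alpha> by (simp add: realization_hom_def mono_comp_def compose_eq push)
  qed
  moreover have "fst ?F = ?\<phi>"
  proof (rule extensionalityI[OF realization_hom_extensional(1)], simp)
    fix e assume e: "e \<in> topspace (total_space A TA X)"
    then show "fst ?F e = ?\<phi> e"
    proof (rule total_spaceE)
      fix \<sigma> \<alpha> a assume eq: "e = glue_rel A TA X `` {(\<sigma>, \<alpha>, a)}" and p: "(\<sigma>, \<alpha>, a) \<in> topspace (glue_space TA X)"
      note p' = p[unfolded topspace_glue_iff]
      have q: "(f ` \<sigma>, push (Vert X) f \<alpha>, a \<otimes> inv (\<kappa> \<sigma>)) \<in> topspace (glue_space TA Y)"
        using p' mono_homD(2,4)[OF f] push_in_simplex(1)[OF monomial_complex_simplex(1)[OF X] finX, of \<sigma> \<alpha> f]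
        by (simp add: topspace_glue_iff)
      have "fst ?F e = glue_rel A TA Z `` {(g ` f ` \<sigma>, push (Vert Y) g (push (Vert X) f \<alpha>),
          a \<otimes> inv (\<mu> (f ` \<sigma>) \<otimes> \<kappa> \<sigma>))}"
        using realization_hom_class[OF X Z finX gf p] p'
          compose_image_subset[OF monomial_complex_simplex(1)[OF X], of \<sigma> g f]
        by (simp add: mono_comp_def eq push)
      also have "a \<otimes> inv (\<mu> (f ` \<sigma>) \<otimes> \<kappa> \<sigma>) = a \<otimes> inv (\<kappa> \<sigma>) \<otimes> inv (\<mu> (f ` \<sigma>))"
        using p' mono_homD(2,4)[OF f] mono_homD(4)[OF g] by (simp add: inv_mult_group m_assoc)
      also have "glue_rel A TA Z `` {(g ` f ` \<sigma>, push (Vert Y) g (push (Vert X) f \<alpha>),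
          a \<otimes> inv (\<kappa> \<sigma>) \<otimes> inv (\<mu> (f ` \<sigma>)))} = ?\<phi> e"
        using realization_hom_class[OF X Y finX f p] realization_hom_class[OF Y Z finY g q] e
        by (simp add: eq compose_def)
      finally show ?thesis .
    qed
  qed
  ultimately show ?thesis
    by (simp add: prod_eq_iff)
qed

lemma is_functor_realization: "is_functor (simp_cat A) (top_cat A TA) (realization_functor A TA)"
  unfolding is_functor_def
proof (intro conjI ballI is_category_simp_cat is_category_top_cat)
  fix X :: "('s, 'a) mono_complex" assume "X \<in> Ob (simp_cat A)"
  then have X: "monomial_complex A X" "finite (Vert X)"
    by (simp_all add: simp_cat_def)
  show "on_ob (realization_functor A TA) X \<in> Ob (top_cat A TA)"
    using fibered_bundle_realization[OF X] by (simp add: realization_functor_def top_cat_def)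
  show "on_hom (realization_functor A TA) X X (Idn (simp_cat A) X) =
      Idn (top_cat A TA) (on_ob (realization_functor A TA) X)"
    using realization_hom_id[OF X]
    by (simp add: simp_cat_def realization_functor_def top_cat_def)
  fix Y :: "('s, 'a) mono_complex" and f assume "Y \<in> Ob (simp_cat A)" and "f \<in> Hom (simp_cat A) X Y"
  then have Y: "monomial_complex A Y" "finite (Vert Y)" and f: "(fst f, snd f) \<in> mono_hom A X Y"
    by (simp_all add: simp_cat_def)
  show "on_hom (realization_functor A TA) X Y f \<in>
      Hom (top_cat A TA) (on_ob (realization_functor A TA) X) (on_ob (realization_functor A TA) Y)"
    using realization_hom_in_bundle_hom[OF X Y f] by (simp add: realization_functor_def top_cat_def)
  fix Z :: "('s, 'a) mono_complex" and g assume "Z \<in> Ob (simp_cat A)" and "g \<in> Hom (simp_cat A) Y Z"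
  then have Z: "monomial_complex A Z" "finite (Vert Z)" and g: "(fst g, snd g) \<in> mono_hom A Y Z"
    by (simp_all add: simp_cat_def)
  show "on_hom (realization_functor A TA) X Z (Cmp (simp_cat A) X Y Z g f) =
      Cmp (top_cat A TA) (on_ob (realization_functor A TA) X) (on_ob (realization_functor A TA) Y)
        (on_ob (realization_functor A TA) Z) (on_hom (realization_functor A TA) Y Z g)
        (on_hom (realization_functor A TA) X Y f)"
    using realization_hom_comp[OF X Y Z f g]
    by (simp add: simp_cat_def realization_functor_def top_cat_def case_prod_unfold)
qed

end

theorem lemma5p8:
  fixes A :: "('a, 'g) monoid_scheme" and TA :: "'a topology"
  assumes "topological_group A TA"
  shows
    "(\<forall>(X :: ('s, 'a) mono_complex) (Y :: ('t, 'a) mono_complex) f \<kappa> f' \<kappa>'.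
        X \<in> Ob (simp_cat A) \<and> Y \<in> Ob (simp_cat A) \<and>
        (f, \<kappa>) \<in> mono_hom A X Y \<and> (f', \<kappa>') \<in> mono_hom A X Y \<and>
        ((f, \<kappa>), (f', \<kappa>')) \<in> simp_homotopic A X Y \<longrightarrow>
          (realization_hom A TA X Y (f, \<kappa>), realization_hom A TA X Y (f', \<kappa>'))
            \<in> bundle_homotopic A (realization A TA X) (realization A TA Y)) \<and>
     (let \<C> = (simp_cat A :: (('s, 'a) mono_complex, _) category);
          \<D> = top_cat A TA;
          R = realization_functor A TA;
          H\<C> = quotient_category \<C> (simp_homotopic A);
          H\<D> = quotient_category \<D> (bundle_homotopic A);
          Q = quotient_functor (simp_homotopic A);
          Q' = quotient_functor (bundle_homotopic A)
      in is_functor \<C> \<D> R \<and> is_functor \<C> H\<C> Q \<and> is_functor \<D> H\<D> Q' \<and>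
         (\<exists>F. is_functor H\<C> H\<D> F \<and>
              functor_eq \<C> (functor_comp F Q) (functor_comp Q' R)))"
proof -
  interpret topological_group A TA by fact
  \<comment> \<open>The functors live on a single vertex type, whereas the first claim allows two.
    So the general lemma is used twice, here in the form that \<open>induced_functor\<close>
    expects.\<close>
  have homotopic: "(on_hom (realization_functor A TA) X Y f, on_hom (realization_functor A TA) X Y f')
      \<in> bundle_homotopic A (on_ob (realization_functor A TA) X) (on_ob (realization_functor A TA) Y)"
    if "X \<in> Ob (simp_cat A)" "Y \<in> Ob (simp_cat A)" "(f, f') \<in> simp_homotopic A X Y"
    for X Y :: "('s, 'a) mono_complex" and f f'
    using that simp_homotopic_imp_bundle_homotopic[of X Y f f']
    by (simp add: simp_cat_def realization_functor_def)
  show ?thesis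
    unfolding Let_def
    using simp_homotopic_imp_bundle_homotopic
    by (intro conjI is_functor_realization
        is_functor_quotient[OF is_category_simp_cat simp_homotopic_congruence]
        is_functor_quotient[OF is_category_top_cat bundle_homotopic_congruence]
        induced_functor[OF is_functor_realization simp_homotopic_congruence bundle_homotopic_congruence homotopic])
      (auto simp: simp_cat_def)
qed

end
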